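(* For $\mathfrak g=A_2$, let $\lambda\in\mathfrak h^*_{\mathbb R}$ lie on at least two vanishing lines, one of which is $P(n_i,\alpha_i)$ with $i\in\{1,2\}$ and $n_i\ge1$, and let $j=3-i$. Then for all sufficiently small $\epsilon,\delta$ with $0<\delta<\epsilon$, $$\sigma(\lambda)=\frac{\sum_{s,s'\in\{+1,-1\}}\tilde f\big(a(\lambda+s\epsilon\Lambda_j+s'\delta\alpha_i)\big)}{4(1-x_1^2)(1-x_2^2)(1-x_1^2x_2^2)},$$ i.e. $\sigma(\lambda)$ is the average of the values of $f$ on the four regions having $\lambda$ as a corner and a segment of $P(n_i,\alpha_i)$ as an edge.
   Context: $\mathfrak g=A_2$ with simple roots $\alpha_1,\alpha_2$, $(\alpha_1,\alpha_1)=(\alpha_2,\alpha_2)=2$, $(\alpha_1,\alpha_2)=-1$, $\alpha_3=\alpha_1+\alpha_2$, $\Delta_+=\{\alpha_1,\alpha_2,\alpha_3\}$, $\rho=\alpha_3$; $\mathfrak h^*_{\mathbb R}$ is the real span of $\alpha_1,\alpha_2$; fundamental weights $\Lambda_1,\Lambda_2$ satisfy $(\Lambda_k,\alpha_l)=\delta_{kl}$. Vanishing lines: $P(n,\alpha)=\{\lambda:(\alpha,\lambda+\rho)=n\}$, $n\in\mathbb Z_{\ge1}$, $\alpha\in\Delta_+$. For $\lambda\in\mathfrak h^*_{\mathbb R}$, $V(\lambda)$ is the Verma module with highest weight vector $|\lambda\rangle$; the Shapovalov form is the unique bilinear form with $\langle\lambda|\lambda\rangle=1$, $\langle x\lambda,y\lambda\rangle=\langle\lambda,x^\dagger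 y\lambda\rangle$, $\dagger$ the anti-automorphism with $H_i^\dagger=H_i$, $E_{\pm\alpha_i}^\dagger=E_{\mp\alpha_i}$. $M_{(m_1,m_2)}(\lambda)$ is its real symmetric Gram matrix on the weight space of weight $\lambda-m_1\alpha_1-m_2\alpha_2$, and $\sigma(\lambda)=\sum_{m_1,m_2\ge0}{\rm sig}(M_{(m_1,m_2)}(\lambda))x_1^{m_1}x_2^{m_2}$ (sig = #positive − #negative eigenvalues). For $\mu\in\mathfrak h^*_{\mathbb R}$, $a(\mu)=(a_1,a_2,a_3)$ with $a_k=\max(0,\lfloor(\alpha_k,\mu+\rho)\rfloor)$, and $\tilde f(a_1,a_2,a_3)=(1+x_1)(1+x_2)(1+x_1x_2)-2x_1^{a_1+1}(1+x_2)(1+x_1x_2)-2x_2^{a_2+1}(1+x_1)(1+x_1x_2)-2(x_1x_2)^{a_3+1}(1+x_1)(1+x_2)+4x_1^{a_1+1}(x_1x_2)^{\min(a_2,a_3)+1}(1+x_2)+4x_2^{a_2+1}(x_1x_2)^{\min(a_1,a_3)+1}(1+x_1)+4x_1^{\max(a_1,a_3)+1}x_2^{\max(a_2,a_3)+1}(1+x_1x_2)-8x_1^{\min(a_2,a_3)+a_1+2}x_2^{\min(a_1,a_3)+a_2+2}$. *)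

theory Defs
  imports "Jordan_Normal_Form.Char_Poly" "HOL-Computational_Algebra.Formal_Power_Series"
    "HOL-Analysis.Product_Vector"
begin

text \<open>An element of the real span of alpha1, alpha2 is represented by its coordinates
  (c1, c2) meaning c1*alpha1 + c2*alpha2.\<close>

type_synonym wt = "real \<times> real"

definition ip :: "wt \<Rightarrow> wt \<Rightarrow> real" where
  "ip x y = 2 * fst x * fst y - fst x * snd y - snd x * fst y + 2 * snd x * snd y"

definition alpha :: "nat \<Rightarrow> wt" where
  "alpha k = (if k = 1 then (1, 0) else if k = 2 then (0, 1) else if k = 3 then (1, 1) else (0, 0))"

definition rho :: wt where "rho = (1, 1)"

text \<open>Fundamental weights: (Lambda k, alpha l) = delta kl.\<close>
definition Lambda :: "nat \<Rightarrow> wt" where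
  "Lambda k = (if k = 1 then (2/3, 1/3) else if k = 2 then (1/3, 2/3) else (0, 0))"

definition on_vline :: "nat \<Rightarrow> nat \<Rightarrow> wt \<Rightarrow> bool" where
  "on_vline n k l \<longleftrightarrow> n \<ge> 1 \<and> k \<in> {1, 2, 3} \<and> ip (alpha k) (l + rho) = real n"

text \<open>A word [j1,...,jk] (entries 1 or 2) stands for F_{j1} ... F_{jk} |lambda>;
  a vector is a finite linear combination of words.\<close>

type_synonym comb = "(real \<times> nat list) list"

text \<open>Eigenvalue of H_i on the weight vector w|lambda> (weight lambda - wt(w)).\<close>
definition hval :: "wt \<Rightarrow> nat \<Rightarrow> nat list \<Rightarrow> real" where
  "hval l i w = ip (alpha i) l - sum_list (map (\<lambda>k. ip (alpha i) (alpha k)) w)"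

text \<open>Action of E_i on w|lambda>, using [E_i, F_j] = delta_ij H_i and E_i|lambda> = 0.\<close>
fun eword :: "wt \<Rightarrow> nat \<Rightarrow> nat list \<Rightarrow> comb" where
  "eword l i [] = []"
| "eword l i (j # w) =
     map (\<lambda>(c, u). (c, j # u)) (eword l i w) @ (if i = j then [(hval l i w, w)] else [])"

definition eact :: "wt \<Rightarrow> nat \<Rightarrow> comb \<Rightarrow> comb" where
  "eact l i v = concat (map (\<lambda>(c, w). map (\<lambda>(d, u). (c * d, u)) (eword l i w)) v)"

definition top_coeff :: "comb \<Rightarrow> real" where
  "top_coeff v = sum_list (map (\<lambda>(c, u). if u = [] then c else 0) v)"

text \<open><w|lambda>, v> = <lambda| w^dagger v>, with (F_j w)^dagger = w^dagger E_j.\<close>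
fun pair :: "wt \<Rightarrow> nat list \<Rightarrow> comb \<Rightarrow> real" where
  "pair l [] v = top_coeff v"
| "pair l (j # w) v = pair l w (eact l j v)"

definition shap :: "wt \<Rightarrow> comb \<Rightarrow> comb \<Rightarrow> real" where
  "shap l v v' = sum_list (map (\<lambda>(c, w). c * pair l w v') v)"

definition cmul :: "comb \<Rightarrow> comb \<Rightarrow> comb" where
  "cmul v v' = concat (map (\<lambda>(c, w). map (\<lambda>(d, u). (c * d, w @ u)) v') v)"

fun cpow :: "comb \<Rightarrow> nat \<Rightarrow> comb" where
  "cpow v 0 = [(1, [])]"
| "cpow v (Suc n) = cmul v (cpow v n)"

definition F1 :: comb where "F1 = [(1, [1])]"
definition F2 :: comb where "F2 = [(1, [2])]"
definition F3 :: comb where "F3 = [(1, [2, 1]), (-1, [1, 2])]"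

text \<open>PBW basis of the weight space of weight lambda - m1 alpha1 - m2 alpha2:
  F1^(m1-c) F3^c F2^(m2-c), c = 0..min m1 m2.\<close>
definition pbw :: "nat \<Rightarrow> nat \<Rightarrow> nat \<Rightarrow> comb" where
  "pbw m1 m2 c = cmul (cpow F1 (m1 - c)) (cmul (cpow F3 c) (cpow F2 (m2 - c)))"

definition gram :: "wt \<Rightarrow> nat \<Rightarrow> nat \<Rightarrow> real mat" where
  "gram l m1 m2 = mat (Suc (min m1 m2)) (Suc (min m1 m2))
      (\<lambda>(a, b). shap l (pbw m1 m2 a) (pbw m1 m2 b))"

definition sig :: "real mat \<Rightarrow> int" where
  "sig A = int (\<Sum>r\<in>{r. r > 0 \<and> poly (char_poly A) r = 0}. order r (char_poly A))
         - int (\<Sum>r\<in>{r. r < 0 \<and> poly (char_poly A) r = 0}. order r (char_poly A))"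

text \<open>int fps fps: outer variable x2, inner variable x1.\<close>
definition X1 :: "int fps fps" where "X1 = fps_const fps_X"
definition X2 :: "int fps fps" where "X2 = fps_X"

definition sigma :: "wt \<Rightarrow> int fps fps" where
  "sigma l = Abs_fps (\<lambda>m2. Abs_fps (\<lambda>m1. sig (gram l m1 m2)))"

definition avec :: "wt \<Rightarrow> nat \<times> nat \<times> nat" where
  "avec mu = (nat \<lfloor>ip (alpha 1) (mu + rho)\<rfloor>, nat \<lfloor>ip (alpha 2) (mu + rho)\<rfloor>,
              nat \<lfloor>ip (alpha 3) (mu + rho)\<rfloor>)"

definition ftilde :: "nat \<times> nat \<times> nat \<Rightarrow> int fps fps" where
  "ftilde a = (case a of (a1, a2, a3) \<Rightarrow>
       (1 + X1) * (1 + X2) * (1 + X1 * X2)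
     - 2 * X1 ^ (a1 + 1) * (1 + X2) * (1 + X1 * X2)
     - 2 * X2 ^ (a2 + 1) * (1 + X1) * (1 + X1 * X2)
     - 2 * (X1 * X2) ^ (a3 + 1) * (1 + X1) * (1 + X2)
     + 4 * X1 ^ (a1 + 1) * (X1 * X2) ^ (min a2 a3 + 1) * (1 + X2)
     + 4 * X2 ^ (a2 + 1) * (X1 * X2) ^ (min a1 a3 + 1) * (1 + X1)
     + 4 * X1 ^ (max a1 a3 + 1) * X2 ^ (max a2 a3 + 1) * (1 + X1 * X2)
     - 8 * X1 ^ (min a2 a3 + a1 + 2) * X2 ^ (min a1 a3 + a2 + 2))"

end

theory Submission
  imports Defs "Jordan_Normal_Form.Schur_Decomposition" "HOL-Library.Function_Algebras"
begin

text \<open>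
  A point on two vanishing lines, one of them for a simple root, is integral. Say it lies on a line for
  \<open>\<alpha>\<^sub>1\<close> and put \<open>a = (\<alpha>\<^sub>1, \<lambda> + \<rho>) > 0\<close>,
  \<open>b = (\<alpha>\<^sub>2, \<lambda> + \<rho>)\<close>; then \<open>a\<close>, \<open>b\<close> are integers with \<open>a + b > 0\<close>. Restricting the Verma module to
  the \<open>sl\<^sub>2\<close> of \<open>\<alpha>\<^sub>1\<close> gives Gelfand-Tsetlin vectors \<open>F\<^sub>1\<^sup>k u\<^sub>p\<^sub>q\<close>, where \<open>u\<^sub>p\<^sub>q\<close> is killed by \<open>E\<^sub>1\<close>. Those
  with \<open>p < min a (a + b)\<close> and \<open>k < a + q - p\<close> are orthogonal, their span plus the radical is stable
  under \<open>F\<^sub>1\<close> and \<open>F\<^sub>2\<close> and hence is everything, and the sign of their norm is that of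
  \<open>(b - 1)\<cdots>(b - q)\<close>. By Sylvester's law of inertia this yields every signature, the generating
  function is then a double geometric series, and comparing it with the average of \<open>ftilde\<close>
  is a polynomial identity. The case of \<open>\<alpha>\<^sub>2\<close> follows from the diagram automorphism.
\<close>

section \<open>Spectral theorem and inertia\<close>

text \<open>The form is degenerate at such a point, so the argument runs modulo its radical and
  directly at \<lambda>, with no limit from the adjacent regions. Restricting to the simple root
  whose line passes through \<lambda> makes a a positive integer. Then a + q - p > 0 for all p < min
  a (a + b), which keeps the denominators of the Gelfand-Tsetlin formulas positive, and F_1^(a + q -
  p) u_pq is singular modulo the radical, which ends each string. The bound on p comes from E_2
  u_pq: its component along F_1 u_(p-1)q carries the factor p (a - p) (a + b - p), which is positive
  for 0 < p < min a (a + b) and vanishes at p = min a (a + b). The vectors need not be independent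
  modulo the radical: for b \<ge> 1 those with q \<ge> b have norm 0, and the law of inertia is
  stated so that zero norms are harmless. For b \<le> 0 the signs are (-1)^q, so two kinds of
  generating functions arise. Modelling the Verma module by coefficient functions makes the
  independence of the PBW monomials automatic; in exchange the commutation relations and the
  symmetry of the form have to be verified.\<close>

lemma real_scalar_prod_ge_0: "(v :: real vec) \<bullet> v \<ge> 0"
  by (simp add: scalar_prod_def sum_nonneg)

text \<open>A complex eigenvalue exists and satisfies z <v,v> = <Cv,v> = <v,Cv> = cnj z <v,v> for
  the Hermitian product, so it is real; \<open>char_poly\<close> commutes with the embedding, which
  brings the root back to the reals.\<close>

lemma symmetric_has_real_eigenvalue:
  fixes A :: "real mat"
  assumes A: "A \<in> carrier_mat n n" and sym: "transpose_mat A = A" and n: "n > 0"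
  shows "\<exists>e. eigenvalue A e"
proof -
  let ?h = "of_real :: real \<Rightarrow> complex"
  interpret of_real_hom: inj_comm_ring_hom ?h
    by unfold_locales auto
  let ?C = "map_mat ?h A"
  have C: "?C \<in> carrier_mat n n" using A by auto
  obtain z where z: "poly (char_poly ?C) z = 0"
    using degree_monic_char_poly[OF C] n
    by (metis (no_types, lifting) constant_degree fundamental_theorem_of_algebra not_gr_zero)
  then have "eigenvalue ?C z" using eigenvalue_root_char_poly[OF C] by simp
  then obtain v where v: "v \<in> carrier_vec n" "v \<noteq> 0\<^sub>v n" "?C *\<^sub>v v = z \<cdot>\<^sub>v v"
    unfolding eigenvalue_def eigenvector_def using C by auto
  have Cs: "transpose_mat ?C = ?C"
    using sym by (metis map_mat_transpose)
  have conjC: "conjugate (?C *\<^sub>v v) = ?C *\<^sub>v conjugate v"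
    using A v(1) by (intro eq_vecI) (auto simp: scalar_prod_def)
  have "(?C *\<^sub>v v) \<bullet>c v = z * (v \<bullet>c v)"
    using v by simp
  moreover have "(?C *\<^sub>v v) \<bullet>c v = v \<bullet> (?C *\<^sub>v conjugate v)"
    using transpose_vec_mult_scalar[OF C, of "conjugate v" v] v(1) Cs C
    by (metis carrier_vec_conjugate)
  moreover have "v \<bullet> (?C *\<^sub>v conjugate v) = v \<bullet>c (z \<cdot>\<^sub>v v)"
    using conjC v(3) by simp
  moreover have "v \<bullet>c (z \<cdot>\<^sub>v v) = cnj z * (v \<bullet>c v)"
    using v(1) by (simp add: conjugate_smult_vec)
  moreover have "v \<bullet>c v \<noteq> 0" using v by simp
  ultimately have "z = cnj z" by simp
  then obtain e where e: "z = ?h e" by (metis Reals_cnj_iff Reals_cases)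
  have "poly (char_poly A) e = 0"
    using z unfolding e of_real_hom.char_poly_hom[OF A] by simp
  then show ?thesis using eigenvalue_root_char_poly[OF A] by blast
qed

text \<open>Gram-Schmidt on a basis completed from \<open>v\<close>, with the columns rescaled to
  length 1. The first column stays proportional to \<open>v\<close>, which is what deflation
  needs.\<close>

lemma mat_of_cols_orthonormal:
  fixes v :: "real vec"
  assumes v: "v \<in> carrier_vec n" "v \<noteq> 0\<^sub>v n"
  shows "\<exists>W \<in> carrier_mat n n. transpose_mat W * W = 1\<^sub>m n \<and> (\<exists>c. c \<noteq> 0 \<and> col W 0 = c \<cdot>\<^sub>v v)"
proof -
  interpret cof_vec_space n "TYPE(real)" .
  define b where "b = basis_completion v"
  define ws where "ws = gram_schmidt n b"
  have n: "n \<noteq> 0" using v by auto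
  from basis_completion[OF v, folded b_def]
  have span_b: "span (set b) = carrier_vec n" and dist_b: "distinct b"
    and indep: "\<not> lin_dep (set b)" and b: "set b \<subseteq> carrier_vec n" and hdb: "hd b = v"
    and len_b: "length b = n" by auto
  from hdb len_b n obtain vs where bv: "b = v # vs" by (cases b, auto)
  from gram_schmidt_result[OF b dist_b indep refl, folded ws_def]
  have ws: "set ws \<subseteq> carrier_vec n" "corthogonal ws" "length ws = n"
    by (auto simp: len_b)
  from gram_schmidt_hd[OF v(1), of vs, folded bv] have hdws: "hd ws = v" unfolding ws_def .
  define r where "r i = 1 / sqrt (ws ! i \<bullet> ws ! i)" for i
  define W where "W = mat n n (\<lambda>(i,j). r j * (ws ! j) $ i)"
  have W: "W \<in> carrier_mat n n" by (simp add: W_def)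
  have wsc: "ws ! i \<in> carrier_vec n" if "i < n" for i using ws that by auto
  have orth: "ws ! i \<bullet> ws ! j = 0 \<longleftrightarrow> i \<noteq> j" if "i < n" "j < n" for i j
    using corthogonalD[OF ws(2), of i j] that ws(3) wsc[of j]
    by (simp add: conjugate_vec_def scalar_prod_def)
  have pos: "ws ! i \<bullet> ws ! i > 0" if "i < n" for i
    using real_scalar_prod_ge_0[of "ws ! i"] orth[OF that that] by linarith
  have WW: "(transpose_mat W * W) $$ (i,j) = (if i = j then 1 else 0)" if "i < n" "j < n" for i j
  proof -
    have "(transpose_mat W * W) $$ (i,j) = (\<Sum>k<n. (r i * (ws ! i) $ k) * (r j * (ws ! j) $ k))"
      using that by (simp add: W_def scalar_prod_def atLeast0LessThan)
    also have "\<dots> = r i * r j * (ws ! i \<bullet> ws ! j)"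
      using wsc[OF that(2)] by (simp add: scalar_prod_def atLeast0LessThan sum_distrib_left mult_ac)
    also have "\<dots> = (if i = j then 1 else 0)"
      using orth[OF that] pos[OF that(1)] by (auto simp: r_def)
    finally show ?thesis .
  qed
  have "transpose_mat W * W = 1\<^sub>m n"
    by (rule eq_matI) (use W WW in auto)
  moreover have "col W 0 = r 0 \<cdot>\<^sub>v v"
  proof -
    have "ws ! 0 = v" using hdws ws(3) n by (cases ws) auto
    then show ?thesis using n v(1) by (intro eq_vecI) (auto simp: W_def)
  qed
  moreover have "r 0 \<noteq> 0" using pos[of 0] n by (simp add: r_def)
  ultimately show ?thesis using W by blast
qed

lemma mult_mat_regroup:
  fixes A :: "'a :: semiring_0 mat"
  assumes A: "A \<in> carrier_mat n n" and B: "B \<in> carrier_mat n n" and C: "C \<in> carrier_mat n n"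
    and D: "D \<in> carrier_mat n n" and E: "E \<in> carrier_mat n n"
  shows "A * B * C * (D * E) = A * (B * C * D) * E"
proof -
  have "A * B * C * (D * E) = A * B * C * D * E"
    using assms by (intro assoc_mult_mat[symmetric]) auto
  also have "A * B * C * D = A * (B * C) * D"
    using assoc_mult_mat[OF A B C] by simp
  also have "\<dots> = A * (B * C * D)"
    using assms by (intro assoc_mult_mat) auto
  finally show ?thesis .
qed

text \<open>Deflation: conjugated by an orthogonal matrix whose first column is an eigenvector, a
  symmetric matrix splits into a 1 by 1 block and a smaller symmetric block.\<close>

lemma real_spectral:
  fixes A :: "real mat"
  assumes "A \<in> carrier_mat n n" and "transpose_mat A = A"
  shows "\<exists>P \<in> carrier_mat n n. \<exists>e. transpose_mat P * P = 1\<^sub>m n \<and>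
           A = P * mat n n (\<lambda>(i,j). if i = j then e i else 0) * transpose_mat P"
  using assms
proof (induction n arbitrary: A)
  case 0
  then show ?case by (intro bexI[of _ "1\<^sub>m 0"] exI[of _ "\<lambda>_. 0"]) auto
next
  case (Suc n)
  note A = Suc.prems(1) and sym = Suc.prems(2)
  obtain e0 where "eigenvalue A e0"
    using symmetric_has_real_eigenvalue[OF A sym] by auto
  then obtain v where v: "v \<in> carrier_vec (Suc n)" "v \<noteq> 0\<^sub>v (Suc n)" and Av: "A *\<^sub>v v = e0 \<cdot>\<^sub>v v"
    unfolding eigenvalue_def eigenvector_def using A by auto
  obtain W c where W: "W \<in> carrier_mat (Suc n) (Suc n)" and WW: "transpose_mat W * W = 1\<^sub>m (Suc n)"
    and c: "col W 0 = c \<cdot>\<^sub>v v" using mat_of_cols_orthonormal[OF v] by auto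
  have Wt: "transpose_mat W \<in> carrier_mat (Suc n) (Suc n)" using W by simp
  have WW': "W * transpose_mat W = 1\<^sub>m (Suc n)"
    using mat_mult_left_right_inverse[OF Wt W WW] .
  define A' where "A' = transpose_mat W * A * W"
  have A': "A' \<in> carrier_mat (Suc n) (Suc n)" unfolding A'_def using A W by auto
  have A's: "transpose_mat A' = A'"
  proof -
    have "transpose_mat A' = transpose_mat W * transpose_mat (transpose_mat W * A)"
      unfolding A'_def using A W Wt by (subst transpose_mult) auto
    also have "\<dots> = transpose_mat W * (transpose_mat A * W)"
      using A W Wt by (subst transpose_mult) auto
    also have "\<dots> = A'" unfolding A'_def sym using A W Wt by auto
    finally show ?thesis .
  qed
  have eig: "A *\<^sub>v col W 0 = e0 \<cdot>\<^sub>v col W 0"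
    unfolding c using Av v(1) A by (simp add: mult_mat_vec smult_smult_assoc mult.commute)
  have W0: "col W 0 \<in> carrier_vec (Suc n)"
    using W unfolding carrier_vec_def by simp
  have "col A' 0 = transpose_mat W *\<^sub>v (A *\<^sub>v col W 0)"
    unfolding A'_def assoc_mult_mat_vec[OF Wt A W0, symmetric]
    by (rule col_mult2[of _ "Suc n" "Suc n" _ "Suc n"]) (use A W in auto)
  also have "\<dots> = e0 \<cdot>\<^sub>v col (transpose_mat W * W) 0"
    unfolding eig mult_mat_vec[OF Wt W0] by (subst col_mult2[OF Wt W]) auto
  finally have col0: "A' $$ (i, 0) = (if i = 0 then e0 else 0)" if "i < Suc n" for i
  proof -
    assume *: "col A' 0 = e0 \<cdot>\<^sub>v col (transpose_mat W * W) 0"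
    have "A' $$ (i,0) = col A' 0 $ i" using that A' by simp
    then show ?thesis unfolding * WW using that by simp
  qed
  have symi: "A' $$ (i,j) = A' $$ (j,i)" if "i < Suc n" "j < Suc n" for i j
    using that A' A's by (metis carrier_matD index_transpose_mat(1))
  define B where "B = mat n n (\<lambda>(i,j). A' $$ (Suc i, Suc j))"
  have B: "B \<in> carrier_mat n n" by (simp add: B_def)
  have "transpose_mat B = B"
    by (rule eq_matI) (auto simp: B_def intro!: symi)
  from Suc.IH[OF B this] obtain Q e where Q: "Q \<in> carrier_mat n n"
    and QQ: "transpose_mat Q * Q = 1\<^sub>m n"
    and BQ: "B = Q * mat n n (\<lambda>(i,j). if i = j then e i else 0) * transpose_mat Q" by auto
  define R where "R = four_block_mat (1\<^sub>m 1) (0\<^sub>m 1 n) (0\<^sub>m n 1) Q"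
  have R: "R \<in> carrier_mat (Suc n) (Suc n)"
    unfolding R_def using four_block_carrier_mat[OF one_carrier_mat[of 1] Q] by simp
  have Rt: "transpose_mat R = four_block_mat (1\<^sub>m 1) (0\<^sub>m 1 n) (0\<^sub>m n 1) (transpose_mat Q)"
    unfolding R_def by (subst transpose_four_block_mat[of _ 1 1 _ n _ n]) (use Q in auto)
  have RR: "transpose_mat R * R = 1\<^sub>m (Suc n)"
    unfolding Rt unfolding R_def
    by (subst mult_four_block_mat[of _ 1 1 _ n _ n _ _ 1 _ n]) (use Q QQ in auto)
  define e' where "e' i = (case i of 0 \<Rightarrow> e0 | Suc k \<Rightarrow> e k)" for i
  let ?D = "mat n n (\<lambda>(i,j). if i = j then e i else 0)"
  let ?D' = "mat (Suc n) (Suc n) (\<lambda>(i,j). if i = j then e' i else 0)"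
  have D': "?D' = four_block_mat (mat 1 1 (\<lambda>_. e0)) (0\<^sub>m 1 n) (0\<^sub>m n 1) ?D"
    by (rule eq_matI) (auto simp: e'_def split: nat.splits)
  have A'B: "A' = four_block_mat (mat 1 1 (\<lambda>_. e0)) (0\<^sub>m 1 n) (0\<^sub>m n 1) B"
  proof (rule eq_matI)
    fix i j
    assume "i < dim_row (four_block_mat (mat 1 1 (\<lambda>_. e0)) (0\<^sub>m 1 n) (0\<^sub>m n 1) B)"
      "j < dim_col (four_block_mat (mat 1 1 (\<lambda>_. e0)) (0\<^sub>m 1 n) (0\<^sub>m n 1) B)"
    then have ij: "i < Suc n" "j < Suc n" by (simp_all add: B_def)
    show "A' $$ (i,j) = four_block_mat (mat 1 1 (\<lambda>_. e0)) (0\<^sub>m 1 n) (0\<^sub>m n 1) B $$ (i,j)"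
      using ij col0[of i] col0[of j] symi[of 0 j]
      by (cases i; cases j) (auto simp: B_def)
  qed (use A' B in auto)
  have RD: "R * ?D' = four_block_mat (mat 1 1 (\<lambda>_. e0)) (0\<^sub>m 1 n) (0\<^sub>m n 1) (Q * ?D)"
    unfolding R_def D'
    by (subst mult_four_block_mat[of _ 1 1 _ n _ n _ _ 1 _ n]) (use Q in auto)
  have "R * ?D' * transpose_mat R = A'"
    unfolding RD Rt A'B BQ
    by (subst mult_four_block_mat[of _ 1 1 _ n _ n _ _ 1 _ n]) (use Q in auto)
  define P where "P = W * R"
  have P: "P \<in> carrier_mat (Suc n) (Suc n)" unfolding P_def using W R by auto
  have Rtc: "transpose_mat R \<in> carrier_mat (Suc n) (Suc n)" using R by simp
  have D'c: "?D' \<in> carrier_mat (Suc n) (Suc n)" by simp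
  have Pt: "transpose_mat P = transpose_mat R * transpose_mat W"
    unfolding P_def using W R by (simp add: transpose_mult)
  have "transpose_mat P * P = transpose_mat R * transpose_mat W * 1\<^sub>m (Suc n) * (W * R)"
    unfolding Pt unfolding P_def right_mult_one_mat[OF mult_carrier_mat[OF Rtc Wt]] ..
  also have "\<dots> = transpose_mat R * (transpose_mat W * 1\<^sub>m (Suc n) * W) * R"
    using Rtc Wt W R by (intro mult_mat_regroup) auto
  also have "\<dots> = 1\<^sub>m (Suc n)"
    unfolding right_mult_one_mat[OF Wt] WW right_mult_one_mat[OF Rtc] by (rule RR)
  finally have PP: "transpose_mat P * P = 1\<^sub>m (Suc n)" .
  have "P * ?D' * transpose_mat P = W * (R * ?D' * transpose_mat R) * transpose_mat W"
    unfolding Pt unfolding P_def using W R Wt Rtc D'c by (intro mult_mat_regroup) auto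
  also have "\<dots> = W * (transpose_mat W * A * W) * transpose_mat W"
    unfolding \<open>R * ?D' * transpose_mat R = A'\<close> A'_def ..
  also have "\<dots> = W * transpose_mat W * A * (W * transpose_mat W)"
    using W Wt A by (intro mult_mat_regroup[symmetric]) auto
  also have "\<dots> = A" unfolding WW' using A by simp
  finally have "A = P * ?D' * transpose_mat P" by simp
  with P PP show ?case by blast
qed

section \<open>Sylvester's law of inertia\<close>

lemma homogeneous_system_nontrivial:
  fixes S :: "nat \<Rightarrow> nat \<Rightarrow> real"
  assumes "finite J" "finite I" "card J < card I"
  shows "\<exists>x. (\<exists>i\<in>I. x i \<noteq> 0) \<and> (\<forall>j\<in>J. (\<Sum>i\<in>I. S j i * x i) = 0)"
  using assms
proof (induction J arbitrary: I S rule: finite_induct)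
  case empty
  then have "I \<noteq> {}" by auto
  then show ?case by (intro exI[of _ "\<lambda>_. 1"]) auto
next
  case (insert j J)
  show ?case
  proof (cases "\<forall>i\<in>I. S j i = 0")
    case True
    then show ?thesis using insert.IH[of I S] insert.prems insert.hyps by auto
  next
    case False
    then obtain i0 where i0: "i0 \<in> I" "S j i0 \<noteq> 0" by auto
    let ?I = "I - {i0}"
    \<comment> \<open>The system after the unknown \<open>x i0\<close> has been eliminated by means
      of equation \<open>j\<close>; \<open>t\<close> below is the resulting value of that
      unknown.\<close>
    define S' where "S' k i = S k i - S k i0 * S j i / S j i0" for k i
    have "finite ?I" "card J < card ?I" using insert.prems insert.hyps i0 by auto
    from insert.IH[OF this, of S'] obtain x i1 where x: "i1 \<in> ?I" "x i1 \<noteq> 0"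
      "\<And>k. k \<in> J \<Longrightarrow> (\<Sum>i\<in>?I. S' k i * x i) = 0" by auto
    define t where "t = - (\<Sum>i\<in>?I. S j i * x i) / S j i0"
    define y where "y = x(i0 := t)"
    have sum_y: "(\<Sum>i\<in>I. S k i * y i) = S k i0 * t + (\<Sum>i\<in>?I. S k i * x i)" for k
      using i0 insert.prems by (subst sum.remove[of I i0]) (auto simp: y_def intro!: sum.cong)
    have "(\<Sum>i\<in>I. S j i * y i) = 0"
      unfolding sum_y t_def using i0 by simp
    moreover have "(\<Sum>i\<in>I. S k i * y i) = 0" if "k \<in> J" for k
    proof -
      have "0 = (\<Sum>i\<in>?I. S k i * x i) - (\<Sum>i\<in>?I. S k i0 / S j i0 * (S j i * x i))"
        using x(3)[OF that] by (simp add: S'_def algebra_simps sum_subtractf)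
      also have "\<dots> = (\<Sum>i\<in>I. S k i * y i)"
        unfolding sum_y t_def by (simp add: sum_distrib_left sum_divide_distrib)
      finally show ?thesis by simp
    qed
    moreover have "y i1 \<noteq> 0" "i1 \<in> I" using x by (auto simp: y_def)
    ultimately show ?thesis by blast
  qed
qed

lemma sum_scaled_product:
  fixes c :: real
  shows "(\<Sum>i\<in>A. \<Sum>j\<in>B. c * f i * g j) = c * sum f A * sum g B"
proof -
  have "(\<Sum>i\<in>A. \<Sum>j\<in>B. c * f i * g j) = (\<Sum>i\<in>A. c * f i * sum g B)"
    by (simp only: sum_distrib_left)
  also have "\<dots> = c * sum f A * sum g B"
    by (simp only: sum_distrib_right[symmetric] sum_distrib_left[symmetric])
  finally show ?thesis .
qed

text \<open>With more positive \<open>e i\<close> than positive \<open>d k\<close>, some nonzero x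
  supported on the positive \<open>e i\<close> is annihilated by all rows \<open>k\<close> with
  \<open>d k > 0\<close>. The same quadratic form is then positive at x by its \<open>e\<close>
  expression and at most 0 by its \<open>d\<close> expression.\<close>

lemma diagonal_inertia_le:
  fixes d e :: "nat \<Rightarrow> real"
  assumes S: "\<And>i j. i < n \<Longrightarrow> j < n \<Longrightarrow>
      (\<Sum>k<r. d k * S k i * S k j) = (if i = j then e i else 0)"
  shows "card {i. i < n \<and> e i > 0} \<le> card {k. k < r \<and> d k > 0}"
proof (rule ccontr)
  let ?I = "{i. i < n \<and> e i > 0}" and ?J = "{k. k < r \<and> d k > 0}"
  assume "\<not> card ?I \<le> card ?J"
  then obtain x i0 where x: "i0 \<in> ?I" "x i0 \<noteq> 0" "\<And>k. k \<in> ?J \<Longrightarrow> (\<Sum>i\<in>?I. S k i * x i) = 0"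
    using homogeneous_system_nontrivial[of ?J ?I S] by auto
  define y where "y k = (\<Sum>i\<in>?I. S k i * x i)" for k
  have "0 < e i0 * (x i0)\<^sup>2" using x by simp
  also have "\<dots> \<le> (\<Sum>i\<in>?I. e i * (x i)\<^sup>2)"
    using x(1) by (intro member_le_sum) auto
  also have "\<dots> = (\<Sum>i\<in>?I. \<Sum>j\<in>?I. (\<Sum>k<r. d k * S k i * S k j) * x i * x j)"
  proof (rule sum.cong[OF refl])
    fix i assume i: "i \<in> ?I"
    have "(\<Sum>j\<in>?I. (\<Sum>k<r. d k * S k i * S k j) * x i * x j)
        = (\<Sum>j\<in>?I. if j = i then e i * (x i)\<^sup>2 else 0)"
      by (rule sum.cong[OF refl]) (use i S in \<open>auto simp: power2_eq_square\<close>)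
    also have "\<dots> = e i * (x i)\<^sup>2" using i by simp
    finally show "e i * (x i)\<^sup>2 = (\<Sum>j\<in>?I. (\<Sum>k<r. d k * S k i * S k j) * x i * x j)" by simp
  qed
  also have "\<dots> = (\<Sum>i\<in>?I. \<Sum>k<r. \<Sum>j\<in>?I. d k * (S k i * x i) * (S k j * x j))"
    unfolding sum_distrib_right by (subst sum.swap) (simp add: mult_ac)
  also have "\<dots> = (\<Sum>k<r. \<Sum>i\<in>?I. \<Sum>j\<in>?I. d k * (S k i * x i) * (S k j * x j))"
    by (rule sum.swap)
  also have "\<dots> = (\<Sum>k<r. d k * (y k)\<^sup>2)"
    by (simp only: y_def power2_eq_square sum_scaled_product) (simp only: mult.assoc)
  also have "\<dots> \<le> 0"
  proof (rule sum_nonpos)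
    fix k assume "k \<in> {..<r}"
    then show "d k * (y k)\<^sup>2 \<le> 0"
      using x(3)[of k] by (cases "d k > 0") (auto simp: y_def mult_nonpos_nonneg)
  qed
  finally show False by simp
qed

definition inertia :: "nat \<Rightarrow> (nat \<Rightarrow> real) \<Rightarrow> int" where
  "inertia r d = int (card {k. k < r \<and> d k > 0}) - int (card {k. k < r \<and> d k < 0})"

lemma inertia_eq_sum: "inertia r d = (\<Sum>k<r. if d k > 0 then 1 else if d k < 0 then - 1 else 0)"
proof -
  have "(\<Sum>k<r. if d k > 0 then 1 else if d k < 0 then - 1 else 0)
      = (\<Sum>k<r. (if d k > 0 then 1 else 0) - (if d k < 0 then 1 else (0::int)))"
    by (intro sum.cong) auto
  also have "\<dots> = inertia r d"
    by (simp add: inertia_def sum_subtractf flip: sum.inter_filter)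
  finally show ?thesis by simp
qed

text \<open>The inequality is applied in both directions, and again to the negated forms. The
  substitutions are rectangular, so the two diagonal forms may differ in size and in their number of
  zeros.\<close>

lemma inertia_cong:
  assumes "\<And>i j. i < n \<Longrightarrow> j < n \<Longrightarrow> (\<Sum>k<r. d k * S k i * S k j) = (if i = j then e i else 0)"
    and "\<And>i j. i < r \<Longrightarrow> j < r \<Longrightarrow> (\<Sum>k<n. e k * T k i * T k j) = (if i = j then d i else 0)"
  shows "inertia n e = inertia r d"
proof -
  have neg: "(\<Sum>k<r. - d k * S k i * S k j) = (if i = j then - e i else 0)" if "i < n" "j < n" for i j
    using assms(1)[OF that] by (simp add: sum_negf)
  have neg': "(\<Sum>k<n. - e k * T k i * T k j) = (if i = j then - d i else 0)" if "i < r" "j < r" for i j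
    using assms(2)[OF that] by (simp add: sum_negf)
  have "card {i. i < n \<and> e i > 0} = card {k. k < r \<and> d k > 0}"
    using diagonal_inertia_le[where n = n and r = r and e = e, OF assms(1)]
      diagonal_inertia_le[where n = r and r = n and e = d, OF assms(2)]
    by simp
  moreover have "card {i. i < n \<and> - e i > 0} = card {k. k < r \<and> - d k > 0}"
    using diagonal_inertia_le[where n = n and r = r and e = "\<lambda>k. - e k", OF neg]
      diagonal_inertia_le[where n = r and r = n and e = "\<lambda>k. - d k", OF neg'] by simp
  ultimately show ?thesis by (simp add: inertia_def)
qed

lemma order_prod_linear_factors:
  fixes e :: "nat \<Rightarrow> real"
  shows "Polynomial.order x (\<Prod>i<n. [:- e i, 1:]) = card {i. i < n \<and> e i = x}"
proof (induction n)
  case (Suc n)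
  have "{i. i < Suc n \<and> e i = x} = {i. i < n \<and> e i = x} \<union> (if e n = x then {n} else {})"
    by (auto simp: less_Suc_eq)
  then have "card {i. i < Suc n \<and> e i = x} = card {i. i < n \<and> e i = x} + (if e n = x then 1 else 0)"
    by simp
  moreover have "Polynomial.order x [:- e n, 1:] = (if e n = x then 1 else 0)"
    by (simp add: order_linear' )
  moreover have "(\<Prod>i<n. [:- e i, 1:]) * [:- e n, 1:] \<noteq> 0"
    by (intro no_zero_divisors) auto
  ultimately show ?case
    using Suc order_mult[of "\<Prod>i<n. [:- e i, 1:]" "[:- e n, 1:]" x] by (simp del: mult_pCons_right)
qed (simp add: order_0I)

lemma sig_char_poly:
  assumes cp: "char_poly A = (\<Prod>i<n. [:- e i, 1:])"
  shows "sig A = inertia n e"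
proof -
  have root: "poly (char_poly A) x = 0 \<longleftrightarrow> (\<exists>i<n. e i = x)" for x
    unfolding cp poly_prod by auto
  have "(\<Sum>x\<in>{x. Q x \<and> poly (char_poly A) x = 0}. Polynomial.order x (char_poly A))
      = card {i. i < n \<and> Q (e i)}" for Q
  proof -
    have "(\<Sum>x\<in>{x. Q x \<and> poly (char_poly A) x = 0}. Polynomial.order x (char_poly A))
       = (\<Sum>x\<in>e ` {i. i < n \<and> Q (e i)}. card {i. i < n \<and> e i = x})"
      unfolding root unfolding cp order_prod_linear_factors by (intro sum.cong) auto
    also have "\<dots> = (\<Sum>x\<in>e ` {i. i < n \<and> Q (e i)}. \<Sum>i\<in>{i \<in> {i. i < n \<and> Q (e i)}. e i = x}. 1)"
      by (intro sum.cong) (auto intro!: arg_cong[where f = card])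
    also have "\<dots> = card {i. i < n \<and> Q (e i)}"
      by (subst sum.image_gen[symmetric]) auto
    finally show ?thesis .
  qed
  from this[of "\<lambda>x. x > 0"] this[of "\<lambda>x. x < 0"] show ?thesis
    by (simp add: sig_def inertia_def)
qed

text \<open>Links \<open>sig\<close>, which counts roots of the characteristic polynomial, to a
  diagonal form: an orthogonal \<open>P\<close> is at once a similarity and a congruence.\<close>

lemma sig_diagonalisation:
  fixes G :: "nat \<Rightarrow> nat \<Rightarrow> real"
  assumes sym: "\<And>i j. i < n \<Longrightarrow> j < n \<Longrightarrow> G i j = G j i"
  obtains e P where
    "\<And>i j. i < n \<Longrightarrow> j < n \<Longrightarrow> G i j = (\<Sum>k<n. e k * P i k * P j k)"
    "\<And>k l. k < n \<Longrightarrow> l < n \<Longrightarrow> (\<Sum>i<n. P i k * P i l) = (if k = l then 1 else 0)"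
    "sig (mat n n (\<lambda>(i,j). G i j)) = inertia n e"
proof -
  let ?G = "mat n n (\<lambda>(i,j). G i j)"
  have G: "?G \<in> carrier_mat n n" by simp
  have "transpose_mat ?G = ?G" by (rule eq_matI) (auto intro: sym)
  from real_spectral[OF G this] obtain Q e where Q: "Q \<in> carrier_mat n n"
    and QQ: "transpose_mat Q * Q = 1\<^sub>m n"
    and GQ: "?G = Q * mat n n (\<lambda>(i,j). if i = j then e i else 0) * transpose_mat Q" by auto
  let ?D = "mat n n (\<lambda>(i,j). if i = j then e i else 0)"
  have Qt: "transpose_mat Q \<in> carrier_mat n n" using Q by simp
  have "G i j = (\<Sum>k<n. e k * Q $$ (i,k) * Q $$ (j,k))" if "i < n" "j < n" for i j
  proof -
    have QD: "(Q * ?D) $$ (i,k) = Q $$ (i,k) * e k" if "k < n" for k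
      using Q \<open>i < n\<close> that by (simp add: scalar_prod_def if_distrib[of "\<lambda>z. _ * z"] cong: if_cong)
    have "G i j = (Q * ?D * transpose_mat Q) $$ (i,j)" using GQ that by (metis index_mat(1) split_conv)
    also have "\<dots> = (\<Sum>k<n. (Q * ?D) $$ (i,k) * Q $$ (j,k))"
      using Q that by (simp add: scalar_prod_def atLeast0LessThan)
    also have "\<dots> = (\<Sum>k<n. e k * Q $$ (i,k) * Q $$ (j,k))"
      by (intro sum.cong) (simp_all add: QD mult_ac)
    finally show ?thesis .
  qed
  moreover have "(\<Sum>i<n. Q $$ (i,k) * Q $$ (i,l)) = (if k = l then 1 else 0)" if "k < n" "l < n" for k l
  proof -
    have "(transpose_mat Q * Q) $$ (k,l) = (\<Sum>i<n. Q $$ (i,k) * Q $$ (i,l))"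
      using Q that by (simp add: scalar_prod_def atLeast0LessThan)
    then show ?thesis unfolding QQ using that by simp
  qed
  moreover have "sig ?G = inertia n e"
  proof (rule sig_char_poly)
    have QQ': "Q * transpose_mat Q = 1\<^sub>m n" using mat_mult_left_right_inverse[OF Qt Q QQ] .
    have "similar_mat_wit ?G ?D Q (transpose_mat Q)"
      by (rule similar_mat_witI[of _ _ n]) (use Q QQ QQ' GQ in auto)
    then have "similar_mat ?G ?D" unfolding similar_mat_def by blast
    then have "char_poly ?G = char_poly ?D" by (rule char_poly_similar)
    also have "\<dots> = (\<Prod>a\<leftarrow>diag_mat ?D. [:- a, 1:])"
      by (rule char_poly_upper_triangular[of _ n]) auto
    also have "diag_mat ?D = map e [0..<n]" by (auto simp: diag_mat_def)
    also have "(\<Prod>a\<leftarrow>map e [0..<n]. [:- a, 1:]) = (\<Prod>i<n. [:- e i, 1:])"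
      by (simp add: prod.distinct_set_conv_list[symmetric] atLeast0LessThan o_def)
    finally show "char_poly ?G = (\<Prod>i<n. [:- e i, 1:])" .
  qed
  ultimately show ?thesis by (rule that[of e "\<lambda>i k. Q $$ (i, k)"])
qed

lemma sum_bilinear_expand:
  fixes d :: "nat \<Rightarrow> real"
  shows "(\<Sum>i<n. \<Sum>j<n. U i * (\<Sum>m<r. d m * T m i * T m j) * V j)
       = (\<Sum>m<r. d m * (\<Sum>i<n. T m i * U i) * (\<Sum>j<n. T m j * V j))"
proof -
  have "(\<Sum>i<n. \<Sum>j<n. U i * (\<Sum>m<r. d m * T m i * T m j) * V j)
      = (\<Sum>i<n. \<Sum>j<n. \<Sum>m<r. d m * (T m i * U i) * (T m j * V j))"
    by (simp add: sum_distrib_left sum_distrib_right mult_ac)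
  also have "\<dots> = (\<Sum>i<n. \<Sum>m<r. \<Sum>j<n. d m * (T m i * U i) * (T m j * V j))"
    by (subst sum.swap) simp
  also have "\<dots> = (\<Sum>m<r. \<Sum>i<n. \<Sum>j<n. d m * (T m i * U i) * (T m j * V j))"
    by (rule sum.swap)
  also have "\<dots> = (\<Sum>m<r. d m * (\<Sum>i<n. T m i * U i) * (\<Sum>j<n. T m j * V j))"
    by (simp only: sum_scaled_product)
  finally show ?thesis .
qed

text \<open>Since \<open>r\<close> may differ from \<open>n\<close>, this covers a family that is
  orthogonal and spans only modulo the radical: \<open>T\<close> expresses the given basis through
  the family, \<open>U\<close> the family through the basis.\<close>

lemma sig_eq_inertia:
  fixes G :: "nat \<Rightarrow> nat \<Rightarrow> real"
  assumes G: "\<And>i j. i < n \<Longrightarrow> j < n \<Longrightarrow> G i j = (\<Sum>k<r. d k * T k i * T k j)"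
    and D: "\<And>k l. k < r \<Longrightarrow> l < r \<Longrightarrow>
      (\<Sum>i<n. \<Sum>j<n. U i k * G i j * U j l) = (if k = l then d k else 0)"
  shows "sig (mat n n (\<lambda>(i,j). G i j)) = inertia r d"
proof -
  have sym: "G i j = G j i" if "i < n" "j < n" for i j
    unfolding G[OF that] G[OF that(2,1)] by (simp add: mult_ac)
  obtain e P where GP: "\<And>i j. i < n \<Longrightarrow> j < n \<Longrightarrow> G i j = (\<Sum>k<n. e k * P i k * P j k)"
    and PP: "\<And>k l. k < n \<Longrightarrow> l < n \<Longrightarrow> (\<Sum>i<n. P i k * P i l) = (if k = l then 1 else 0)"
    and sig: "sig (mat n n (\<lambda>(i,j). G i j)) = inertia n e"
    by (rule sig_diagonalisation[of n G]) (use sym in blast)+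
  have "inertia n e = inertia r d"
  proof (rule inertia_cong)
    fix k l assume kl: "k < n" "l < n"
    have "(\<Sum>m<r. d m * (\<Sum>i<n. T m i * P i k) * (\<Sum>j<n. T m j * P j l))
        = (\<Sum>i<n. \<Sum>j<n. P i k * G i j * P j l)"
      using G by (simp add: sum_bilinear_expand[symmetric])
    also have "\<dots> = (\<Sum>i<n. \<Sum>j<n. P i k * (\<Sum>m<n. e m * P i m * P j m) * P j l)"
      using GP by simp
    also have "\<dots> = (\<Sum>m<n. e m * (\<Sum>i<n. P i m * P i k) * (\<Sum>j<n. P j m * P j l))"
      by (rule sum_bilinear_expand)
    also have "\<dots> = (\<Sum>m<n. if m = k then (if k = l then e k else 0) else 0)"
      by (intro sum.cong) (auto simp: PP kl)
    also have "\<dots> = (if k = l then e k else 0)" using kl by simp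
    finally show "(\<Sum>m<r. d m * (\<Sum>i<n. T m i * P i k) * (\<Sum>j<n. T m j * P j l))
        = (if k = l then e k else 0)" .
  next
    fix k l assume kl: "k < r" "l < r"
    have "(\<Sum>m<n. e m * (\<Sum>i<n. P i m * U i k) * (\<Sum>j<n. P j m * U j l))
        = (\<Sum>i<n. \<Sum>j<n. U i k * G i j * U j l)"
      using GP by (simp add: sum_bilinear_expand[symmetric])
    also have "\<dots> = (if k = l then d k else 0)" by (rule D[OF kl])
    finally show "(\<Sum>m<n. e m * (\<Sum>i<n. P i m * U i k) * (\<Sum>j<n. P j m * U j l))
        = (if k = l then d k else 0)" .
  qed
  then show ?thesis using sig by simp
qed

lemma sum_swap_pairs:
  "(\<Sum>i\<in>A. \<Sum>j\<in>B. \<Sum>p\<in>C. \<Sum>q\<in>D. f i j p q) = (\<Sum>p\<in>C. \<Sum>q\<in>D. \<Sum>i\<in>A. \<Sum>j\<in>B. f i j p q)"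
proof -
  have "(\<Sum>i\<in>A. \<Sum>j\<in>B. \<Sum>p\<in>C. \<Sum>q\<in>D. f i j p q) = (\<Sum>i\<in>A. \<Sum>p\<in>C. \<Sum>q\<in>D. \<Sum>j\<in>B. f i j p q)"
    by (intro sum.cong refl) (subst sum.swap, intro sum.cong refl sum.swap)
  also have "\<dots> = (\<Sum>p\<in>C. \<Sum>q\<in>D. \<Sum>i\<in>A. \<Sum>j\<in>B. f i j p q)"
    by (subst sum.swap, intro sum.cong refl sum.swap)
  finally show ?thesis .
qed

text \<open>Used for the diagram automorphism, where \<open>T\<close> and \<open>U\<close> are the
  base changes between two differently ordered PBW bases.\<close>

lemma sig_cong:
  fixes G H :: "nat \<Rightarrow> nat \<Rightarrow> real"
  assumes sym: "\<And>i j. i < n \<Longrightarrow> j < n \<Longrightarrow> G i j = G j i"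
    and H: "\<And>i j. i < n \<Longrightarrow> j < n \<Longrightarrow> H i j = (\<Sum>k<n. \<Sum>l<n. T k i * G k l * T l j)"
    and G: "\<And>i j. i < n \<Longrightarrow> j < n \<Longrightarrow> G i j = (\<Sum>k<n. \<Sum>l<n. U k i * H k l * U l j)"
  shows "sig (mat n n (\<lambda>(i,j). H i j)) = sig (mat n n (\<lambda>(i,j). G i j))"
proof -
  obtain e P where GP: "\<And>i j. i < n \<Longrightarrow> j < n \<Longrightarrow> G i j = (\<Sum>k<n. e k * P i k * P j k)"
    and PP: "\<And>k l. k < n \<Longrightarrow> l < n \<Longrightarrow> (\<Sum>i<n. P i k * P i l) = (if k = l then 1 else 0)"
    and sig: "sig (mat n n (\<lambda>(i,j). G i j)) = inertia n e"
    by (rule sig_diagonalisation[of n G]) (use sym in blast)+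
  have "sig (mat n n (\<lambda>(i,j). H i j)) = inertia n e"
  proof (rule sig_eq_inertia)
    fix i j assume ij: "i < n" "j < n"
    have "H i j = (\<Sum>k<n. \<Sum>l<n. T k i * (\<Sum>m<n. e m * P k m * P l m) * T l j)"
      using H[OF ij] GP by simp
    then show "H i j = (\<Sum>m<n. e m * (\<Sum>k<n. P k m * T k i) * (\<Sum>l<n. P l m * T l j))"
      by (simp add: sum_bilinear_expand)
  next
    fix k l assume kl: "k < n" "l < n"
    let ?V = "\<lambda>i k. \<Sum>p<n. U i p * P p k"
    have "(\<Sum>i<n. \<Sum>j<n. ?V i k * H i j * ?V j l)
        = (\<Sum>i<n. \<Sum>j<n. \<Sum>p<n. \<Sum>q<n. P p k * (U i p * H i j * U j q) * P q l)"
      by (simp add: sum_distrib_left sum_distrib_right mult_ac)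
    also have "\<dots> = (\<Sum>p<n. \<Sum>q<n. \<Sum>i<n. \<Sum>j<n. P p k * (U i p * H i j * U j q) * P q l)"
      by (rule sum_swap_pairs)
    also have "\<dots> = (\<Sum>p<n. \<Sum>q<n. P p k * G p q * P q l)"
      using G by (simp add: sum_distrib_left sum_distrib_right)
    also have "\<dots> = (\<Sum>i<n. \<Sum>j<n. P i k * (\<Sum>m<n. e m * P i m * P j m) * P j l)"
      using GP by simp
    also have "\<dots> = (\<Sum>m<n. e m * (\<Sum>i<n. P i m * P i k) * (\<Sum>j<n. P j m * P j l))"
      by (rule sum_bilinear_expand)
    also have "\<dots> = (\<Sum>m<n. if m = k then (if k = l then e k else 0) else 0)"
      by (intro sum.cong) (auto simp: PP kl)
    also have "\<dots> = (if k = l then e k else 0)" using kl by simp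
    finally show "(\<Sum>i<n. \<Sum>j<n. ?V i k * H i j * ?V j l) = (if k = l then e k else 0)" .
  qed
  then show ?thesis using sig by simp
qed

section \<open>A function model of the Verma module\<close>

text \<open>Pointwise scaling makes \<open>verma\<close> a real vector space, so that the library
  notions \<open>linear\<close> and \<open>span\<close> apply to it.\<close>

instantiation "fun" :: (type, scaleR) scaleR
begin
definition scaleR_fun_def: "r *\<^sub>R f = (\<lambda>x. r *\<^sub>R f x)"
instance ..
end

lemma scaleR_fun_apply [simp]: "(r *\<^sub>R f) x = r *\<^sub>R f x"
  by (simp add: scaleR_fun_def)

instance "fun" :: (type, real_vector) real_vector
  by standard (simp_all add: fun_eq_iff scaleR_add_left scaleR_add_right)

type_synonym verma = "nat \<Rightarrow> nat \<Rightarrow> nat \<Rightarrow> real"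

text \<open>\<open>f k c q\<close> is the coefficient of \<open>F\<^sub>1\<^sup>k F\<^sub>3\<^sup>c F\<^sub>2\<^sup>q |\<lambda>\<rangle>\<close>. Infinite supports are
  harmless because every operator and the form act on each weight space separately. The parameters \<open>a\<close>, \<open>b\<close> of
  the raising operators are \<open>(\<alpha>\<^sub>1, \<lambda> + \<rho>)\<close> and \<open>(\<alpha>\<^sub>2, \<lambda> + \<rho>)\<close>.\<close>

definition lower1 :: "verma \<Rightarrow> verma" where
  "lower1 f = (\<lambda>k c q. if k = 0 then 0 else f (k - 1) c q)"

text \<open>Reordering into PBW form: F_2 F_1^k = F_1^k F_2 + k F_1^(k-1) F_3 with F_3 = [F_2, F_1],
  and F_2 commutes with F_3. The shifts \<open>k + 1\<close> and \<open>c - 1\<close> appear because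
  coefficients are read off at the target monomial.\<close>

definition lower2 :: "verma \<Rightarrow> verma" where
  "lower2 f = (\<lambda>k c q. (if q = 0 then 0 else f k c (q - 1))
     + (if c = 0 then 0 else real (k + 1) * f (k + 1) (c - 1) q))"

definition lower3 :: "verma \<Rightarrow> verma" where
  "lower3 f = (\<lambda>k c q. if c = 0 then 0 else f k (c - 1) q)"

text \<open>From E_1 F_1^k = F_1^k E_1 + k F_1^(k-1) (H_1 - k + 1) and [E_1, F_3] = - F_2; on F_3^c
  F_2^q applied to the highest weight vector, H_1 is a - 1 - c + q. In \<open>raise2\<close> the
  bracket is [E_2, F_3] = F_1.\<close>

definition raise1 :: "real \<Rightarrow> verma \<Rightarrow> verma" where
  "raise1 a f = (\<lambda>k c q. real (k + 1) * (a - real c + real q - real (k + 1)) * f (k + 1) c q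
     - (if q = 0 then 0 else real (c + 1) * f k (c + 1) (q - 1)))"

definition raise2 :: "real \<Rightarrow> verma \<Rightarrow> verma" where
  "raise2 b f = (\<lambda>k c q. (if k = 0 then 0 else real (c + 1) * f (k - 1) (c + 1) q)
     + real (q + 1) * (b - real (q + 1)) * f k c (q + 1))"

text \<open>E_3 = [E_1, E_2] is the image of F_3 = [F_2, F_1] under the anti-automorphism.\<close>

definition raise3 :: "real \<Rightarrow> real \<Rightarrow> verma \<Rightarrow> verma" where
  "raise3 a b f = raise1 a (raise2 b f) - raise2 b (raise1 a f)"

definition cartan1 :: "real \<Rightarrow> verma \<Rightarrow> verma" where
  "cartan1 a f = (\<lambda>k c q. (a - 1 - 2 * real k - real c + real q) * f k c q)"

definition cartan2 :: "real \<Rightarrow> verma \<Rightarrow> verma" where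
  "cartan2 b f = (\<lambda>k c q. (b - 1 + real k - real c - 2 * real q) * f k c q)"

lemma linear_ops:
  "linear lower1" "linear lower2" "linear lower3" "linear (raise1 a)" "linear (raise2 b)"
  "linear (raise3 a b)"
proof -
  show 1: "linear (raise1 a)" and 2: "linear (raise2 b)"
    by (intro linearI; auto simp: fun_eq_iff raise1_def raise2_def algebra_simps)+
  show "linear lower1" "linear lower2" "linear lower3"
    by (intro linearI; auto simp: fun_eq_iff lower1_def lower2_def lower3_def algebra_simps)+
  show "linear (raise3 a b)"
    unfolding raise3_def
    by (intro linear_compose_sub linear_compose[OF 1 2, unfolded o_def] linear_compose[OF 2 1, unfolded o_def])
qed

lemmas op_add = linear_ops[THEN linear_add]
lemmas op_scale = linear_ops[THEN linear_scale]
lemmas op_zero [simp] = linear_ops[THEN linear_0]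

lemma lower3_commutator: "lower3 f = lower2 (lower1 f) - lower1 (lower2 f)"
  by (auto simp: fun_eq_iff lower1_def lower2_def lower3_def algebra_simps)

lemma lower1_lower3: "lower1 (lower3 f) = lower3 (lower1 f)"
  by (auto simp: fun_eq_iff lower1_def lower3_def)

lemma raise1_lower1: "raise1 a (lower1 f) = lower1 (raise1 a f) + cartan1 a f"
proof (intro ext)
  fix k c q
  show "raise1 a (lower1 f) k c q = (lower1 (raise1 a f) + cartan1 a f) k c q"
    by (cases k; cases q; simp add: raise1_def lower1_def cartan1_def algebra_simps)
qed

lemma raise1_lower2: "raise1 a (lower2 f) = lower2 (raise1 a f)"
proof (intro ext)
  fix k c q
  show "raise1 a (lower2 f) k c q = lower2 (raise1 a f) k c q"
    by (cases c; cases q; simp add: raise1_def lower2_def algebra_simps)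
qed

lemma raise2_lower1: "raise2 b (lower1 f) = lower1 (raise2 b f)"
proof (intro ext)
  fix k c q
  show "raise2 b (lower1 f) k c q = lower1 (raise2 b f) k c q"
    by (cases k; cases "k - 1"; simp add: raise2_def lower1_def algebra_simps)
qed

lemma raise2_lower2: "raise2 b (lower2 f) = lower2 (raise2 b f) + cartan2 b f"
proof (intro ext)
  fix k c q
  show "raise2 b (lower2 f) k c q = (lower2 (raise2 b f) + cartan2 b f) k c q"
    by (cases k; cases c; cases q; simp add: raise2_def lower2_def cartan2_def algebra_simps)
qed

lemma raise3_explicit:
  "raise3 a b f = (\<lambda>k c q. real (c + 1) * (a + b - real c - real q - real k - 2) * f k (c + 1) q
     - real (k + 1) * real (q + 1) * (b - real q - 1) * f (k + 1) c (q + 1))"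
proof (intro ext)
  fix k c q
  \<comment> \<open>Naming the casts and the values of \<open>f\<close> leaves a polynomial identity
    in independent variables.\<close>
  define K C Q where "K = real k" "C = real c" "Q = real q"
  note [simp] = this[symmetric]
  obtain X Y Z W where F: "f k (Suc c) q = X" "f (Suc k) c (Suc q) = Y"
    "f (k - 1) (Suc (Suc c)) (q - 1) = Z" "f k (Suc c) (Suc (q - 1)) = W" by blast
  show "raise3 a b f k c q = real (c + 1) * (a + b - real c - real q - real k - 2) * f k (c + 1) q
     - real (k + 1) * real (q + 1) * (b - real q - 1) * f (k + 1) c (q + 1)"
    by (cases "k = 0"; cases "q = 0"; simp add: raise3_def raise1_def raise2_def F)
      (simp_all add: algebra_simps)
qed

text \<open>The Serre relation [E_1, [E_1, E_2]] = 0; together with \<open>raise2_raise3\<close> it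
  allows the raising operators in \<open>pairing\<close> to be reordered.\<close>

lemma raise1_raise3: "raise1 a (raise3 a b f) = raise3 a b (raise1 a f)"
proof (intro ext)
  fix k c q
  define K C Q where "K = real k" "C = real c" "Q = real q"
  note [simp] = this[symmetric]
  obtain X Y Z where F: "f (Suc k) (Suc c) q = X" "f (Suc (Suc k)) c (Suc q) = Y"
    "f k (Suc (Suc c)) (q - 1) = Z" by blast
  show "raise1 a (raise3 a b f) k c q = raise3 a b (raise1 a f) k c q"
    by (cases "q = 0"; simp add: raise3_explicit raise1_def F) (simp_all add: F algebra_simps)
qed

lemma raise2_raise3: "raise2 b (raise3 a b f) = raise3 a b (raise2 b f)"
proof (intro ext)
  fix k c q
  define K C Q where "K = real k" "C = real c" "Q = real q"
  note [simp] = this[symmetric]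
  obtain X Y Z where F: "f k (Suc c) (Suc q) = X" "f (Suc k) c (Suc (Suc q)) = Y"
    "f (k - 1) (Suc (Suc c)) q = Z" by blast
  show "raise2 b (raise3 a b f) k c q = raise3 a b (raise2 b f) k c q"
    by (cases "k = 0"; simp add: raise3_explicit raise2_def F) (simp_all add: F algebra_simps)
qed

section \<open>The Shapovalov form on the function model\<close>

lemma funpow_commute:
  assumes "\<And>f. g (h f) = h (g f)"
  shows "(g ^^ n) (h f) = h ((g ^^ n) f)"
  by (induction n) (simp_all add: assms)

lemma linear_funpow: "linear (g :: 'a::real_vector \<Rightarrow> 'a) \<Longrightarrow> linear (g ^^ n)"
  by (induction n) (auto simp: linear_id[unfolded id_def] id_def linear_compose)

lemma raise1_funpow_raise2:
  "(raise1 a ^^ k) (raise2 b g) = raise2 b ((raise1 a ^^ k) g) + real k *\<^sub>R raise3 a b ((raise1 a ^^ (k - 1)) g)"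
proof (induction k)
  case (Suc k)
  have "(raise1 a ^^ Suc k) (raise2 b g)
      = raise1 a (raise2 b ((raise1 a ^^ k) g)) + real k *\<^sub>R raise1 a (raise3 a b ((raise1 a ^^ (k - 1)) g))"
    by (simp only: funpow.simps o_apply Suc op_add op_scale)
  also have "raise1 a (raise2 b ((raise1 a ^^ k) g))
      = raise2 b ((raise1 a ^^ Suc k) g) + raise3 a b ((raise1 a ^^ k) g)"
    by (simp add: raise3_def)
  also have "real k *\<^sub>R raise1 a (raise3 a b ((raise1 a ^^ (k - 1)) g)) = real k *\<^sub>R raise3 a b ((raise1 a ^^ k) g)"
    by (cases k) (simp_all add: raise1_raise3)
  finally show ?case by (simp add: algebra_simps)
qed simp

text \<open>The value of the Shapovalov form at F_1^k F_3^c F_2^q and \<open>g\<close>: the adjoint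
  E_2^q E_3^c E_1^k is applied to \<open>g\<close>, and the coefficient of the highest weight vector
  is read off.\<close>

definition pairing :: "real \<Rightarrow> real \<Rightarrow> nat \<Rightarrow> nat \<Rightarrow> nat \<Rightarrow> verma \<Rightarrow> real" where
  "pairing a b k c q g = (raise2 b ^^ q) ((raise3 a b ^^ c) ((raise1 a ^^ k) g)) 0 0 0"

lemma pairing_raise1: "pairing a b k c q (raise1 a g) = pairing a b (Suc k) c q g"
  by (simp add: pairing_def funpow_swap1)

lemma pairing_raise2:
  "pairing a b k c q (raise2 b g) = pairing a b k c (Suc q) g + real k * pairing a b (k - 1) (Suc c) q g"
proof -
  note lin = linear_ops(5)[of b, THEN linear_funpow, of q] linear_ops(6)[of a b, THEN linear_funpow, of c]
  show ?thesis
    unfolding pairing_def raise1_funpow_raise2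
    by (simp add: linear_add[OF lin(2)] linear_scale[OF lin(2)] linear_add[OF lin(1)] linear_scale[OF lin(1)]
        funpow_commute[of "raise3 a b" "raise2 b", OF raise2_raise3[symmetric]] funpow_swap1)
qed

lemma linear_pairing: "linear (pairing a b k c q)"
proof -
  note lin = linear_ops(4)[of a, THEN linear_funpow, of k]
    linear_ops(5)[of b, THEN linear_funpow, of q] linear_ops(6)[of a b, THEN linear_funpow, of c]
  show ?thesis
    by (intro linearI) (simp_all add: pairing_def linear_add[OF lin(1)] linear_scale[OF lin(1)]
      linear_add[OF lin(2)] linear_scale[OF lin(2)] linear_add[OF lin(3)] linear_scale[OF lin(3)])
qed

lemmas pairing_linear = linear_pairing[THEN linear_add] linear_pairing[THEN linear_scale]
  linear_pairing[THEN linear_diff] linear_pairing[THEN linear_0]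

definition proj :: "nat \<Rightarrow> nat \<Rightarrow> verma \<Rightarrow> verma" where
  "proj m1 m2 f = (\<lambda>k c q. if k + c = m1 \<and> c + q = m2 then f k c q else 0)"

lemma raise1_proj: "raise1 a (proj (Suc m1) m2 f) = proj m1 m2 (raise1 a f)"
  by (auto simp: fun_eq_iff raise1_def proj_def)

lemma raise2_proj: "raise2 b (proj m1 (Suc m2) f) = proj m1 m2 (raise2 b f)"
  by (auto simp: fun_eq_iff raise2_def proj_def)

lemma raise3_proj: "raise3 a b (proj (Suc m1) (Suc m2) f) = proj m1 m2 (raise3 a b f)"
  by (auto simp: fun_eq_iff raise3_explicit proj_def)

text \<open>Each raising operator carries the projection to the next smaller weight, so the
  functional sees only the component of its own weight.\<close>

lemma pairing_proj: "pairing a b k c q (proj (k + c) (c + q) f) = pairing a b k c q f"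
proof -
  have 1: "(raise1 a ^^ k) (proj (k + m1) m2 f) = proj m1 m2 ((raise1 a ^^ k) f)" for k m1 m2 f
    by (induction k arbitrary: f) (simp_all add: funpow_swap1 raise1_proj)
  have 2: "(raise2 b ^^ k) (proj m1 (k + m2) f) = proj m1 m2 ((raise2 b ^^ k) f)" for k m1 m2 f
    by (induction k arbitrary: f) (simp_all add: funpow_swap1 raise2_proj)
  have 3: "(raise3 a b ^^ k) (proj (k + m1) (k + m2) f) = proj m1 m2 ((raise3 a b ^^ k) f)" for k m1 m2 f
    by (induction k arbitrary: f) (simp_all add: funpow_swap1 raise3_proj)
  have "(raise2 b ^^ q) ((raise3 a b ^^ c) ((raise1 a ^^ k) (proj (k + c) (c + q) f)))
      = proj 0 0 ((raise2 b ^^ q) ((raise3 a b ^^ c) ((raise1 a ^^ k) f)))"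
    using 3[of c 0 q] 2[of q 0 0] by (simp only: 1 add_0_right)
  then show ?thesis by (simp only: pairing_def) (simp add: proj_def)
qed

text \<open>The Shapovalov form on the weight space \<open>(m\<^sub>1, m\<^sub>2)\<close>; components of other weights are ignored.\<close>

definition form :: "real \<Rightarrow> real \<Rightarrow> nat \<Rightarrow> nat \<Rightarrow> verma \<Rightarrow> verma \<Rightarrow> real" where
  "form a b m1 m2 f g = (\<Sum>c | c \<le> m1 \<and> c \<le> m2. f (m1 - c) c (m2 - c) * pairing a b (m1 - c) c (m2 - c) g)"

lemma form_add_left: "form a b m1 m2 (f + f') g = form a b m1 m2 f g + form a b m1 m2 f' g"
  and form_scale_left: "form a b m1 m2 (r *\<^sub>R f) g = r * form a b m1 m2 f g"
  and form_zero_left [simp]: "form a b m1 m2 0 g = 0"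
  and form_add_right: "form a b m1 m2 f (g + g') = form a b m1 m2 f g + form a b m1 m2 f g'"
  and form_scale_right: "form a b m1 m2 f (r *\<^sub>R g) = r * form a b m1 m2 f g"
  and form_zero_right [simp]: "form a b m1 m2 f 0 = 0"
  by (simp_all add: form_def pairing_linear sum.distrib sum_distrib_left algebra_simps)

lemma form_proj_left: "form a b m1 m2 (proj m1 m2 f) g = form a b m1 m2 f g"
  by (simp add: form_def proj_def)

lemma form_proj_right: "form a b m1 m2 f (proj m1 m2 g) = form a b m1 m2 f g"
proof -
  have "pairing a b (m1 - c) c (m2 - c) (proj m1 m2 g) = pairing a b (m1 - c) c (m2 - c) g"
    if "c \<le> m1" "c \<le> m2" for c
    using pairing_proj[of a b "m1 - c" c "m2 - c" g] that by simp
  then show ?thesis by (simp add: form_def)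
qed

lemma form_lower1: "form a b (Suc m1) m2 (lower1 f) g = form a b m1 m2 f (raise1 a g)"
  unfolding form_def pairing_raise1
  by (rule sum.mono_neutral_cong_right) (auto simp: lower1_def Suc_diff_le)

lemma form_lower2: "form a b m1 (Suc m2) (lower2 f) g = form a b m1 m2 f (raise2 b g)"
proof -
  let ?p = "pairing a b"
  have "form a b m1 (Suc m2) (lower2 f) g
     = (\<Sum>c | c \<le> m1 \<and> c \<le> Suc m2. (if c \<le> m2 then f (m1 - c) c (m2 - c) else 0) * ?p (m1 - c) c (Suc m2 - c) g)
     + (\<Sum>c | c \<le> m1 \<and> c \<le> Suc m2. (if c = 0 then 0 else real (m1 - c + 1) * f (m1 - c + 1) (c - 1) (Suc m2 - c))
         * ?p (m1 - c) c (Suc m2 - c) g)"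
    unfolding form_def sum.distrib[symmetric]
    by (intro sum.cong) (auto simp: lower2_def algebra_simps Suc_diff_le le_Suc_eq)
  also have "(\<Sum>c | c \<le> m1 \<and> c \<le> Suc m2. (if c \<le> m2 then f (m1 - c) c (m2 - c) else 0) * ?p (m1 - c) c (Suc m2 - c) g)
     = (\<Sum>c | c \<le> m1 \<and> c \<le> m2. f (m1 - c) c (m2 - c) * ?p (m1 - c) c (Suc (m2 - c)) g)"
    by (rule sum.mono_neutral_cong_right) (auto simp: Suc_diff_le)
  \<comment> \<open>The summand coming from F_3 is reindexed by \<open>Suc\<close>, which turns it
    into the second term of \<open>pairing_raise2\<close>.\<close>
  also have "(\<Sum>c | c \<le> m1 \<and> c \<le> Suc m2. (if c = 0 then 0 else real (m1 - c + 1) * f (m1 - c + 1) (c - 1) (Suc m2 - c))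
         * ?p (m1 - c) c (Suc m2 - c) g)
     = (\<Sum>c \<in> Suc ` {c. c < m1 \<and> c \<le> m2}. real (m1 - c + 1) * f (m1 - c + 1) (c - 1) (Suc m2 - c)
         * ?p (m1 - c) c (Suc m2 - c) g)"
    by (rule sum.mono_neutral_cong_right) (auto simp: image_iff gr0_conv_Suc)
  also have "\<dots> = (\<Sum>c | c < m1 \<and> c \<le> m2. f (m1 - c) c (m2 - c) * (real (m1 - c) * ?p (m1 - c - 1) (Suc c) (m2 - c) g))"
    by (subst sum.reindex) (auto intro!: sum.cong simp: Suc_diff_Suc)
  also have "\<dots> = (\<Sum>c | c \<le> m1 \<and> c \<le> m2. f (m1 - c) c (m2 - c) * (real (m1 - c) * ?p (m1 - c - 1) (Suc c) (m2 - c) g))"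
    by (rule sum.mono_neutral_cong_left) auto
  finally show ?thesis
    by (simp add: form_def pairing_raise2 sum.distrib distrib_left)
qed

lemma form_lower1_0: "form a b 0 m2 (lower1 f) g = 0"
  by (simp add: form_def lower1_def)

lemma form_lower2_0: "form a b m1 0 (lower2 f) g = 0"
  by (simp add: form_def lower2_def)

lemma form_lower1_0_right: "form a b 0 m2 g (lower1 f) = 0"
proof -
  have "proj 0 m2 (lower1 f) = 0" by (auto simp: fun_eq_iff proj_def lower1_def)
  then show ?thesis using form_proj_right[of a b 0 m2 g "lower1 f"] by simp
qed

lemma form_lower2_0_right: "form a b m1 0 g (lower2 f) = 0"
proof -
  have "proj m1 0 (lower2 f) = 0" by (auto simp: fun_eq_iff proj_def lower2_def)
  then show ?thesis using form_proj_right[of a b m1 0 g "lower2 f"] by simp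
qed

lemma form_cartan1: "form a b m1 m2 g (cartan1 a f) = form a b m1 m2 (cartan1 a g) f"
proof -
  have "proj m1 m2 (cartan1 a f) = (a - 1 - 2 * real m1 + real m2) *\<^sub>R proj m1 m2 f" for f
    by (auto simp: fun_eq_iff proj_def cartan1_def)
  then show ?thesis
    by (metis form_proj_left form_proj_right form_scale_left form_scale_right)
qed

lemma form_cartan2: "form a b m1 m2 g (cartan2 b f) = form a b m1 m2 (cartan2 b g) f"
proof -
  have "proj m1 m2 (cartan2 b f) = (b - 1 + real m1 - 2 * real m2) *\<^sub>R proj m1 m2 f" for f
    by (auto simp: fun_eq_iff proj_def cartan2_def)
  then show ?thesis
    by (metis form_proj_left form_proj_right form_scale_left form_scale_right)
qed

lemma lower_decomposition:
  assumes "f 0 0 0 = 0"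
  shows "\<exists>f1 f2. f = lower1 f1 + lower2 f2"
proof -
  \<comment> \<open>Modulo the image of F_1 only the monomials with k = 0 matter: F_2^(q+1) is F_2
    applied to F_2^q, and F_3^(c+1) F_2^q is congruent to F_2 applied to F_1 F_3^c F_2^q.\<close>
  define f2 :: verma where
    "f2 k c q = (if k = 0 then if c = 0 then f 0 0 (q + 1) else 0 else if k = 1 then f 0 (c + 1) q else 0)" for k c q
  define f1 :: verma where "f1 k c q = (f - lower2 f2) (k + 1) c q" for k c q
  have "(f - lower2 f2) 0 c q = 0" for c q
    using assms by (cases c; cases q) (auto simp: lower2_def f2_def)
  then have "f - lower2 f2 = lower1 f1"
    by (auto simp: fun_eq_iff lower1_def f1_def)
  then show ?thesis by (metis diff_add_cancel)
qed

lemma form_decomposition: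
  assumes "m1 + m2 > 0"
  obtains f1 f2 where "proj m1 m2 f = lower1 f1 + lower2 f2"
proof -
  have "proj m1 m2 f 0 0 0 = 0" using assms by (auto simp: proj_def)
  then show ?thesis using lower_decomposition that by blast
qed

text \<open>\<open>form\<close> treats its arguments differently: adjointness on the left is built
  into \<open>pairing\<close>, on the right it has to be proved. Writing \<open>g\<close> as F_1 g1
  + F_2 g2 lets these operators be moved across from the left; the commutation relations and the
  induction hypothesis at smaller weight finish each case.\<close>

lemma form_lower_right:
  "m1 + m2 = n \<Longrightarrow> form a b (Suc m1) m2 g (lower1 f) = form a b m1 m2 (raise1 a g) f"
  "m1 + m2 = n \<Longrightarrow> form a b m1 (Suc m2) g (lower2 f) = form a b m1 m2 (raise2 b g) f"
proof (induction n arbitrary: m1 m2 f g rule: less_induct)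
  case (less n)
  {
    case 1
    obtain g1 g2 where g: "proj (Suc m1) m2 g = lower1 g1 + lower2 g2"
      using form_decomposition[of "Suc m1" m2 g] by auto
    have "form a b (Suc m1) m2 (lower1 g1) (lower1 f) = form a b m1 m2 (raise1 a (lower1 g1)) f"
    proof (cases m1)
      case 0
      then show ?thesis
        by (simp add: form_lower1 raise1_lower1 form_add_left form_add_right form_lower1_0 form_lower1_0_right form_cartan1)
    next
      case (Suc m)
      then have "form a b m1 m2 g1 (lower1 (raise1 a f)) = form a b m m2 (raise1 a g1) (raise1 a f)"
        using less(1)[of "m + m2" m m2] 1 by simp
      also have "\<dots> = form a b m1 m2 (lower1 (raise1 a g1)) f" by (simp add: Suc form_lower1)
      finally show ?thesis
        by (simp add: form_lower1 raise1_lower1 form_add_left form_add_right form_cartan1)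
    qed
    moreover have "form a b (Suc m1) m2 (lower2 g2) (lower1 f) = form a b m1 m2 (raise1 a (lower2 g2)) f"
    proof (cases m2)
      case 0
      then show ?thesis by (simp add: form_lower2_0 raise1_lower2)
    next
      case (Suc m)
      then show ?thesis
        using less(1)[of "m1 + m" m1 m] 1 by (simp add: form_lower2 raise1_lower2 raise2_lower1)
    qed
    ultimately have "form a b (Suc m1) m2 (proj (Suc m1) m2 g) (lower1 f)
        = form a b m1 m2 (raise1 a (proj (Suc m1) m2 g)) f"
      unfolding g by (simp add: form_add_left op_add)
    then show ?case by (simp add: form_proj_left raise1_proj)
  next
    case 2
    obtain g1 g2 where g: "proj m1 (Suc m2) g = lower1 g1 + lower2 g2"
      using form_decomposition[of m1 "Suc m2" g] by auto
    have "form a b m1 (Suc m2) (lower2 g2) (lower2 f) = form a b m1 m2 (raise2 b (lower2 g2)) f"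
    proof (cases m2)
      case 0
      then show ?thesis
        by (simp add: form_lower2 raise2_lower2 form_add_left form_add_right form_lower2_0 form_lower2_0_right form_cartan2)
    next
      case (Suc m)
      then have "form a b m1 m2 g2 (lower2 (raise2 b f)) = form a b m1 m (raise2 b g2) (raise2 b f)"
        using less(2)[of "m1 + m" m1 m] 2 by simp
      also have "\<dots> = form a b m1 m2 (lower2 (raise2 b g2)) f" by (simp add: Suc form_lower2)
      finally show ?thesis
        by (simp add: form_lower2 raise2_lower2 form_add_left form_add_right form_cartan2)
    qed
    moreover have "form a b m1 (Suc m2) (lower1 g1) (lower2 f) = form a b m1 m2 (raise2 b (lower1 g1)) f"
    proof (cases m1)
      case 0
      then show ?thesis by (simp add: form_lower1_0 raise2_lower1)
    next
      case (Suc m)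
      then show ?thesis
        using less(2)[of "m + m2" m m2] 2 by (simp add: form_lower1 raise1_lower2 raise2_lower1)
    qed
    ultimately have "form a b m1 (Suc m2) (proj m1 (Suc m2) g) (lower2 f)
        = form a b m1 m2 (raise2 b (proj m1 (Suc m2) g)) f"
      unfolding g by (simp add: form_add_left op_add)
    then show ?case by (simp add: form_proj_left raise2_proj)
  }
qed

text \<open>Peeling one F_1 or F_2 off \<open>f\<close> and moving it across, from either side,
  lowers m1 + m2.\<close>

lemma form_sym: "form a b m1 m2 f g = form a b m1 m2 g f"
proof (induction "m1 + m2" arbitrary: m1 m2 f g rule: less_induct)
  case less
  show ?case
  proof (cases "m1 + m2 = 0")
    case True
    then show ?thesis by (simp add: form_def pairing_def)
  next
    case False
    then obtain f1 f2 where f: "proj m1 m2 f = lower1 f1 + lower2 f2"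
      using form_decomposition[of m1 m2 f] by auto
    have "form a b m1 m2 (lower1 f1) g = form a b m1 m2 g (lower1 f1)"
      using less[of "m1 - 1" m2 f1 "raise1 a g"]
      by (cases m1) (simp_all add: form_lower1_0 form_lower1_0_right form_lower1 form_lower_right[OF refl])
    moreover have "form a b m1 m2 (lower2 f2) g = form a b m1 m2 g (lower2 f2)"
      using less[of m1 "m2 - 1" f2 "raise2 b g"]
      by (cases m2) (simp_all add: form_lower2_0 form_lower2_0_right form_lower2 form_lower_right[OF refl])
    ultimately have "form a b m1 m2 (proj m1 m2 f) g = form a b m1 m2 g (proj m1 m2 f)"
      unfolding f by (simp add: form_add_left form_add_right)
    then show ?thesis by (simp add: form_proj_left form_proj_right)
  qed
qed

lemmas pointwise = plus_fun_apply zero_fun_apply minus_apply scaleR_fun_apply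

declare pointwise [simp del]

section \<open>Words and their combinations evaluated in the function model\<close>

definition lower :: "nat \<Rightarrow> verma \<Rightarrow> verma" where
  "lower j = (if j = 1 then lower1 else lower2)"

definition raise :: "real \<Rightarrow> real \<Rightarrow> nat \<Rightarrow> verma \<Rightarrow> verma" where
  "raise a b j = (if j = 1 then raise1 a else raise2 b)"

lemma linear_lower: "linear (lower j)" and linear_raise: "linear (raise a b j)"
  by (simp_all add: lower_def raise_def linear_ops)

definition basis_vec :: "nat \<Rightarrow> nat \<Rightarrow> nat \<Rightarrow> verma" where
  "basis_vec k c q = (\<lambda>k' c' q'. if k' = k \<and> c' = c \<and> q' = q then 1 else 0)"

definition word_op :: "nat list \<Rightarrow> verma \<Rightarrow> verma" where
  "word_op w = foldr lower w"

lemma word_op_simps [simp]: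
  "word_op [] f = f" "word_op (j # w) f = lower j (word_op w f)"
  "word_op (w @ w') f = word_op w (word_op w' f)"
  by (simp_all add: word_op_def)

lemma linear_word_op: "linear (word_op w)"
proof (induction w)
  case Nil
  show ?case by (intro linearI) simp_all
next
  case (Cons j w)
  show ?case
    by (intro linearI) (simp_all add: linear_add[OF Cons] linear_scale[OF Cons] linear_add[OF linear_lower]
      linear_scale[OF linear_lower])
qed

definition comb_op :: "comb \<Rightarrow> verma \<Rightarrow> verma" where
  "comb_op v f = (\<Sum>(c, w)\<leftarrow>v. c *\<^sub>R word_op w f)"

lemma comb_op_simps [simp]:
  "comb_op [] f = 0"
  "comb_op (x # v) f = fst x *\<^sub>R word_op (snd x) f + comb_op v f"
  "comb_op (v @ v') f = comb_op v f + comb_op v' f"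
  by (simp_all add: comb_op_def split_beta)

lemma comb_op_scaled_prefix:
  "comb_op (map (\<lambda>(d, u). (c * d, w @ u)) v) f = c *\<^sub>R word_op w (comb_op v f)"
  by (induction v)
    (simp_all add: split_beta linear_add[OF linear_word_op] linear_scale[OF linear_word_op] scaleR_add_right
      linear_0[OF linear_word_op])

lemma comb_op_cmul: "comb_op (cmul v v') f = comb_op v (comb_op v' f)"
  unfolding cmul_def
  by (induction v) (auto simp: comb_op_scaled_prefix)

lemma comb_op_cpow: "comb_op (cpow v n) f = (comb_op v ^^ n) f"
  by (induction n) (simp_all add: comb_op_cmul)

lemma comb_op_F: "comb_op F1 = lower1" "comb_op F2 = lower2" "comb_op F3 = lower3"
  by (simp_all add: fun_eq_iff F1_def F2_def F3_def lower_def lower3_commutator)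

definition vac :: verma where "vac = basis_vec 0 0 0"

abbreviation ev :: "comb \<Rightarrow> verma" where "ev v \<equiv> comb_op v vac"

lemma ev_pbw: "ev (pbw m1 m2 c) = basis_vec (m1 - c) c (m2 - c)"
proof -
  have 2: "(lower2 ^^ q) vac = basis_vec 0 0 q" for q
    by (induction q) (auto simp: vac_def basis_vec_def lower2_def fun_eq_iff)
  have 3: "(lower3 ^^ c) (basis_vec 0 0 q) = basis_vec 0 c q" for c q
    by (induction c) (auto simp: basis_vec_def lower3_def fun_eq_iff)
  have 1: "(lower1 ^^ k) (basis_vec 0 c q) = basis_vec k c q" for k c q
    by (induction k) (auto simp: basis_vec_def lower1_def fun_eq_iff)
  show ?thesis
    by (simp only: pbw_def comb_op_cmul comb_op_cpow comb_op_F 1 2 3)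
qed

text \<open>Words over other letters are excluded because \<open>lower\<close> and
  \<open>raise\<close> treat every index except 1 as 2, whereas \<open>eword\<close> compares
  letters literally.\<close>

definition letters_ok :: "comb \<Rightarrow> bool" where
  "letters_ok v \<longleftrightarrow> (\<forall>x\<in>set v. set (snd x) \<subseteq> {1, 2})"

definition homogeneous :: "nat \<Rightarrow> nat \<Rightarrow> comb \<Rightarrow> bool" where
  "homogeneous m1 m2 v \<longleftrightarrow>
     (\<forall>x\<in>set v. set (snd x) \<subseteq> {1, 2} \<and> count_list (snd x) 1 = m1 \<and> count_list (snd x) 2 = m2)"

lemma homogeneous_letters_ok: "homogeneous m1 m2 v \<Longrightarrow> letters_ok v"
  by (auto simp: homogeneous_def letters_ok_def)

lemma homogeneous_cmul:
  "homogeneous m1 m2 v \<Longrightarrow> homogeneous n1 n2 v' \<Longrightarrow> homogeneous (m1 + n1) (m2 + n2) (cmul v v')"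
  by (fastforce simp: homogeneous_def cmul_def)

lemma homogeneous_cpow: "homogeneous m1 m2 v \<Longrightarrow> homogeneous (n * m1) (n * m2) (cpow v n)"
  by (induction n) (auto simp: homogeneous_cmul, simp add: homogeneous_def)

lemma homogeneous_pbw:
  assumes "c \<le> m1" "c \<le> m2"
  shows "homogeneous m1 m2 (pbw m1 m2 c)"
proof -
  have "homogeneous 1 0 F1" "homogeneous 0 1 F2" "homogeneous 1 1 F3"
    by (simp_all add: homogeneous_def F1_def F2_def F3_def)
  then have "homogeneous ((m1 - c) * 1 + (c * 1 + (m2 - c) * 0)) ((m1 - c) * 0 + (c * 1 + (m2 - c) * 1)) (pbw m1 m2 c)"
    unfolding pbw_def by (intro homogeneous_cmul homogeneous_cpow)
  then show ?thesis using assms by simp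
qed

lemma lower1_proj: "proj (Suc m1) m2 (lower1 f) = lower1 (proj m1 m2 f)"
  by (auto simp: fun_eq_iff lower1_def proj_def)

lemma lower2_proj: "proj m1 (Suc m2) (lower2 f) = lower2 (proj m1 m2 f)"
proof (intro ext)
  fix k c q
  show "proj m1 (Suc m2) (lower2 f) k c q = lower2 (proj m1 m2 f) k c q"
    by (cases c; cases q) (simp_all add: lower2_def proj_def)
qed

lemma proj_word:
  "set w \<subseteq> {1, 2} \<Longrightarrow> proj (count_list w 1) (count_list w 2) (word_op w vac) = word_op w vac"
proof (induction w)
  case Nil
  show ?case by (auto simp: vac_def basis_vec_def proj_def fun_eq_iff)
next
  case (Cons j w)
  then have "j = 1 \<or> j = 2" and "proj (count_list w 1) (count_list w 2) (word_op w vac) = word_op w vac"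
    by auto
  then show ?case
    using lower1_proj[of "count_list w 1" "count_list w 2" "word_op w vac"]
      lower2_proj[of "count_list w 1" "count_list w 2" "word_op w vac"]
    by (elim disjE) (simp_all add: lower_def)
qed

definition coord1 :: "wt \<Rightarrow> real" where "coord1 l = ip (alpha 1) (l + rho)"
definition coord2 :: "wt \<Rightarrow> real" where "coord2 l = ip (alpha 2) (l + rho)"

lemma hval_eq:
  assumes "set w \<subseteq> {1, 2}"
  shows "hval l 1 w = coord1 l - 1 - 2 * real (count_list w 1) + real (count_list w 2)"
    and "hval l 2 w = coord2 l - 1 + real (count_list w 1) - 2 * real (count_list w 2)"
proof -
  have "hval l 1 w = coord1 l - 1 - 2 * real (count_list w 1) + real (count_list w 2) \<and>
    hval l 2 w = coord2 l - 1 + real (count_list w 1) - 2 * real (count_list w 2)"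
    using assms
    by (induction w) (auto simp: hval_def coord1_def coord2_def ip_def alpha_def rho_def)
  then show "hval l 1 w = coord1 l - 1 - 2 * real (count_list w 1) + real (count_list w 2)"
    and "hval l 2 w = coord2 l - 1 + real (count_list w 1) - 2 * real (count_list w 2)"
    by blast+
qed

lemma cartan_word:
  assumes "set w \<subseteq> {1, 2}"
  shows "cartan1 (coord1 l) (word_op w vac) = hval l 1 w *\<^sub>R word_op w vac"
    and "cartan2 (coord2 l) (word_op w vac) = hval l 2 w *\<^sub>R word_op w vac"
proof -
  have *: "word_op w vac k c q = 0 \<or> (k + c = count_list w 1 \<and> c + q = count_list w 2)" for k c q
    using fun_cong[OF fun_cong[OF fun_cong[OF proj_word[OF assms]]], of k c q]
    by (auto simp: proj_def split: if_splits)
  show "cartan1 (coord1 l) (word_op w vac) = hval l 1 w *\<^sub>R word_op w vac"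
  proof (intro ext)
    fix k c q
    show "cartan1 (coord1 l) (word_op w vac) k c q = (hval l 1 w *\<^sub>R word_op w vac) k c q"
      unfolding hval_eq(1)[OF assms] using *[of k c q] by (auto simp: cartan1_def pointwise)
  qed
  show "cartan2 (coord2 l) (word_op w vac) = hval l 2 w *\<^sub>R word_op w vac"
  proof (intro ext)
    fix k c q
    show "cartan2 (coord2 l) (word_op w vac) k c q = (hval l 2 w *\<^sub>R word_op w vac) k c q"
      unfolding hval_eq(2)[OF assms] using *[of k c q] by (auto simp: cartan2_def pointwise)
  qed
qed

lemma raise_vac: "raise a b i vac = 0"
  by (auto simp: raise_def raise1_def raise2_def vac_def basis_vec_def fun_eq_iff pointwise)

lemma ev_prefix: "ev (map (\<lambda>(c, u). (c, j # u)) v) = lower j (ev v)"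
  using comb_op_scaled_prefix[of 1 "[j]" v vac] by simp

text \<open>\<open>eword\<close> and \<open>raise\<close> obey the same recursion, E_i F_j = F_j E_i
  plus H_i if i = j, with E_i killing the highest weight vector. So evaluation intertwines them
  although words are not taken modulo the Serre relations.\<close>

lemma ev_eword:
  assumes "set w \<subseteq> {1, 2}" "i \<in> {1, 2}"
  shows "ev (eword l i w) = raise (coord1 l) (coord2 l) i (word_op w vac)"
  using assms
proof (induction w)
  case Nil
  then show ?case by (simp add: raise_vac)
next
  case (Cons j w)
  then have IH: "ev (eword l i w) = raise (coord1 l) (coord2 l) i (word_op w vac)"
    and w: "set w \<subseteq> {1, 2}" by auto
  have "ev (eword l i (j # w)) = lower j (raise (coord1 l) (coord2 l) i (word_op w vac))
      + (if i = j then hval l i w *\<^sub>R word_op w vac else 0)"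
    by (simp add: ev_prefix IH)
  also have "\<dots> = raise (coord1 l) (coord2 l) i (lower j (word_op w vac))"
    using Cons.prems cartan_word[OF w, of l]
    by (auto simp: raise_def lower_def raise1_lower1 raise1_lower2 raise2_lower1 raise2_lower2)
  finally show ?case by simp
qed

lemma letters_ok_eword: "set w \<subseteq> {1, 2} \<Longrightarrow> letters_ok (eword l i w)"
  by (induction w) (fastforce simp: letters_ok_def)+

lemma ev_scale: "ev (map (\<lambda>(d, u). (c * d, u)) v) = c *\<^sub>R ev v"
  using comb_op_scaled_prefix[of c "[]" v vac] by simp

lemma ev_eact:
  assumes "letters_ok v" "i \<in> {1, 2}"
  shows "ev (eact l i v) = raise (coord1 l) (coord2 l) i (ev v)"
  using assms(1)
proof (induction v)
  case Nil
  then show ?case by (simp add: eact_def linear_0[OF linear_raise])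
next
  case (Cons x v)
  then have "letters_ok v" "set (snd x) \<subseteq> {1, 2}" by (auto simp: letters_ok_def)
  moreover have "eact l i (x # v) = map (\<lambda>(d, u). (fst x * d, u)) (eword l i (snd x)) @ eact l i v"
    by (simp add: eact_def split_beta)
  ultimately show ?case
    using Cons.IH assms(2)
    by (simp only: comb_op_simps ev_scale ev_eword linear_add[OF linear_raise] linear_scale[OF linear_raise])
qed

lemma letters_ok_eact: "letters_ok v \<Longrightarrow> letters_ok (eact l i v)"
proof (induction v)
  case (Cons x v)
  have *: "letters_ok (map (\<lambda>(d, u). (c * d, u)) v)" if "letters_ok v" for c v
    using that by (simp add: letters_ok_def split_beta)
  have app: "letters_ok (v @ v') \<longleftrightarrow> letters_ok v \<and> letters_ok v'" for v v'
    by (auto simp: letters_ok_def)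
  have "eact l i (x # v) = map (\<lambda>(d, u). (fst x * d, u)) (eword l i (snd x)) @ eact l i v"
    by (simp add: eact_def split_beta)
  moreover have "letters_ok v" "set (snd x) \<subseteq> {1, 2}"
    using Cons.prems by (auto simp: letters_ok_def)
  moreover have "letters_ok (eact l i v)" "letters_ok (eword l i (snd x))"
    using Cons.IH letters_ok_eword calculation(2,3) by blast+
  ultimately show ?case
    using *[of "eword l i (snd x)" "fst x"] by (simp only: app)
qed (simp add: eact_def)

lemma top_coeff_ev: "letters_ok v \<Longrightarrow> top_coeff v = ev v 0 0 0"
proof (induction v)
  case (Cons x v)
  have "word_op u vac 0 0 0 = (if u = [] then 1 else 0)" for u
    by (cases u) (auto simp: vac_def basis_vec_def lower_def lower1_def lower2_def)
  then show ?case using Cons by (auto simp: top_coeff_def letters_ok_def split_beta pointwise)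
qed (simp add: top_coeff_def pointwise)

text \<open>Each letter is moved across by adjointness, which mirrors the recursion of
  \<open>pair\<close>.\<close>

lemma pair_eq_form:
  assumes "set w \<subseteq> {1, 2}" "letters_ok v"
  shows "pair l w v = form (coord1 l) (coord2 l) (count_list w 1) (count_list w 2) (word_op w vac) (ev v)"
  using assms
proof (induction w arbitrary: v)
  case Nil
  then show ?case by (simp add: top_coeff_ev form_def pairing_def vac_def basis_vec_def)
next
  case (Cons j w)
  then have j: "j = 1 \<or> j = 2" by auto
  have "pair l (j # w) v = form (coord1 l) (coord2 l) (count_list w 1) (count_list w 2) (word_op w vac)
      (raise (coord1 l) (coord2 l) j (ev v))"
    using Cons j by (auto simp: letters_ok_eact ev_eact)
  then show ?case
    using j by (auto simp: raise_def lower_def form_lower1 form_lower2)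
qed

lemma shap_eq_form:
  assumes "homogeneous m1 m2 v" "letters_ok v'"
  shows "shap l v v' = form (coord1 l) (coord2 l) m1 m2 (ev v) (ev v')"
  using assms(1)
proof (induction v)
  case Nil
  then show ?case by (simp add: shap_def)
next
  case (Cons x v)
  then show ?case
    using pair_eq_form[of "snd x" v' l] assms(2)
    by (simp add: shap_def homogeneous_def form_add_left form_scale_left split_beta)
qed

lemma form_basis_vec:
  assumes "c \<le> m1" "c \<le> m2"
  shows "form a b m1 m2 (basis_vec (m1 - c) c (m2 - c)) g = pairing a b (m1 - c) c (m2 - c) g"
proof -
  have "form a b m1 m2 (basis_vec (m1 - c) c (m2 - c)) g
     = (\<Sum>d | d \<le> m1 \<and> d \<le> m2. if d = c then pairing a b (m1 - d) d (m2 - d) g else 0)"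
    unfolding form_def by (intro sum.cong) (auto simp: basis_vec_def)
  then show ?thesis using assms by simp
qed

definition gram_entry :: "wt \<Rightarrow> nat \<Rightarrow> nat \<Rightarrow> nat \<Rightarrow> nat \<Rightarrow> real" where
  "gram_entry l m1 m2 c d = form (coord1 l) (coord2 l) m1 m2
     (basis_vec (m1 - c) c (m2 - c)) (basis_vec (m1 - d) d (m2 - d))"

lemma gram_eq: "gram l m1 m2 = mat (Suc (min m1 m2)) (Suc (min m1 m2)) (\<lambda>(c, d). gram_entry l m1 m2 c d)"
  unfolding gram_def gram_entry_def
  by (rule eq_matI) (auto simp: shap_eq_form[OF homogeneous_pbw homogeneous_letters_ok[OF homogeneous_pbw]] ev_pbw)

lemma gram_entry_sym: "gram_entry l m1 m2 c d = gram_entry l m1 m2 d c"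
  by (simp add: gram_entry_def form_sym)

lemma form_expand:
  "form (coord1 l) (coord2 l) m1 m2 f g
   = (\<Sum>c<Suc (min m1 m2). \<Sum>d<Suc (min m1 m2).
        f (m1 - c) c (m2 - c) * gram_entry l m1 m2 c d * g (m1 - d) d (m2 - d))"
proof -
  let ?B = "form (coord1 l) (coord2 l) m1 m2"
  let ?e = "\<lambda>c. basis_vec (m1 - c) c (m2 - c)"
  have set: "{c. c \<le> m1 \<and> c \<le> m2} = {..<Suc (min m1 m2)}" by auto
  have expand: "?B f g = (\<Sum>c<Suc (min m1 m2). f (m1 - c) c (m2 - c) * ?B (?e c) g)" for f g
    unfolding form_def[of _ _ _ _ f] set by (intro sum.cong) (auto simp: form_basis_vec)
  have "?B (?e c) g = (\<Sum>d<Suc (min m1 m2). gram_entry l m1 m2 c d * g (m1 - d) d (m2 - d))" for c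
    unfolding form_sym[of _ _ _ _ "?e c" g] expand[of g]
    by (intro sum.cong) (auto simp: gram_entry_def form_sym[of _ _ _ _ "?e c"])
  then show ?thesis
    unfolding expand[of f] by (simp only: sum_distrib_left mult.assoc)
qed

section \<open>The diagram automorphism\<close>

definition swap_letter :: "nat \<Rightarrow> nat" where "swap_letter j = 3 - j"

definition swap_comb :: "comb \<Rightarrow> comb" where
  "swap_comb v = map (\<lambda>(c, w). (c, map swap_letter w)) v"

lemma hval_swap:
  assumes "set w \<subseteq> {1, 2}" "i \<in> {1, 2}"
  shows "hval (prod.swap l) (swap_letter i) (map swap_letter w) = hval l i w"
proof -
  have "ip (alpha (swap_letter i)) (alpha (swap_letter k)) = ip (alpha i) (alpha k)" if "k \<in> {1, 2}" for k
    using assms(2) that by (auto simp: ip_def alpha_def swap_letter_def)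
  then have "map (\<lambda>k. ip (alpha (swap_letter i)) (alpha k)) (map swap_letter w) = map (\<lambda>k. ip (alpha i) (alpha k)) w"
    unfolding map_map o_def using assms(1) by (intro map_cong) auto
  moreover have "ip (alpha (swap_letter i)) (prod.swap l) = ip (alpha i) l"
    using assms(2) by (auto simp: ip_def alpha_def swap_letter_def)
  ultimately show ?thesis by (simp only: hval_def)
qed

lemma eword_swap:
  assumes "set w \<subseteq> {1, 2}" "i \<in> {1, 2}"
  shows "eword (prod.swap l) (swap_letter i) (map swap_letter w) = swap_comb (eword l i w)"
  using assms
proof (induction w)
  case (Cons j w)
  then have "swap_letter i = swap_letter j \<longleftrightarrow> i = j" by (auto simp: swap_letter_def)
  then show ?case using Cons hval_swap[of w i l] by (auto simp: swap_comb_def)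
qed (simp add: swap_comb_def)

lemma eact_swap:
  assumes "letters_ok v" "i \<in> {1, 2}"
  shows "eact (prod.swap l) (swap_letter i) (swap_comb v) = swap_comb (eact l i v)"
  using assms(1)
proof (induction v)
  case (Cons x v)
  then show ?case
    using eword_swap[of "snd x" i l] assms(2)
    by (auto simp: eact_def swap_comb_def letters_ok_def split_beta o_def)
qed (simp add: swap_comb_def eact_def)

lemma pair_swap:
  assumes "set w \<subseteq> {1, 2}" "letters_ok v"
  shows "pair (prod.swap l) (map swap_letter w) (swap_comb v) = pair l w v"
  using assms
proof (induction w arbitrary: v)
  case Nil
  have "top_coeff (swap_comb v) = top_coeff v"
    unfolding top_coeff_def swap_comb_def by (induction v) auto
  then show ?case by simp
next
  case (Cons j w)
  then show ?case by (simp add: eact_swap letters_ok_eact)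
qed

lemma shap_swap:
  assumes "letters_ok v" "letters_ok v'"
  shows "shap (prod.swap l) (swap_comb v) (swap_comb v') = shap l v v'"
  using assms(1)
proof (induction v)
  case (Cons x v)
  then show ?case
    using pair_swap[of "snd x" v' l] assms(2)
    by (simp add: shap_def swap_comb_def letters_ok_def split_beta)
qed (simp add: shap_def swap_comb_def)

lemma homogeneous_swap: "homogeneous m1 m2 v \<Longrightarrow> homogeneous m2 m1 (swap_comb v)"
proof -
  have "count_list (map swap_letter w) 1 = count_list w 2 \<and> count_list (map swap_letter w) 2 = count_list w 1
      \<and> set (map swap_letter w) \<subseteq> {1, 2}" if "set w \<subseteq> {1, 2}" for w
    using that by (induction w) (auto simp: swap_letter_def)
  then show "homogeneous m1 m2 v \<Longrightarrow> homogeneous m2 m1 (swap_comb v)"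
    by (auto simp: homogeneous_def swap_comb_def split_beta)
qed

text \<open>The automorphism sends F_3 to - F_3 and reverses the order of F_1 and F_2 in the PBW
  monomials. The two Gram matrices are therefore congruent rather than equal, the base change being
  the PBW coordinates of the swapped monomials.\<close>

lemma gram_entry_swap:
  assumes "c < Suc (min m1 m2)" "d < Suc (min m1 m2)"
  shows "gram_entry l m1 m2 c d =
    (\<Sum>i<Suc (min m1 m2). \<Sum>j<Suc (min m1 m2).
       ev (swap_comb (pbw m1 m2 c)) (m2 - i) i (m1 - i) * gram_entry (prod.swap l) m2 m1 i j
       * ev (swap_comb (pbw m1 m2 d)) (m2 - j) j (m1 - j))"
proof -
  have h: "homogeneous m1 m2 (pbw m1 m2 c)" "homogeneous m1 m2 (pbw m1 m2 d)"
    using assms by (simp_all add: homogeneous_pbw)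
  note ok = h[THEN homogeneous_letters_ok]
  have "gram_entry l m1 m2 c d = shap l (pbw m1 m2 c) (pbw m1 m2 d)"
    by (simp add: shap_eq_form[OF h(1) ok(2)] ev_pbw gram_entry_def)
  also have "\<dots> = shap (prod.swap l) (swap_comb (pbw m1 m2 c)) (swap_comb (pbw m1 m2 d))"
    by (simp add: shap_swap ok)
  also have "\<dots> = form (coord1 (prod.swap l)) (coord2 (prod.swap l)) m2 m1
      (ev (swap_comb (pbw m1 m2 c))) (ev (swap_comb (pbw m1 m2 d)))"
    using h by (intro shap_eq_form homogeneous_swap homogeneous_letters_ok[OF homogeneous_swap])
  finally show ?thesis by (simp add: form_expand min.commute)
qed

section \<open>Gelfand-Tsetlin vectors\<close>

text \<open>The singular vectors of the \<open>sl\<^sub>2\<close> of \<open>\<alpha>\<^sub>1\<close>, normalised so that the coefficient of \<open>F\<^sub>3\<^sup>p F\<^sub>2\<^sup>q\<close> is 1.\<close>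

definition gtvec :: "real \<Rightarrow> nat \<Rightarrow> nat \<Rightarrow> verma" where
  "gtvec a p q = (\<lambda>k c r. if k + c = p \<and> r = q + k
     then real (p choose k) / pochhammer (a + real q - real p + 1) k else 0)"

lemma binomial_absorb_left: "real (k + 1) * real (p choose (k + 1)) = (real p - real k) * real (p choose k)"
proof (cases "k \<le> p")
  case True
  have "(k + 1) * (p choose (k + 1)) = (p - k) * (p choose k)"
    using binomial_absorption[of k p] binomial_absorb_comp[of p k] by simp
  then have "real ((k + 1) * (p choose (k + 1))) = real ((p - k) * (p choose k))" by simp
  then show ?thesis using True by (simp add: of_nat_diff distrib_right)
qed (simp add: binomial_eq_0)

lemma pochhammer_shift: "pochhammer s k * (s + real k) = s * pochhammer (s + 1 :: real) k"
  by (metis pochhammer_Suc pochhammer_rec)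

text \<open>With s = a + q - p + 1, being killed by E_1 is the recursion (k + 1) (s + k) x_(k+1) =
  (p - k) x_k for the coefficients, solved by the quotient in \<open>gtvec\<close>; s > 0 keeps its
  denominators nonzero.\<close>

lemma raise1_gtvec:
  assumes "a + real q - real p + 1 > 0"
  shows "raise1 a (gtvec a p q) = 0"
proof (intro ext)
  fix k c r
  show "raise1 a (gtvec a p q) k c r = 0 k c r"
  proof (cases "k + 1 + c = p \<and> r = q + k + 1")
    case True
    define s where "s = a + real q - real p + 1"
    have s: "s + real k > 0" "pochhammer s k \<noteq> 0"
      using assms pochhammer_pos[of s k] unfolding s_def by linarith+
    have p: "real p = real k + 1 + real c" using True by auto
    have c1: "a - real c + real r - real (k + 1) = s + real k"
      using True p by (simp add: s_def)
    have "raise1 a (gtvec a p q) k c r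
      = real (k + 1) * (s + real k) * (real (p choose (k + 1)) / pochhammer s (k + 1))
        - real (c + 1) * (real (p choose k) / pochhammer s k)"
      unfolding raise1_def c1 using True by (simp add: gtvec_def s_def)
    also have "real (k + 1) * (s + real k) * (real (p choose (k + 1)) / pochhammer s (k + 1))
      = real (k + 1) * real (p choose (k + 1)) / pochhammer s k"
      using s by (simp add: pochhammer_Suc)
    also have "real (c + 1) * (real (p choose k) / pochhammer s k) = (real p - real k) * real (p choose k) / pochhammer s k"
      using p by simp
    finally have "raise1 a (gtvec a p q) k c r
      = (real (k + 1) * real (p choose (k + 1)) - (real p - real k) * real (p choose k)) / pochhammer s k"
      by (simp only: diff_divide_distrib)
    also have "\<dots> = 0" unfolding binomial_absorb_left by simp
    finally show ?thesis by (simp add: pointwise)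
  next
    case False
    then show ?thesis by (auto simp: raise1_def gtvec_def pointwise)
  qed
qed

text \<open>F_2 commutes with E_1, so F_2 u_pq should be a multiple of u_p(q+1). The factor is its
  coefficient at F_3^p F_2^(q+1), namely 1 + p / (a + q - p + 1).\<close>

lemma lower2_gtvec:
  assumes "a + real q - real p + 1 > 0"
  shows "lower2 (gtvec a p q) = ((a + real q + 1) / (a + real q - real p + 1)) *\<^sub>R gtvec a p (q + 1)"
proof (intro ext)
  fix k c r
  define s where "s = a + real q - real p + 1"
  have s: "s + real k > 0" "pochhammer s k \<noteq> 0" "s > 0"  "pochhammer (s + 1) k \<noteq> 0"
    using assms pochhammer_pos[of s k] pochhammer_pos[of "s + 1" k] unfolding s_def by linarith+
  note rec = pochhammer_shift[of s k]
  show "lower2 (gtvec a p q) k c r = (((a + real q + 1) / (a + real q - real p + 1)) *\<^sub>R gtvec a p (q + 1)) k c r"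
  proof (cases "k + c = p \<and> r = q + k + 1")
    case True
    then have p: "real p = real k + real c" by auto
    have *: "(if c = 0 then 0 else real (k + 1) * (real (p choose (k + 1)) / pochhammer s (k + 1)))
        = (real p - real k) * real (p choose k) / (pochhammer s k * (s + real k))"
    proof (cases "c = 0")
      case False
      then show ?thesis using binomial_absorb_left[of k p] by (simp add: pochhammer_Suc)
    qed (use p in simp)
    have "lower2 (gtvec a p q) k c r = real (p choose k) / pochhammer s k
       + (if c = 0 then 0 else real (k + 1) * (real (p choose (k + 1)) / pochhammer s (k + 1)))"
      using True by (cases c) (auto simp: lower2_def gtvec_def s_def)
    also have "\<dots> = real (p choose k) * (s + real p) / (pochhammer s k * (s + real k))"
    proof -
      have "real (p choose k) / pochhammer s k = real (p choose k) * (s + real k) / (pochhammer s k * (s + real k))"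
        using s by simp
      then show ?thesis
        unfolding * by (simp only: add_divide_distrib[symmetric]) (simp add: algebra_simps)
    qed
    also have "\<dots> = (s + real p) / s * (real (p choose k) / pochhammer (s + 1) k)"
      unfolding rec by simp
    also have "\<dots> = (((a + real q + 1) / (a + real q - real p + 1)) *\<^sub>R gtvec a p (q + 1)) k c r"
      using True by (simp add: gtvec_def pointwise s_def algebra_simps)
    finally show ?thesis .
  next
    case False
    then show ?thesis by (cases c) (auto simp: lower2_def gtvec_def pointwise)
  qed
qed

text \<open>E_1 F_3 u_pq = - F_2 u_pq is a multiple of u_p(q+1), and E_1 F_1 u_p(q+1) = (a + q - p)
  u_p(q+1). The quotient of the two factors is the correction that makes F_3 u_pq singular; it
  leaves the coefficient of F_3^(p+1) F_2^q equal to 1.\<close>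

lemma lower3_gtvec:
  assumes "a + real q - real p > 0"
  shows "lower3 (gtvec a p q) = gtvec a (p + 1) q
     - ((a + real q + 1) / ((a + real q - real p) * (a + real q - real p + 1))) *\<^sub>R lower1 (gtvec a p (q + 1))"
proof (intro ext)
  fix k c r
  define s where "s = a + real q - real p"
  have s: "s > 0" using assms by (simp add: s_def)
  show "lower3 (gtvec a p q) k c r = (gtvec a (p + 1) q
     - ((a + real q + 1) / ((a + real q - real p) * (a + real q - real p + 1))) *\<^sub>R lower1 (gtvec a p (q + 1))) k c r"
  proof (cases "k + c = p + 1 \<and> r = q + k")
    case True
    have eq: "a + real q + 1 = s + real p + 1" "a + real (q + 1) - real p + 1 = s + 2"
      "a + real q - real (p + 1) + 1 = s" by (simp_all add: s_def)
    show ?thesis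
    proof (cases k)
      case 0
      then show ?thesis using True by (auto simp: lower3_def gtvec_def lower1_def pointwise)
    next
      case (Suc j)
      define P where "P = pochhammer (s + 2) j"
      have P: "P > 0" using s unfolding P_def by (intro pochhammer_pos) simp
      have p1: "pochhammer (s + 1) k = (s + 1) * P"
        unfolding Suc P_def pochhammer_rec by (simp add: add.assoc)
      have p0: "pochhammer s k = s * ((s + 1) * P) / (s + real k)"
        using pochhammer_shift[of s k] s by (simp add: p1 eq_divide_eq)
      have b: "real k * real (p choose k) = (real p - real j) * real (p choose j)"
        using binomial_absorb_left[of j p] Suc by simp
      have b': "real (p + 1 choose k) = real (p choose j) + real (p choose k)"
        using Suc by simp
      have l: "lower3 (gtvec a p q) k c r = real (p choose k) / pochhammer (s + 1) k"
        using True Suc by (cases c) (auto simp: lower3_def gtvec_def s_def)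
      have r: "(gtvec a (p + 1) q
         - ((a + real q + 1) / ((a + real q - real p) * (a + real q - real p + 1))) *\<^sub>R lower1 (gtvec a p (q + 1))) k c r
        = real (p + 1 choose k) / pochhammer s k - (s + real p + 1) / (s * (s + 1)) * (real (p choose j) / P)"
      proof -
        have g1: "gtvec a (p + 1) q k c r = real (p + 1 choose k) / pochhammer s k"
          unfolding gtvec_def eq(3) using True by simp
        have g2: "lower1 (gtvec a p (q + 1)) k c r = real (p choose j) / P"
          unfolding lower1_def gtvec_def eq(2) P_def using True Suc by simp
        show ?thesis unfolding pointwise g1 g2 real_scaleR_def eq(1) s_def[symmetric] ..
      qed
      have "real (p + 1 choose k) / pochhammer s k - (s + real p + 1) / (s * (s + 1)) * (real (p choose j) / P)
          = ((real (p choose j) + real (p choose k)) * (s + real k) - (s + real p + 1) * real (p choose j)) / (s * (s + 1) * P)"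
        unfolding b' p0
        by (simp only: divide_divide_eq_right times_divide_times_eq diff_divide_distrib mult.assoc)
      also have "(real (p choose j) + real (p choose k)) * (s + real k) - (s + real p + 1) * real (p choose j)
          = s * real (p choose k) + (real k * real (p choose k) - (real p - real j) * real (p choose j))"
        using Suc by (simp add: algebra_simps)
      also have "\<dots> = s * real (p choose k)" using b by simp
      also have "s * real (p choose k) / (s * (s + 1) * P) = real (p choose k) / pochhammer (s + 1) k"
        using s by (simp add: p1)
      finally show ?thesis unfolding l r by simp
    qed
  next
    case False
    then show ?thesis by (cases k; cases c) (auto simp: lower3_def gtvec_def lower1_def pointwise)
  qed
qed

text \<open>The singular boundary case \<open>s = 0\<close> is only used with \<open>q = 0\<close>, where the last term is \<open>0 / 0 = 0\<close>
  and the value is still the correct one, although \<open>gtcoeff_eq\<close> fails there.\<close>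

definition gtcoeff :: "real \<Rightarrow> real \<Rightarrow> nat \<Rightarrow> nat \<Rightarrow> real" where
  "gtcoeff a b p q = (let s = a + real q - real p in
     real p * (1 + (real q + 1) * (b - real q - 1) / (s + 1) - real q * (b - real q) / s))"

text \<open>The factored form shows the positivity for 0 < p < min a (a + b) and the zeros at p = a
  and p = a + b, where the family stops.\<close>

lemma gtcoeff_eq:
  assumes "a + real q - real p > 0"
  shows "gtcoeff a b p q = real p * (a - real p) * (a + b - real p) / ((a + real q - real p) * (a + real q - real p + 1))"
proof -
  define s where "s = a + real q - real p"
  have s: "s > 0" using assms by (simp add: s_def)
  have "gtcoeff a b p q = real p * (s - real q) * (s + b - real q) / (s * (s + 1))"
    using s unfolding gtcoeff_def Let_def s_def[symmetric] by (simp add: field_simps) 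
  then show ?thesis by (simp add: s_def algebra_simps)
qed

text \<open>The shape is explained by E_1 E_1 E_2 u_pq = E_1 E_3 u_pq = 0, which suggests a
  combination of a singular vector and F_1 of another one. Coefficients at k = 0 give q (b - q), the
  remaining ones give \<open>gtcoeff\<close>.\<close>

lemma raise2_gtvec:
  assumes "a + real q - real p + 1 > 0" "q = 0 \<or> a + real q - real p > 0"
  shows "raise2 b (gtvec a p q) = (real q * (b - real q)) *\<^sub>R gtvec a p (q - 1)
     + gtcoeff a b p q *\<^sub>R lower1 (gtvec a (p - 1) q)"
proof (intro ext)
  fix k c r
  define s where "s = a + real q - real p"
  have s: "s + 1 > 0" "q = 0 \<or> s > 0" using assms by (simp_all add: s_def)
  show "raise2 b (gtvec a p q) k c r = ((real q * (b - real q)) *\<^sub>R gtvec a p (q - 1)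
     + gtcoeff a b p q *\<^sub>R lower1 (gtvec a (p - 1) q)) k c r"
  proof (cases "k + c = p \<and> r + 1 = q + k")
    case True
    show ?thesis
    proof (cases k)
      case 0
      then show ?thesis using True by (auto simp: raise2_def gtvec_def lower1_def pointwise)
    next
      case (Suc j)
      then obtain p' where p': "p = Suc p'" using True by (cases p) auto
      define P where "P = pochhammer (s + 2) j"
      have P: "P > 0" using s unfolding P_def by (intro pochhammer_pos) simp
      define B where "B = real (p choose k)"
      have b1: "(real c + 1) * real (p choose j) = real k * B"
      proof -
        have "real p - real j = real c + 1" using True Suc by auto
        then show ?thesis using binomial_absorb_left[of j p] Suc by (simp add: B_def)
      qed
      have b2: "real p * real (p' choose j) = real k * B"
        using Suc_times_binomial_eq[of p' j] unfolding B_def Suc p' by (metis mult.commute of_nat_mult)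
      have pk: "pochhammer (s + 1) k = (s + 1) * P"
        unfolding Suc P_def pochhammer_rec by (simp add: add.assoc)
      have pj: "pochhammer (s + 1) j = (s + 1) * P / (s + real k)"
        using pochhammer_Suc[of "s + 1" j] pk s Suc by (simp add: eq_divide_eq add_ac)
      have l: "raise2 b (gtvec a p q) k c r = (real c + 1) * (real (p choose j) / pochhammer (s + 1) j)
         + real (q + k) * (b - real (q + k)) * (B / pochhammer (s + 1) k)"
      proof -
        have "real r + 1 = real (q + k)" "k - 1 + (c + 1) = p" "r = q + (k - 1)" using True Suc by auto
        then show ?thesis
          using True Suc by (auto simp: raise2_def gtvec_def s_def B_def)
      qed
      have r2: "lower1 (gtvec a (p - 1) q) k c r = real (p' choose j) / P"
      proof -
        have eq: "a + real q - real p' + 1 = s + 2" by (simp add: s_def p')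
        have "lower1 (gtvec a (p - 1) q) k c r = real (p' choose j) / pochhammer (a + real q - real p' + 1) j"
          using True Suc p' by (simp add: lower1_def gtvec_def)
        then show ?thesis unfolding eq P_def .
      qed
      have "(real c + 1) * (real (p choose j) / pochhammer (s + 1) j) = real k * B * (s + real k) / ((s + 1) * P)"
        using P s Suc unfolding pj b1[symmetric] by simp
      then have l': "raise2 b (gtvec a p q) k c r
          = B * (real k * (s + real k) + real (q + k) * (b - real (q + k))) / ((s + 1) * P)"
        unfolding l pk by (simp only: times_divide_eq_right add_divide_distrib[symmetric]) (simp add: algebra_simps)
      have g: "gtcoeff a b p q * (real (p' choose j) / P)
          = (1 + (real q + 1) * (b - real q - 1) / (s + 1) - real q * (b - real q) / s) * (real k * B) / P"
        unfolding gtcoeff_def Let_def s_def[symmetric] b2[symmetric] by simp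
      show ?thesis
      proof (cases "q = 0")
        case True
        have g0: "gtcoeff a b p q * (real (p' choose j) / P) = B * (real k * (s + b)) / ((s + 1) * P)"
          unfolding g using True s by (simp add: field_simps)
        show ?thesis
          unfolding l' pointwise r2 real_scaleR_def g0 using True by (simp add: algebra_simps)
      next
        case False
        then have s0: "s > 0" using s by simp
        have ps: "pochhammer s k = s * ((s + 1) * P) / (s + real k)"
          using pochhammer_shift[of s k] s0 by (simp add: pk eq_divide_eq)
        have r1: "gtvec a p (q - 1) k c r = B / pochhammer s k"
        proof -
          have "r = q - 1 + k" "a + real (q - 1) - real p + 1 = s"
            using True False by (auto simp: s_def of_nat_diff)
          then show ?thesis using True by (simp add: gtvec_def B_def)
        qed
        have "real q * (b - real q) * (B / pochhammer s k) + gtcoeff a b p q * (real (p' choose j) / P)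
           = B * (real q * (b - real q) * (s + real k) + real k * (s * (s + 1) + s * (real q + 1) * (b - real q - 1)
               - (s + 1) * real q * (b - real q))) / (s * (s + 1) * P)"
        proof -
          define u v where "u = (real q + 1) * (b - real q - 1)" and "v = real q * (b - real q)"
          have "1 + u / (s + 1) - v / s = (s * (s + 1) + s * u - (s + 1) * v) / (s * (s + 1))"
            using s0 by (simp add: divide_simps) (simp add: algebra_simps)
          then have "v * (B / (s * ((s + 1) * P) / (s + real k))) + (1 + u / (s + 1) - v / s) * (real k * B) / P
            = (v * (B * (s + real k)) + (s * (s + 1) + s * u - (s + 1) * v) * (real k * B)) / (s * (s + 1) * P)"
            by (simp only: divide_divide_eq_right times_divide_eq_left times_divide_eq_right divide_divide_eq_left
                add_divide_distrib mult.assoc)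
          also have "v * (B * (s + real k)) + (s * (s + 1) + s * u - (s + 1) * v) * (real k * B)
            = B * (v * (s + real k) + real k * (s * (s + 1) + s * u - (s + 1) * v))"
            by (simp add: algebra_simps)
          finally show ?thesis unfolding g ps by (simp only: u_def v_def mult.assoc)
        qed
        also have "real q * (b - real q) * (s + real k) + real k * (s * (s + 1) + s * (real q + 1) * (b - real q - 1)
               - (s + 1) * real q * (b - real q))
           = s * (real k * (s + real k) + real (q + k) * (b - real (q + k)))"
          by (simp add: algebra_simps)
        also have "B * (s * (real k * (s + real k) + real (q + k) * (b - real (q + k)))) / (s * (s + 1) * P)
           = B * (real k * (s + real k) + real (q + k) * (b - real (q + k))) / ((s + 1) * P)"
          using s0 by simp
        finally show ?thesis unfolding l' pointwise r1 r2 real_scaleR_def by (rule sym)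
      qed
    qed
  next
    case False
    moreover have "gtcoeff a b 0 q = 0" by (simp add: gtcoeff_def Let_def)
    ultimately show ?thesis
      by (cases k; cases q; cases p) (auto simp: raise2_def gtvec_def lower1_def pointwise)
  qed
qed

section \<open>The radical of the form\<close>

definition rad :: "real \<Rightarrow> real \<Rightarrow> verma \<Rightarrow> bool" where
  "rad a b f \<longleftrightarrow> (\<forall>k c q. pairing a b k c q f = 0)"

lemma rad_iff_form: "rad a b f \<longleftrightarrow> (\<forall>m1 m2 g. form a b m1 m2 g f = 0)"
proof
  show "\<forall>m1 m2 g. form a b m1 m2 g f = 0" if "rad a b f"
    using that by (simp add: rad_def form_def)
  assume *: "\<forall>m1 m2 g. form a b m1 m2 g f = 0"
  show "rad a b f"
    unfolding rad_def
  proof (intro allI)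
    fix k c q
    show "pairing a b k c q f = 0"
      using form_basis_vec[of c "k + c" "c + q" a b f] * by simp
  qed
qed

lemma rad_0 [simp]: "rad a b 0"
  and rad_add: "rad a b f \<Longrightarrow> rad a b g \<Longrightarrow> rad a b (f + g)"
  and rad_scale: "rad a b f \<Longrightarrow> rad a b (r *\<^sub>R f)"
  by (simp_all add: rad_def pairing_linear)

lemma rad_lower1: "rad a b f \<Longrightarrow> rad a b (lower1 f)"
  unfolding rad_iff_form
proof (intro allI)
  fix m1 m2 g
  assume "\<forall>m1 m2 g. form a b m1 m2 g f = 0"
  then show "form a b m1 m2 g (lower1 f) = 0"
    by (cases m1) (simp_all add: form_lower1_0_right form_lower_right[OF refl])
qed

lemma rad_lower2: "rad a b f \<Longrightarrow> rad a b (lower2 f)"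
  unfolding rad_iff_form
proof (intro allI)
  fix m1 m2 g
  assume "\<forall>m1 m2 g. form a b m1 m2 g f = 0"
  then show "form a b m1 m2 g (lower2 f) = 0"
    by (cases m2) (simp_all add: form_lower2_0_right form_lower_right[OF refl])
qed

lemma rad_lower1_funpow: "rad a b f \<Longrightarrow> rad a b ((lower1 ^^ k) f)"
  by (induction k) (simp_all add: rad_lower1)

text \<open>A vector without top component that is singular modulo the radical lies in it. Pairings
  with E_1 or with E_2 alone reduce directly; those with k = 0 that contain E_3 are reached from
  \<open>pairing_raise2\<close> at k = 1.\<close>

lemma radI:
  assumes r1: "rad a b (raise1 a f)" and r2: "rad a b (raise2 b f)" and top: "f 0 0 0 = 0"
  shows "rad a b f"
  unfolding rad_def
proof (intro allI)
  have 1: "pairing a b (Suc k) c q f = 0" for k c q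
    using r1 pairing_raise1[of a b k c q f] by (simp add: rad_def)
  have 2: "pairing a b 0 (Suc c) q f = 0" for c q
    using r2 1[of 0 c "Suc q"] pairing_raise2[of a b 1 c q f] by (simp add: rad_def)
  have 3: "pairing a b 0 0 (Suc q) f = 0" for q
    using r2 pairing_raise2[of a b 0 0 q f] by (simp add: rad_def)
  have 4: "pairing a b 0 0 0 f = 0" using top by (simp add: pairing_def)
  show "pairing a b k c q f = 0" for k c q
    using 1 2 3 4 by (cases k; cases c; cases q) simp_all
qed

section \<open>Strings F_1^k u_pq\<close>

definition gv :: "real \<Rightarrow> nat \<Rightarrow> nat \<Rightarrow> nat \<Rightarrow> verma" where
  "gv a k p q = (lower1 ^^ k) (gtvec a p q)"

lemma gv_0: "gv a 0 p q = gtvec a p q" and gv_Suc: "gv a (Suc k) p q = lower1 (gv a k p q)"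
  by (simp_all add: gv_def)

lemma gv_weight: "gv a k p q k' c r \<noteq> 0 \<Longrightarrow> k' + c = k + p \<and> c + r = p + q"
  by (induction k arbitrary: k')
    (auto simp: gv_0 gv_Suc gtvec_def lower1_def split: if_splits, (metis Suc_pred add_Suc)+)

lemma cartan1_gv: "cartan1 a (gv a k p q) = (a - 1 + real q - real p - 2 * real k) *\<^sub>R gv a k p q"
proof (intro ext)
  fix k' c r
  show "cartan1 a (gv a k p q) k' c r = ((a - 1 + real q - real p - 2 * real k) *\<^sub>R gv a k p q) k' c r"
  proof (cases "gv a k p q k' c r = 0")
    case False
    then have "real k' + real c = real k + real p" "real c + real r = real p + real q"
      using gv_weight[OF False] by (metis of_nat_add)+
    then have "a - 1 - 2 * real k' - real c + real r = a - 1 + real q - real p - 2 * real k" by linarith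
    then show ?thesis by (simp add: cartan1_def pointwise)
  qed (simp add: cartan1_def pointwise)
qed

text \<open>The sl_2 formula for highest weight a - 1 + q - p; the coefficient vanishes at k + 1 = a
  + q - p, which is where a string ends for integral a.\<close>

lemma raise1_gv:
  assumes "a + real q - real p + 1 > 0"
  shows "raise1 a (gv a (Suc k) p q) = ((real k + 1) * (a - 1 + real q - real p - real k)) *\<^sub>R gv a k p q"
proof (induction k)
  case 0
  show ?case
    using raise1_gtvec[OF assms] cartan1_gv[of a 0 p q] by (simp add: gv_Suc raise1_lower1 gv_0)
next
  case (Suc k)
  have "raise1 a (gv a (Suc (Suc k)) p q)
     = ((real k + 1) * (a - 1 + real q - real p - real k)) *\<^sub>R gv a (Suc k) p q
       + (a - 1 + real q - real p - 2 * real (Suc k)) *\<^sub>R gv a (Suc k) p q"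
    unfolding gv_Suc[of a "Suc k"] raise1_lower1 Suc op_scale cartan1_gv gv_Suc[of a k, symmetric] ..
  also have "\<dots> = ((real (Suc k) + 1) * (a - 1 + real q - real p - real (Suc k))) *\<^sub>R gv a (Suc k) p q"
    unfolding scaleR_add_left[symmetric] by (rule arg_cong2[where f = scaleR]) (simp_all add: algebra_simps)
  finally show ?case .
qed

lemmas linear_lower1_funpow = linear_funpow[OF linear_ops(1)]

lemma raise2_gv:
  assumes "a + real q - real p + 1 > 0" "q = 0 \<or> a + real q - real p > 0"
  shows "raise2 b (gv a k p q) = (real q * (b - real q)) *\<^sub>R gv a k p (q - 1)
     + gtcoeff a b p q *\<^sub>R gv a (Suc k) (p - 1) q"
proof -
  have "raise2 b (gv a k p q) = (lower1 ^^ k) (raise2 b (gtvec a p q))"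
    unfolding gv_def by (rule funpow_commute[symmetric]) (rule raise2_lower1[symmetric])
  then show ?thesis
    unfolding raise2_gtvec[OF assms]
    by (simp add: linear_add[OF linear_lower1_funpow] linear_scale[OF linear_lower1_funpow] gv_def funpow_swap1)
qed

lemma lower2_lower1_funpow:
  "lower2 ((lower1 ^^ k) f) = (lower1 ^^ k) (lower2 f) + real k *\<^sub>R (lower1 ^^ (k - 1)) (lower3 f)"
proof (induction k)
  case (Suc k)
  have "lower2 ((lower1 ^^ Suc k) f) = lower1 (lower2 ((lower1 ^^ k) f)) + lower3 ((lower1 ^^ k) f)"
    by (simp add: lower3_commutator)
  also have "lower3 ((lower1 ^^ k) f) = (lower1 ^^ k) (lower3 f)"
    by (rule funpow_commute[symmetric]) (rule lower1_lower3)
  also have "lower1 (lower2 ((lower1 ^^ k) f))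
      = (lower1 ^^ Suc k) (lower2 f) + real k *\<^sub>R (lower1 ^^ k) (lower3 f)"
    unfolding Suc by (cases k) (simp_all add: op_add op_scale)
  finally show ?case by (simp add: scaleR_add_left)
qed simp

lemma lower2_gv_0:
  assumes "a + real q - real p > 0"
  shows "lower2 (gv a 0 p q) = ((a + real q + 1) / (a + real q - real p + 1)) *\<^sub>R gv a 0 p (q + 1)"
  using lower2_gtvec[of a q p] assms by (simp add: gv_0)

text \<open>The coefficient of F_1^k u_p(q+1) in F_2 F_1^k u_pq: the factor of
  \<open>lower2_gtvec\<close>, minus the correction of \<open>lower3_gtvec\<close> once for each of
  the k commutators [F_2, F_1].\<close>

definition gtshift :: "real \<Rightarrow> nat \<Rightarrow> nat \<Rightarrow> nat \<Rightarrow> real" where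
  "gtshift a k p q = (a + real q + 1) / (a + real q - real p + 1)
     - real k * ((a + real q + 1) / ((a + real q - real p) * (a + real q - real p + 1)))"

lemma lower2_gv_Suc:
  assumes "a + real q - real p > 0"
  shows "lower2 (gv a (Suc k) p q) = gtshift a (Suc k) p q *\<^sub>R gv a (Suc k) p (q + 1)
     + real (Suc k) *\<^sub>R gv a k (p + 1) q"
proof -
  define al ka where "al = (a + real q + 1) / (a + real q - real p + 1)"
    and "ka = (a + real q + 1) / ((a + real q - real p) * (a + real q - real p + 1))"
  have 3: "(lower1 ^^ k) (lower3 (gtvec a p q)) = gv a k (p + 1) q - ka *\<^sub>R gv a (Suc k) p (q + 1)"
    unfolding lower3_gtvec[OF assms] ka_def
    by (simp only: linear_diff[OF linear_lower1_funpow] linear_scale[OF linear_lower1_funpow] gv_def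
        funpow_swap1 funpow.simps o_apply)
  have 2: "(lower1 ^^ Suc k) (lower2 (gtvec a p q)) = al *\<^sub>R gv a (Suc k) p (q + 1)"
    using lower2_gtvec[of a q p] assms by (simp only: linear_scale[OF linear_lower1_funpow] gv_def al_def)
  have "lower2 (gv a (Suc k) p q)
      = al *\<^sub>R gv a (Suc k) p (q + 1) + real (Suc k) *\<^sub>R (gv a k (p + 1) q - ka *\<^sub>R gv a (Suc k) p (q + 1))"
    unfolding gv_def[of a "Suc k" p q] lower2_lower1_funpow diff_Suc_1 2 3 ..
  also have "\<dots> = (al - real (Suc k) * ka) *\<^sub>R gv a (Suc k) p (q + 1) + real (Suc k) *\<^sub>R gv a k (p + 1) q"
    by (simp only: scaleR_diff_left scaleR_diff_right scaleR_scaleR) simp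
  finally show ?thesis unfolding gtshift_def al_def ka_def .
qed

lemma form_gv_Suc:
  assumes "a + real q - real p + 1 > 0"
  shows "form a b (Suc m1) m2 (gv a (Suc k') p' q') (gv a (Suc k) p q)
    = (real k + 1) * (a - 1 + real q - real p - real k) * form a b m1 m2 (gv a k' p' q') (gv a k p q)"
  unfolding gv_Suc[of a k'] form_lower1 raise1_gv[OF assms] form_scale_right ..

text \<open>Moving F_1 across k times as E_1 leaves F_1^(k' - k) against a vector killed by
  E_1.\<close>

lemma form_gv_orthogonal:
  assumes "a + real q - real p + 1 > 0" "k < k'"
  shows "form a b m1 m2 (gv a k' p' q') (gv a k p q) = 0"
  using assms(2)
proof (induction k arbitrary: k' m1)
  case 0
  then obtain j where k': "k' = Suc j" by (cases k') auto
  show ?case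
    using raise1_gtvec[OF assms(1)]
    by (cases m1) (simp_all add: k' gv_Suc gv_0 form_lower1_0 form_lower1)
next
  case (Suc k)
  then obtain j where k': "k' = Suc j" "k < j" by (cases k') auto
  show ?case
  proof (cases m1)
    case 0
    then show ?thesis by (simp add: k' gv_Suc form_lower1_0)
  next
    case (Suc m)
    then show ?thesis using Suc.IH[OF k'(2)] by (simp add: k' form_gv_Suc[OF assms(1)])
  qed
qed

text \<open>\<open>P\<close> is min a (a + b), the number of admissible p. The parameter b stays
  real here; its integrality is used when \<open>qsign\<close> is evaluated.\<close>

locale gelfand_tsetlin =
  fixes A P :: nat and b :: real
  assumes P_pos: "P > 0" and P_le: "P \<le> A" and P_le': "real P \<le> real A + b"
    and P_eq: "P = A \<or> real P = real A + b"
begin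

abbreviation "a \<equiv> real A"

lemma pos: "p < P \<Longrightarrow> a + real q - real p > 0"
  using P_le by simp

text \<open>The vector is singular modulo the radical, which suffices by \<open>radI\<close>: E_1
  kills it by the sl_2 formula, while E_2 produces F_1 applied to the end of the string (p, q - 1)
  and the end of the string (p - 1, q), both covered by the induction.\<close>

lemma rad_gv_string: "p < P \<Longrightarrow> rad a b (gv a (A + q - p) p q)"
proof (induction "p + q" arbitrary: p q rule: less_induct)
  case less
  note s = pos[OF less.prems, of q]
  obtain h where h: "A + q - p = Suc h" using less.prems P_le by (cases "A + q - p") auto
  then have h': "real h = a - 1 + real q - real p" using less.prems P_le by linarith
  show ?case
  proof (rule radI)
    show "gv a (A + q - p) p q 0 0 0 = 0" by (simp add: h gv_Suc lower1_def)
    show "rad a b (raise1 a (gv a (A + q - p) p q))"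
      using s unfolding h by (simp add: raise1_gv h')
    have 1: "rad a b ((real q * (b - real q)) *\<^sub>R gv a (A + q - p) p (q - 1))"
    proof (cases q)
      case (Suc r)
      have "A + q - p = Suc (A + r - p)" using Suc less.prems P_le by simp
      moreover have "rad a b (gv a (A + r - p) p r)" using less Suc by simp
      ultimately show ?thesis using Suc by (simp add: gv_Suc rad_lower1 rad_scale)
    qed simp
    have 2: "rad a b (gtcoeff a b p q *\<^sub>R gv a (Suc (A + q - p)) (p - 1) q)"
    proof (cases p)
      case 0
      then show ?thesis by (simp add: gtcoeff_def Let_def)
    next
      case (Suc r)
      then have "Suc (A + q - p) = A + q - r" using less.prems P_le by simp
      moreover have "rad a b (gv a (A + q - r) r q)" using less Suc by simp
      ultimately show ?thesis using Suc by (simp add: rad_scale)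
    qed
    show "rad a b (raise2 b (gv a (A + q - p) p q))"
      using rad_add[OF 1 2] s by (subst raise2_gv) auto
  qed
qed

lemma gtcoeff_P: "a + real q - real P > 0 \<Longrightarrow> gtcoeff a b P q = 0"
  using P_eq by (auto simp: gtcoeff_eq)

text \<open>E_1 kills u_Pq. In E_2 u_Pq the component along F_1 u_(P-1)q drops out through the
  factor (a - P) (a + b - P), which leaves a multiple of u_P(q-1).\<close>

lemma rad_gtvec_P: "rad a b (gtvec a P q)"
proof (induction q)
  case 0
  have "rad a b (gtcoeff a b P 0 *\<^sub>R lower1 (gtvec a (P - 1) 0))"
  \<comment> \<open>For \<open>P = A\<close> and \<open>q = 0\<close> the factored formula has
    denominator 0 and \<open>gtcoeff\<close> is P b, possibly nonzero. Here F_1 u_(A-1)0 itself lies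
    in the radical, being the end of a string of length 1.\<close>
  proof (cases "P = A")
    case True
    then have "rad a b (gv a 1 (P - 1) 0)"
      using rad_gv_string[of "P - 1" 0] P_pos by simp
    then show ?thesis by (simp add: gv_Suc gv_0 rad_scale)
  next
    case False
    then show ?thesis using P_le gtcoeff_P[of 0] by simp
  qed
  then have "rad a b (raise2 b (gtvec a P 0))"
    using P_le raise2_gtvec[of a 0 P b] by simp
  moreover have "rad a b (raise1 a (gtvec a P 0))"
    using P_le raise1_gtvec[of a 0 P] by simp
  moreover have "gtvec a P 0 0 0 0 = 0"
    using P_pos by (simp add: gtvec_def)
  ultimately show ?case by (simp add: radI)
next
  case (Suc q)
  then have "rad a b ((real (Suc q) * (b - real (Suc q))) *\<^sub>R gtvec a P q)" by (rule rad_scale)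
  moreover have "gtcoeff a b P (Suc q) = 0" using P_le by (intro gtcoeff_P) simp
  ultimately have "rad a b (raise2 b (gtvec a P (Suc q)))"
    using P_le raise2_gtvec[of a "Suc q" P b] by (simp del: of_nat_Suc)
  moreover have "rad a b (raise1 a (gtvec a P (Suc q)))"
    using P_le raise1_gtvec[of a "Suc q" P] by simp
  moreover have "gtvec a P (Suc q) 0 0 0 = 0"
    by (simp add: gtvec_def)
  ultimately show ?case by (simp add: radI)
qed

lemma rad_gv_P: "rad a b (gv a k P q)"
  unfolding gv_def by (intro rad_lower1_funpow rad_gtvec_P)

text \<open>With k = m1 - p and q = m2 - p the last condition is k < A + q - p, written without
  subtraction.\<close>

definition idx :: "nat \<Rightarrow> nat \<Rightarrow> nat set" where
  "idx m1 m2 = {p. p \<le> m1 \<and> p \<le> m2 \<and> p < P \<and> m1 + p < A + m2}"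

definition gtset :: "nat \<Rightarrow> nat \<Rightarrow> verma set" where
  "gtset m1 m2 = (\<lambda>p. gv a (m1 - p) p (m2 - p)) ` idx m1 m2"

definition spanned :: "nat \<Rightarrow> nat \<Rightarrow> verma \<Rightarrow> bool" where
  "spanned m1 m2 f \<longleftrightarrow> (\<exists>w\<in>span (gtset m1 m2). rad a b (f - w))"

lemma spanned_rad: "rad a b f \<Longrightarrow> spanned m1 m2 f"
  unfolding spanned_def by (rule bexI[of _ 0]) (simp_all add: span_zero)

lemma spanned_add: "spanned m1 m2 f \<Longrightarrow> spanned m1 m2 g \<Longrightarrow> spanned m1 m2 (f + g)"
proof -
  assume "spanned m1 m2 f" "spanned m1 m2 g"
  then obtain w w' where w: "w \<in> span (gtset m1 m2)" "rad a b (f - w)" "w' \<in> span (gtset m1 m2)" "rad a b (g - w')"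
    by (auto simp: spanned_def)
  then have "rad a b (f + g - (w + w'))"
    using rad_add[OF w(2,4)] by (simp only: add_diff_add)
  then show ?thesis unfolding spanned_def using span_add[OF w(1,3)] by blast
qed

lemma spanned_scale: "spanned m1 m2 f \<Longrightarrow> spanned m1 m2 (r *\<^sub>R f)"
proof -
  assume "spanned m1 m2 f"
  then obtain w where w: "w \<in> span (gtset m1 m2)" "rad a b (f - w)" by (auto simp: spanned_def)
  then have "rad a b (r *\<^sub>R f - r *\<^sub>R w)"
    using rad_scale[OF w(2), of r] by (simp only: scaleR_diff_right)
  then show ?thesis unfolding spanned_def using span_scale[OF w(1)] by blast
qed

lemma spanned_diff: "spanned m1 m2 f \<Longrightarrow> spanned m1 m2 g \<Longrightarrow> spanned m1 m2 (f - g)"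
  using spanned_add[of m1 m2 f "(-1) *\<^sub>R g"] spanned_scale[of m1 m2 g "-1"] by simp

lemma spanned_gv:
  assumes "p < P" "k + p < A + q"
  shows "spanned (k + p) (p + q) (gv a k p q)"
proof -
  have "p \<in> idx (k + p) (p + q)" using assms by (auto simp: idx_def)
  then have "gv a k p q \<in> gtset (k + p) (p + q)"
    unfolding gtset_def by (force intro: rev_image_eqI)
  then show ?thesis unfolding spanned_def by (intro bexI[of _ "gv a k p q"]) (auto simp: span_base)
qed

lemma spanned_image:
  assumes lin: "linear L" and rad: "\<And>f. rad a b f \<Longrightarrow> rad a b (L f)"
    and gen: "\<And>p. p \<in> idx m1 m2 \<Longrightarrow> spanned n1 n2 (L (gv a (m1 - p) p (m2 - p)))"
    and f: "spanned m1 m2 f"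
  shows "spanned n1 n2 (L f)"
proof -
  obtain w where w: "w \<in> span (gtset m1 m2)" "rad a b (f - w)" using f by (auto simp: spanned_def)
  have "spanned n1 n2 (L w)"
    using w(1)
  proof (induction rule: span_induct_alt)
    case base
    show ?case using lin by (simp add: linear_0 spanned_rad)
  next
    case (step r x y)
    then show ?case
      using gen by (auto simp: gtset_def linear_add[OF lin] linear_scale[OF lin] intro!: spanned_add spanned_scale)
  qed
  moreover have "spanned n1 n2 (L (f - w))" by (intro spanned_rad rad w)
  ultimately show ?thesis
    using spanned_add[of n1 n2 "L w" "L (f - w)"] by (simp add: linear_diff[OF lin])
qed

lemma spanned_lower1:
  assumes "spanned m1 m2 f"
  shows "spanned (Suc m1) m2 (lower1 f)"
proof (rule spanned_image[OF linear_ops(1) rad_lower1 _ assms])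
  fix p assume p: "p \<in> idx m1 m2"
  define k q where "k = m1 - p" "q = m2 - p"
  have m: "m1 = k + p" "m2 = p + q" using p by (auto simp: idx_def k_q_def)
  have "p < P" "k + p + p < A + (p + q)" using p m by (auto simp: idx_def)
  show "spanned (Suc m1) m2 (lower1 (gv a (m1 - p) p (m2 - p)))"
  \<comment> \<open>F_1 leaves the family exactly at the end of a string, where the result lies in
    the radical.\<close>
  proof (cases "Suc k + p = A + q")
    case True
    then have "Suc k = A + q - p" by simp
    then show ?thesis
      using rad_gv_string[OF \<open>p < P\<close>, of q] by (simp add: m gv_Suc[symmetric] spanned_rad)
  next
    case False
    then have "Suc k + p < A + q"
      using \<open>k + p + p < A + (p + q)\<close> by simp
    then show ?thesis
      using spanned_gv[of p "Suc k" q] \<open>p < P\<close> by (simp add: m gv_Suc)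
  qed
qed

lemma spanned_lower2:
  assumes "spanned m1 m2 f"
  shows "spanned m1 (Suc m2) (lower2 f)"
proof (rule spanned_image[OF linear_ops(2) rad_lower2 _ assms])
  fix p assume p: "p \<in> idx m1 m2"
  define k q where "k = m1 - p" "q = m2 - p"
  have m: "m1 = k + p" "m2 = p + q" using p by (auto simp: idx_def k_q_def)
  have pk: "p < P" "k + p + p < A + (p + q)" using p m by (auto simp: idx_def)
  note s = pos[OF pk(1), of q]
  have 1: "spanned m1 (Suc m2) (gv a k p (q + 1))"
    using spanned_gv[of p k "q + 1"] pk by (simp add: m)
  show "spanned m1 (Suc m2) (lower2 (gv a (m1 - p) p (m2 - p)))"
  proof (cases k)
    case 0
    then show ?thesis using 1 lower2_gv_0[OF s] by (simp add: m spanned_scale)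
  next
    case (Suc j)
    have "spanned m1 (Suc m2) (gv a j (p + 1) q)"
    \<comment> \<open>F_2 raises p by at most one, and for \<open>p + 1 = P\<close> the new vector
      lies in the radical.\<close>
    proof (cases "p + 1 = P")
      case True
      then show ?thesis using rad_gv_P[of j q] by (simp add: spanned_rad)
    next
      case False
      then show ?thesis using spanned_gv[of "p + 1" j q] pk Suc by (simp add: m)
    qed
    then show ?thesis
      using 1 unfolding m Suc by (simp add: lower2_gv_Suc[OF s] spanned_add spanned_scale del: of_nat_Suc)
  qed
qed

text \<open>The span modulo the radical contains the highest weight vector and is stable under F_1
  and F_2, hence under F_3 = [F_2, F_1]; these build every PBW vector.\<close>

lemma spanned_basis_vec: "spanned (k + c) (c + q) (basis_vec k c q)"
proof (induction k)
  case 0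
  show ?case
  proof (induction c)
    case 0
    show ?case
    proof (induction q)
      case 0
      have "basis_vec 0 0 0 = gv a 0 0 0"
        by (auto simp: fun_eq_iff gv_0 gtvec_def basis_vec_def)
      then show ?case using spanned_gv[of 0 0 0] P_pos P_le by simp
    next
      case (Suc q)
      have "basis_vec 0 0 (Suc q) = lower2 (basis_vec 0 0 q)"
        by (auto simp: fun_eq_iff lower2_def basis_vec_def)
      then show ?case using spanned_lower2[OF Suc] by simp
    qed
  next
    case (Suc c)
    have "basis_vec 0 (Suc c) q = lower3 (basis_vec 0 c q)"
      by (auto simp: fun_eq_iff lower3_def basis_vec_def)
    then show ?case
      using spanned_diff[OF spanned_lower2[OF spanned_lower1[OF Suc]] spanned_lower1[OF spanned_lower2[OF Suc]]]
      by (simp add: lower3_commutator)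
  qed
next
  case (Suc k)
  have "basis_vec (Suc k) c q = lower1 (basis_vec k c q)"
    by (auto simp: fun_eq_iff lower1_def basis_vec_def)
  then show ?case using spanned_lower1[OF Suc] by simp
qed

lemma spanned_coefficients:
  assumes "spanned m1 m2 f"
  shows "\<exists>t. rad a b (f - (\<Sum>p\<in>idx m1 m2. t p *\<^sub>R gv a (m1 - p) p (m2 - p)))"
proof -
  obtain w where w: "w \<in> span (gtset m1 m2)" "rad a b (f - w)" using assms by (auto simp: spanned_def)
  have fin: "finite (idx m1 m2)" by (simp add: idx_def)
  have "\<exists>t. w = (\<Sum>p\<in>idx m1 m2. t p *\<^sub>R gv a (m1 - p) p (m2 - p))"
    using w(1)
  proof (induction rule: span_induct_alt)
    case base
    show ?case by (rule exI[of _ "\<lambda>_. 0"]) simp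
  next
    case (step r x y)
    then obtain t p0 where t: "y = (\<Sum>p\<in>idx m1 m2. t p *\<^sub>R gv a (m1 - p) p (m2 - p))"
      and p0: "p0 \<in> idx m1 m2" "x = gv a (m1 - p0) p0 (m2 - p0)" by (auto simp: gtset_def)
    have "r *\<^sub>R x = (\<Sum>p\<in>idx m1 m2. if p = p0 then r *\<^sub>R gv a (m1 - p) p (m2 - p) else 0)"
      using p0 fin by simp
    then have "r *\<^sub>R x + y = (\<Sum>p\<in>idx m1 m2. ((if p = p0 then r else 0) + t p) *\<^sub>R gv a (m1 - p) p (m2 - p))"
      unfolding t by (simp add: scaleR_add_left sum.distrib if_distrib[of "\<lambda>z. z *\<^sub>R _"] cong: if_cong)
    then show ?case by (rule exI[of _ "\<lambda>p. (if p = p0 then r else 0) + t p"])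
  qed
  then obtain t where "w = (\<Sum>p\<in>idx m1 m2. t p *\<^sub>R gv a (m1 - p) p (m2 - p))" by (elim exE)
  then show ?thesis using w(2) by (intro exI[of _ t]) simp
qed

section \<open>Signs of the norms\<close>

definition gtnorm :: "nat \<Rightarrow> nat \<Rightarrow> nat \<Rightarrow> real" where
  "gtnorm m1 m2 p = form a b m1 m2 (gv a (m1 - p) p (m2 - p)) (gv a (m1 - p) p (m2 - p))"

definition qsign :: "nat \<Rightarrow> real" where "qsign q = sgn (\<Prod>j<q. b - 1 - real j)"

lemma qsign_Suc: "qsign (Suc q) = sgn (b - 1 - real q) * qsign q"
  by (simp add: qsign_def sgn_mult mult.commute)

text \<open>u_0q is F_2^q applied to the highest weight vector, and its norm is q! (b - 1) ... (b -
  q).\<close>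

lemma sgn_norm_top: "sgn (form a b 0 q (gtvec a 0 q) (gtvec a 0 q)) = qsign q"
proof (induction q)
  case 0
  show ?case by (simp add: form_def pairing_def gtvec_def qsign_def)
next
  case (Suc q)
  have l: "lower2 (gtvec a 0 q) = gtvec a 0 (Suc q)"
    using lower2_gtvec[of a q 0] by simp
  have r: "raise2 b (gtvec a 0 (Suc q)) = (real (Suc q) * (b - real (Suc q))) *\<^sub>R gtvec a 0 q"
    using raise2_gtvec[of a "Suc q" 0 b] by (simp add: gtcoeff_def del: of_nat_Suc)
  have "form a b 0 (Suc q) (gtvec a 0 (Suc q)) (gtvec a 0 (Suc q))
      = real (Suc q) * (b - real (Suc q)) * form a b 0 q (gtvec a 0 q) (gtvec a 0 q)"
    using form_lower2[of a b 0 q "gtvec a 0 q" "gtvec a 0 (Suc q)"] unfolding l r form_scale_right .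
  moreover have "b - real (Suc q) = b - 1 - real q" by simp
  ultimately show ?case
    using Suc by (simp only: sgn_mult qsign_Suc) simp
qed

text \<open>The sign does not depend on p. Indeed u_(p+1)q is F_2 F_1 u_pq up to a multiple of F_1
  u_p(q+1), which is orthogonal to it. Moving F_2 across, only the F_1 u_pq component of E_2
  u_(p+1)q contributes, so the norm of u_pq is multiplied by \<open>gtcoeff\<close> and an sl_2
  factor, both positive.\<close>

lemma sgn_norm_singular: "p < P \<Longrightarrow> sgn (form a b p (p + q) (gtvec a p q) (gtvec a p q)) = qsign q"
proof (induction p)
  case 0
  show ?case using sgn_norm_top by simp
next
  case (Suc p)
  then have "p < P" by simp
  note s = pos[OF this, of q] and s' = pos[OF Suc.prems, of q]
  let ?u = "gtvec a (Suc p) q"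
  have u: "?u = lower2 (gv a 1 p q) - gtshift a 1 p q *\<^sub>R gv a 1 p (q + 1)"
    using lower2_gv_Suc[OF s, of 0] by (simp add: gv_0)
  have "form a b (Suc p) (Suc (p + q)) (gv a 1 p (q + 1)) ?u = 0"
    using form_gv_orthogonal[of a q "Suc p" 0 1 b "Suc p" "Suc (p + q)" p "q + 1"] s' by (simp add: gv_0)
  then have "form a b (Suc p) (Suc (p + q)) ?u ?u = form a b (Suc p) (Suc (p + q)) (lower2 (gv a 1 p q)) ?u"
    using form_add_left[of a b "Suc p" "Suc (p + q)" ?u "gtshift a 1 p q *\<^sub>R gv a 1 p (q + 1)" ?u] u
    by (simp add: form_scale_left)
  also have "\<dots> = form a b (Suc p) (p + q) (gv a 1 p q) (raise2 b ?u)"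
    by (rule form_lower2)
  also have "raise2 b ?u = (real q * (b - real q)) *\<^sub>R gv a 0 (Suc p) (q - 1) + gtcoeff a b (Suc p) q *\<^sub>R gv a 1 p q"
    using raise2_gv[of a q "Suc p" b 0] s' by (simp add: gv_0)
  also have "form a b (Suc p) (p + q) (gv a 1 p q)
      ((real q * (b - real q)) *\<^sub>R gv a 0 (Suc p) (q - 1) + gtcoeff a b (Suc p) q *\<^sub>R gv a 1 p q)
    = real q * (b - real q) * form a b (Suc p) (p + q) (gv a 1 p q) (gv a 0 (Suc p) (q - 1))
      + gtcoeff a b (Suc p) q * form a b (Suc p) (p + q) (gv a 1 p q) (gv a 1 p q)"
    by (simp add: form_add_right form_scale_right)
  also have "real q * (b - real q) * form a b (Suc p) (p + q) (gv a 1 p q) (gv a 0 (Suc p) (q - 1)) = 0"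
    using form_gv_orthogonal[of a "q - 1" "Suc p" 0 1 b "Suc p" "p + q" p q] pos[OF Suc.prems, of "q - 1"] by simp
  also have "form a b (Suc p) (p + q) (gv a 1 p q) (gv a 1 p q)
      = (a - 1 + real q - real p) * form a b p (p + q) (gtvec a p q) (gtvec a p q)"
    using form_gv_Suc[of a q p b p "p + q" 0 p q 0] s by (simp add: gv_0)
  finally have "form a b (Suc p) (Suc p + q) ?u ?u
      = gtcoeff a b (Suc p) q * (a - 1 + real q - real p) * form a b p (p + q) (gtvec a p q) (gtvec a p q)"
    by simp
  moreover have "a - 1 + real q - real p > 0" using s' by simp
  moreover have "gtcoeff a b (Suc p) q > 0"
  proof -
    have "a - real (Suc p) > 0" "a + b - real (Suc p) > 0"
      using Suc.prems P_le P_le' by linarith+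
    then show ?thesis using s' by (simp add: gtcoeff_eq del: of_nat_Suc)
  qed
  ultimately show ?case using Suc.IH[OF \<open>p < P\<close>] by (simp add: sgn_mult)
qed

text \<open>Each F_1 multiplies the norm by (k + 1) (a - 1 + q - p - k), which is positive before
  the end of the string.\<close>

lemma sgn_norm_gv:
  assumes "p < P" "k + p < A + q"
  shows "sgn (form a b (k + p) (p + q) (gv a k p q) (gv a k p q)) = qsign q"
  using assms(2)
proof (induction k)
  case 0
  show ?case using sgn_norm_singular[OF assms(1), of q] by (simp add: gv_0)
next
  case (Suc k)
  have "a - 1 + real q - real p - real k > 0" using Suc.prems by linarith
  then show ?case
    using Suc form_gv_Suc[of a q p b "k + p" "p + q" k p q k] pos[OF assms(1), of q]
    by (simp add: sgn_mult)
qed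

lemma sgn_gtnorm: "p \<in> idx m1 m2 \<Longrightarrow> sgn (gtnorm m1 m2 p) = qsign (m2 - p)"
  using sgn_norm_gv[of p "m1 - p" "m2 - p"] by (auto simp: idx_def gtnorm_def)

lemma gtvec_orthogonal:
  assumes "p \<in> idx m1 m2" "p' \<in> idx m1 m2" "p \<noteq> p'"
  shows "form a b m1 m2 (gv a (m1 - p) p (m2 - p)) (gv a (m1 - p') p' (m2 - p')) = 0"
proof -
  have *: "form a b m1 m2 (gv a (m1 - p) p (m2 - p)) (gv a (m1 - p') p' (m2 - p')) = 0"
    if "p \<in> idx m1 m2" "p' \<in> idx m1 m2" "p < p'" for p p'
    using that pos[of p' "m2 - p'"] by (intro form_gv_orthogonal) (auto simp: idx_def)
  show ?thesis
    using *[OF assms(1,2)] *[OF assms(2,1)] assms(3) form_sym by (metis linorder_less_linear)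
qed

end

lemma linear_form_left: "linear (\<lambda>f. form a b m1 m2 f g)"
  by (intro linearI) (simp_all add: form_add_left form_scale_left)

lemma linear_form_right: "linear (\<lambda>g. form a b m1 m2 f g)"
  by (intro linearI) (simp_all add: form_add_right form_scale_right)

lemma form_rad_left: "rad a b (f - f') \<Longrightarrow> form a b m1 m2 f g = form a b m1 m2 f' g"
  using linear_diff[OF linear_form_right[of a b m1 m2 g], of f f']
  by (simp add: rad_iff_form form_sym[of a b m1 m2 _ g])

lemma form_rad_right: "rad a b (g - g') \<Longrightarrow> form a b m1 m2 f g = form a b m1 m2 f g'"
  using form_rad_left[of a b g g' m1 m2 f] by (simp add: form_sym)

context gelfand_tsetlin
begin

lemma sig_gram:
  assumes l: "coord1 l = a" "coord2 l = b"
  shows "of_int (sig (gram l m1 m2)) = (\<Sum>p\<in>idx m1 m2. qsign (m2 - p))"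
proof -
  \<comment> \<open>\<open>idx\<close> is the initial segment below \<open>r\<close>; truncated
    subtraction makes it empty when m1 \<ge> A + m2.\<close>
  define r where "r = min (min (Suc m1) (Suc m2)) (min P (A + m2 - m1))"
  define g where "g p = gv a (m1 - p) p (m2 - p)" for p
  define e where "e c = basis_vec (m1 - c) c (m2 - c)" for c
  have idx: "idx m1 m2 = {..<r}" by (auto simp: idx_def r_def)
  let ?n = "Suc (min m1 m2)"
  let ?B = "form a b m1 m2"
  have "\<forall>c. \<exists>t. c < ?n \<longrightarrow> rad a b (e c - (\<Sum>p<r. t p *\<^sub>R g p))"
  proof
    fix c
    show "\<exists>t. c < ?n \<longrightarrow> rad a b (e c - (\<Sum>p<r. t p *\<^sub>R g p))"
    proof (cases "c < ?n")
      case True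
      then have "spanned m1 m2 (e c)"
        using spanned_basis_vec[of "m1 - c" c "m2 - c"] by (simp add: e_def)
      from spanned_coefficients[OF this] show ?thesis by (simp add: idx g_def)
    qed simp
  qed
  then obtain T where T: "\<And>c. c < ?n \<Longrightarrow> rad a b (e c - (\<Sum>p<r. T c p *\<^sub>R g p))"
    by metis
  have orth: "?B (g k) (g j) = (if k = j then gtnorm m1 m2 k else 0)" if "k < r" "j < r" for k j
    using gtvec_orthogonal[of k m1 m2 j] that idx by (auto simp: g_def gtnorm_def)
  have entry: "gram_entry l m1 m2 c d = ?B (e c) (e d)" for c d
    by (simp add: gram_entry_def l e_def)
  have "sig (mat ?n ?n (\<lambda>(c, d). gram_entry l m1 m2 c d)) = inertia r (gtnorm m1 m2)"
  \<comment> \<open>\<open>T\<close> holds the coefficients of the PBW vectors in the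
    Gelfand-Tsetlin family modulo the radical, \<open>U\<close> the PBW coordinates of the
    Gelfand-Tsetlin vectors.\<close>
  proof (rule sig_eq_inertia[where T = "\<lambda>k c. T c k" and U = "\<lambda>c k. g k (m1 - c) c (m2 - c)"])
    fix c d assume cd: "c < ?n" "d < ?n"
    have "gram_entry l m1 m2 c d = ?B (\<Sum>p<r. T c p *\<^sub>R g p) (\<Sum>p<r. T d p *\<^sub>R g p)"
      unfolding entry form_rad_left[OF T[OF cd(1)]] form_rad_right[OF T[OF cd(2)]] ..
    also have "\<dots> = (\<Sum>k<r. \<Sum>j<r. T c k * (T d j * ?B (g k) (g j)))"
      unfolding linear_sum[OF linear_form_left] linear_sum[OF linear_form_right]
      by (simp only: form_scale_left form_scale_right sum_distrib_left) (subst sum.swap, simp only: mult.left_commute)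
    also have "\<dots> = (\<Sum>k<r. \<Sum>j<r. if j = k then gtnorm m1 m2 k * T c k * T d k else 0)"
      by (intro sum.cong refl) (simp add: orth)
    finally show "gram_entry l m1 m2 c d = (\<Sum>k<r. gtnorm m1 m2 k * T c k * T d k)" by simp
  next
    fix k j assume kj: "k < r" "j < r"
    show "(\<Sum>c<?n. \<Sum>d<?n. g k (m1 - c) c (m2 - c) * gram_entry l m1 m2 c d * g j (m1 - d) d (m2 - d))
        = (if k = j then gtnorm m1 m2 k else 0)"
      unfolding form_expand[symmetric] l orth[OF kj] ..
  qed
  then have "sig (gram l m1 m2) = inertia r (gtnorm m1 m2)" by (simp add: gram_eq)
  also have "real_of_int \<dots> = (\<Sum>p<r. sgn (gtnorm m1 m2 p))"
    unfolding inertia_eq_sum of_int_sum by (intro sum.cong) (auto simp: sgn_if)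
  also have "\<dots> = (\<Sum>p\<in>idx m1 m2. qsign (m2 - p))"
    unfolding idx by (intro sum.cong refl sgn_gtnorm) (simp add: idx)
  finally show ?thesis .
qed

text \<open>For \<beta> \<ge> 1 all factors are positive while q < \<beta>, and from q = \<beta> on
  the factor j = \<beta> - 1 is zero; for \<beta> \<le> 0 all factors are negative.\<close>

lemma qsign_eq:
  assumes "b = of_int \<beta>"
  shows "qsign q = of_int (if \<beta> \<ge> 1 then if int q < \<beta> then 1 else 0 else (- 1) ^ q)"
proof (cases "\<beta> \<ge> 1")
  case True
  show ?thesis
  proof (cases "int q < \<beta>")
    case q: True
    have "(\<Prod>j<q. b - 1 - real j) > 0"
    proof (rule prod_pos)
      fix j assume "j \<in> {..<q}"
      then have "int j + 1 < \<beta>" using q by simp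
      then show "0 < b - 1 - real j" unfolding assms by linarith
    qed
    then show ?thesis using True q by (simp add: qsign_def)
  next
    case False
    then have "nat (\<beta> - 1) \<in> {..<q}" "b - 1 - real (nat (\<beta> - 1)) = 0" using True by (auto simp: assms)
    then have "(\<Prod>j<q. b - 1 - real j) = 0" by (meson finite_lessThan prod_zero)
    then have "qsign q = 0" unfolding qsign_def by (simp only: sgn_0)
    then show ?thesis using True False by simp
  qed
next
  case False
  then have "b \<le> 0" by (simp add: assms)
  then have "sgn (b - 1 - real j) = - 1" for j by simp
  then have "qsign q = (- 1) ^ q"
    unfolding qsign_def by (induction q) (simp_all add: sgn_mult)
  then show ?thesis using False by simp
qed

end

section \<open>Generating functions\<close>

definition fps_swap :: "'a :: zero fps fps \<Rightarrow> 'a fps fps" where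
  "fps_swap f = Abs_fps (\<lambda>n. Abs_fps (\<lambda>m. fps_nth (fps_nth f m) n))"

lemma fps_swap_nth [simp]: "fps_nth (fps_nth (fps_swap f) n) m = fps_nth (fps_nth f m) n"
  by (simp add: fps_swap_def)

lemma fps2_eqI: "(\<And>n m. fps_nth (fps_nth f n) m = fps_nth (fps_nth g n) m) \<Longrightarrow> f = g"
  by (simp add: fps_eq_iff)

lemma fps_swap_swap [simp]: "fps_swap (fps_swap f) = f"
  by (rule fps2_eqI) simp

lemma fps_swap_ring:
  fixes f g :: "int fps fps"
  shows "fps_swap (f + g) = fps_swap f + fps_swap g"
    and "fps_swap (f - g) = fps_swap f - fps_swap g"
    and "fps_swap (f * g) = fps_swap f * fps_swap g"
    and "fps_swap 1 = (1 :: int fps fps)"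
proof -
  show "fps_swap (f * g) = fps_swap f * fps_swap g"
    by (rule fps2_eqI) (simp add: fps_mult_nth fps_sum_nth, rule sum.swap)
qed (rule fps2_eqI; simp)+

lemma fps_swap_sum: "fps_swap (sum f S) = (\<Sum>x\<in>S. fps_swap (f x :: int fps fps))"
  by (rule fps2_eqI) (simp add: fps_sum_nth)

lemma fps_swap_numeral: "fps_swap (numeral k :: int fps fps) = numeral k"
proof -
  have "fps_swap (of_nat n :: int fps fps) = of_nat n" for n
  proof (induction n)
    case 0
    show ?case by (rule fps2_eqI) simp
  next
    case (Suc n)
    then show ?case by (simp add: fps_swap_ring)
  qed
  from this[of "numeral k"] show ?thesis by simp
qed

lemma fps_swap_power: "fps_swap (f ^ n) = fps_swap (f :: int fps fps) ^ n"
  by (induction n) (simp_all add: fps_swap_ring)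

lemma fps_swap_X: "fps_swap X1 = X2" "fps_swap X2 = X1"
proof -
  show "fps_swap X1 = X2"
    by (rule fps2_eqI) (simp add: X1_def X2_def fps_const_def fps_X_def)
  then show "fps_swap X2 = X1" by (metis fps_swap_swap)
qed

lemma fps_swap_ftilde: "fps_swap (ftilde (a1, a2, a3)) = ftilde (a2, a1, a3)"
  unfolding ftilde_def split fps_swap_ring fps_swap_power fps_swap_numeral fps_swap_X
  by (simp add: algebra_simps)

text \<open>The series of s(q) (c x_2)^q; \<open>c = 1\<close> and \<open>c = fps_X\<close> give the
  series in x_2 and in x_1 x_2.\<close>

definition twist :: "(nat \<Rightarrow> int) \<Rightarrow> int fps \<Rightarrow> int fps fps" where
  "twist s c = Abs_fps (\<lambda>q. fps_const (s q) * c ^ q)"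

lemma twist_threshold:
  assumes "B > 0"
  shows "twist (\<lambda>q. if q < B then 1 else 0) c * (1 - fps_const c * fps_X) = 1 - (fps_const c * fps_X) ^ B"
proof (rule fps_ext)
  fix n
  have e: "twist s c * (1 - fps_const c * fps_X) = twist s c - fps_X * (fps_const c * twist s c)" for s
    by (simp add: algebra_simps)
  show "fps_nth (twist (\<lambda>q. if q < B then 1 else 0) c * (1 - fps_const c * fps_X)) n
      = fps_nth (1 - (fps_const c * fps_X) ^ B) n"
    unfolding e power_mult_distrib fps_const_power using assms
    by (cases n) (auto simp: twist_def fps_X_power_nth not_less less_Suc_eq)
qed

lemma twist_alternating: "twist (\<lambda>q. (- 1) ^ q) c * (1 + fps_const c * fps_X) = 1"
proof (rule fps_ext)
  fix n
  have e: "twist s c * (1 + fps_const c * fps_X) = twist s c + fps_X * (fps_const c * twist s c)" for s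
    by (simp add: algebra_simps)
  show "fps_nth (twist (\<lambda>q. (- 1) ^ q) c * (1 + fps_const c * fps_X)) n = fps_nth 1 n"
    unfolding e
    by (cases n) (simp_all add: twist_def mult.left_commute del: fps_const_neg flip: fps_const_neg)
qed

text \<open>Multiplication by 1 - x_1 telescopes along each string. The vectors F_1^k u_pq with k <
  A + q - p leave the start (x_1 x_2)^p x_2^q minus the position just past the end, x_1^A x_2^p (x_1
  x_2)^q, both weighted by s(q); the sums over p and q then factor.\<close>

lemma string_generating_function:
  assumes PA: "P \<le> A"
    and S: "\<And>m1 m2. fps_nth (fps_nth S m2) m1 = (\<Sum>p | p \<le> m1 \<and> p \<le> m2 \<and> p < P \<and> m1 + p < A + m2. s (m2 - p))"
  shows "(1 - X1) * S = (\<Sum>p<P. (X1 * X2) ^ p) * twist s 1 - X1 ^ A * (\<Sum>p<P. X2 ^ p) * twist s fps_X"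
proof -
  have X1: "fps_nth (fps_nth (X1 ^ k * f) m2) m1 = (if m1 < k then 0 else fps_nth (fps_nth f m2) (m1 - k))" for k f m1 m2
    by (simp add: X1_def fps_const_power fps_X_power_mult_nth)
  have X2: "fps_nth (fps_nth (X2 ^ k * f) m2) m1 = (if m2 < k then 0 else fps_nth (fps_nth f (m2 - k)) m1)" for k f m1 m2
    by (simp add: X2_def fps_X_power_mult_nth)
  have t1: "fps_nth (fps_nth (twist s 1) m2) m1 = (if m1 = 0 then s m2 else 0)" for m1 m2
    by (simp add: twist_def)
  have t2: "fps_nth (fps_nth (twist s fps_X) m2) m1 = (if m1 = m2 then s m2 else 0)" for m1 m2
    by (simp add: twist_def fps_X_power_nth)
  have Sd: "fps_nth (fps_nth S m2) m1
      = (\<Sum>p<P. if p \<le> m1 \<and> p \<le> m2 \<and> m1 + p < A + m2 then s (m2 - p) else 0)" for m1 m2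
    unfolding S by (rule sum.mono_neutral_cong_left) auto
  have "(1 - X1) * S = (\<Sum>p<P. X1 ^ p * (X2 ^ p * twist s 1) - X1 ^ A * (X2 ^ p * twist s fps_X))"
  proof (rule fps2_eqI)
    fix m2 m1
    have "fps_nth (fps_nth ((1 - X1) * S) m2) m1
      = fps_nth (fps_nth S m2) m1 - fps_nth (fps_nth (X1 ^ 1 * S) m2) m1"
      by (simp add: algebra_simps)
    also have "\<dots> = (\<Sum>p<P. (if p \<le> m1 \<and> p \<le> m2 \<and> m1 + p < A + m2 then s (m2 - p) else 0)
        - (if m1 \<ge> 1 \<and> p \<le> m1 - 1 \<and> p \<le> m2 \<and> m1 - 1 + p < A + m2 then s (m2 - p) else 0))"
      unfolding X1 Sd sum_subtractf by (cases "m1 = 0") auto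
    also have "\<dots> = (\<Sum>p<P. fps_nth (fps_nth (X1 ^ p * (X2 ^ p * twist s 1) - X1 ^ A * (X2 ^ p * twist s fps_X)) m2) m1)"
    proof (rule sum.cong[OF refl])
      fix p assume "p \<in> {..<P}"
      then have "p < A" using PA by simp
      have *: "m1 - A = m2 - p \<and> A \<le> m1 \<and> p \<le> m2 \<longleftrightarrow> m1 + p = A + m2 \<and> p \<le> m2" by auto
      show "(if p \<le> m1 \<and> p \<le> m2 \<and> m1 + p < A + m2 then s (m2 - p) else 0)
        - (if m1 \<ge> 1 \<and> p \<le> m1 - 1 \<and> p \<le> m2 \<and> m1 - 1 + p < A + m2 then s (m2 - p) else 0)
        = fps_nth (fps_nth (X1 ^ p * (X2 ^ p * twist s 1) - X1 ^ A * (X2 ^ p * twist s fps_X)) m2) m1"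
      proof (cases "p \<le> m2")
        case True
        \<comment> \<open>Positions before the string, at its start, inside it, just past its end,
          and beyond; \<open>p < A\<close> keeps the start apart from the position just past the
          end.\<close>
        have "m1 < p \<or> m1 = p \<or> p < m1 \<and> m1 + p < A + m2 \<or> m1 + p = A + m2 \<and> p < m1 \<or> m1 + p > A + m2 \<and> p < m1"
          using True \<open>p < A\<close> by linarith
        then show ?thesis
          using True \<open>p < A\<close> by (elim disjE) (auto simp: X1 X2 t1 t2)
      qed (simp add: X1 X2)
    qed
    finally show "fps_nth (fps_nth ((1 - X1) * S) m2) m1
      = fps_nth (fps_nth (\<Sum>p<P. X1 ^ p * (X2 ^ p * twist s 1) - X1 ^ A * (X2 ^ p * twist s fps_X)) m2) m1"
      by (simp add: fps_sum_nth)
  qed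
  also have "\<dots> = (\<Sum>p<P. (X1 * X2) ^ p) * twist s 1 - X1 ^ A * (\<Sum>p<P. X2 ^ p) * twist s fps_X"
    by (simp add: sum_subtractf sum_distrib_left sum_distrib_right power_mult_distrib mult.assoc)
  finally show ?thesis .
qed

section \<open>Comparison with the four values of \<open>ftilde\<close>\<close>

lemma geometric_sum: "(\<Sum>p<n. (t :: 'a :: comm_ring_1) ^ p) * (1 - t) = 1 - t ^ n"
  by (simp add: one_diff_power_eq mult.commute)

text \<open>Nothing is inverted: each geometric series enters through the equation that clears its
  denominator.\<close>

lemma multiply_out_dominant:
  fixes x y :: "'a :: comm_ring_1"
  assumes "(1 - x) * S = G * T - u * H * T'"
    and "G * (1 - x * y) = g" "H * (1 - y) = h" "T * (1 - y) = t" "T' * (1 - x * y) = t'"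
  shows "S * (4 * (1 - x ^ 2) * (1 - y ^ 2) * (1 - x ^ 2 * y ^ 2))
    = 4 * (1 + x) * (1 + y) * (1 + x * y) * (g * t - u * h * t')"
proof -
  have "S * (4 * (1 - x ^ 2) * (1 - y ^ 2) * (1 - x ^ 2 * y ^ 2))
     = 4 * (1 + x) * (1 + y) * (1 + x * y) * (((1 - x) * S) * (1 - y) * (1 - x * y))"
    by (simp add: power2_eq_square algebra_simps)
  also have "((1 - x) * S) * (1 - y) * (1 - x * y)
     = (G * (1 - x * y)) * (T * (1 - y)) - u * (H * (1 - y)) * (T' * (1 - x * y))"
    unfolding assms(1) by (simp add: algebra_simps)
  finally show ?thesis unfolding assms(2-) .
qed

lemma multiply_out_alternating:
  fixes x y :: "'a :: comm_ring_1"
  assumes "(1 - x) * S = G * T - u * H * T'"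
    and "G * (1 - x * y) = g" "H * (1 - y) = h" "T * (1 + y) = 1" "T' * (1 + x * y) = 1"
  shows "S * (4 * (1 - x ^ 2) * (1 - y ^ 2) * (1 - x ^ 2 * y ^ 2))
    = 4 * (1 + x) * (g * (1 - y) * (1 + x * y) - u * h * (1 + y) * (1 - x * y))"
proof -
  have "S * (4 * (1 - x ^ 2) * (1 - y ^ 2) * (1 - x ^ 2 * y ^ 2))
     = 4 * (1 + x) * (((1 - x) * S) * ((1 - y) * (1 + y) * (1 - x * y) * (1 + x * y)))"
    by (simp add: power2_eq_square algebra_simps)
  also have "((1 - x) * S) * ((1 - y) * (1 + y) * (1 - x * y) * (1 + x * y))
     = (G * (1 - x * y)) * (T * (1 + y)) * (1 - y) * (1 + x * y)
       - u * (H * (1 - y)) * (T' * (1 + x * y)) * (1 + y) * (1 - x * y)"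
    unfolding assms(1) by (simp add: algebra_simps)
  finally show ?thesis unfolding assms(2-) by simp
qed

text \<open>All four corners satisfy a_1 \<le> a_3 and a_2 \<le> a_3, so every \<open>min\<close>
  and \<open>max\<close> is resolved in the same way.\<close>

lemma ftilde_sum_dominant:
  assumes "A > 0" "B > 0"
  shows "ftilde (A, B, A + B) + ftilde (A - 1, B, A + B) + ftilde (A, B - 1, A + B - 1) + ftilde (A - 1, B - 1, A + B - 1)
    = 4 * (1 + X1) * (1 + X2) * (1 + X1 * X2) * ((1 - (X1 * X2) ^ A) * (1 - X2 ^ B) - X1 ^ A * (1 - X2 ^ A) * (1 - (X1 * X2) ^ B))"
proof -
  obtain c d where cd: "A = Suc c" "B = Suc d" using assms by (metis gr0_implies_Suc)
  have f: "ftilde (a1, a2, a3) = (1 + X1) * (1 + X2) * (1 + X1 * X2)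
     - 2 * X1 ^ (a1 + 1) * (1 + X2) * (1 + X1 * X2)
     - 2 * X2 ^ (a2 + 1) * (1 + X1) * (1 + X1 * X2)
     - 2 * (X1 * X2) ^ (a3 + 1) * (1 + X1) * (1 + X2)
     + 4 * X1 ^ (a1 + 1) * (X1 * X2) ^ (a2 + 1) * (1 + X2)
     + 4 * X2 ^ (a2 + 1) * (X1 * X2) ^ (a1 + 1) * (1 + X1)
     + 4 * X1 ^ (a3 + 1) * X2 ^ (a3 + 1) * (1 + X1 * X2)
     - 8 * X1 ^ (a2 + a1 + 2) * X2 ^ (a1 + a2 + 2)" if "a1 \<le> a3" "a2 \<le> a3" for a1 a2 a3
    using that by (simp add: ftilde_def min_absorb1 max_absorb2)
  show ?thesis
    unfolding cd
    by (simp only: f diff_Suc_1 add_Suc add_Suc_right le_add1 le_add2 le_SucI order_refl)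
      (simp add: power_add power_mult_distrib algebra_simps)
qed

text \<open>The corners with a_2 = 0 have a_3 \<le> a_1, except that for P = A the corner (A - 1, 0,
  P) has a_3 = a_1 + 1.\<close>

lemma ftilde_0:
  "a3 \<le> a1 \<Longrightarrow> ftilde (a1, 0, a3) = (1 + X1) * (1 + X2) * (1 + X1 * X2)
     - 2 * X1 ^ (a1 + 1) * (1 + X2) * (1 + X1 * X2)
     - 2 * X2 * (1 + X1) * (1 + X1 * X2)
     - 2 * (X1 * X2) ^ (a3 + 1) * (1 + X1) * (1 + X2)
     + 4 * X1 ^ (a1 + 1) * (X1 * X2) * (1 + X2)
     + 4 * X2 * (X1 * X2) ^ (a3 + 1) * (1 + X1)
     + 4 * X1 ^ (a1 + 1) * X2 ^ (a3 + 1) * (1 + X1 * X2)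
     - 8 * X1 ^ (a1 + 2) * X2 ^ (a3 + 2)"
  "ftilde (c, 0, Suc c) = (1 + X1) * (1 + X2) * (1 + X1 * X2)
     - 2 * X1 ^ (c + 1) * (1 + X2) * (1 + X1 * X2)
     - 2 * X2 * (1 + X1) * (1 + X1 * X2)
     - 2 * (X1 * X2) ^ (c + 2) * (1 + X1) * (1 + X2)
     + 4 * X1 ^ (c + 1) * (X1 * X2) * (1 + X2)
     + 4 * X2 * (X1 * X2) ^ (c + 1) * (1 + X1)
     + 4 * X1 ^ (c + 2) * X2 ^ (c + 2) * (1 + X1 * X2)
     - 8 * X1 ^ (c + 2) * X2 ^ (c + 2)"
  by (simp_all add: ftilde_def min_absorb2 max_absorb1)

lemma ftilde_sum_alternating:
  assumes "P > 0" "P \<le> A"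
  shows "ftilde (A, 0, P) + ftilde (A - 1, 0, P) + ftilde (A, 0, P - 1) + ftilde (A - 1, 0, P - 1)
    = 4 * (1 + X1) * ((1 - (X1 * X2) ^ P) * (1 - X2) * (1 + X1 * X2) - X1 ^ A * (1 - X2 ^ P) * (1 + X2) * (1 - X1 * X2))"
proof -
  obtain c d where cd: "A = Suc c" "P = Suc d" using assms by (metis gr0_implies_Suc less_le_trans)
  show ?thesis
  proof (cases "A = P")
    case True
    then show ?thesis
      unfolding cd by (simp add: ftilde_0 power_mult_distrib algebra_simps)
  next
    case False
    then have "d \<le> c" "Suc d \<le> c" "d \<le> Suc c" using assms cd by auto
    then show ?thesis
      unfolding cd by (simp add: ftilde_0(1) power_mult_distrib algebra_simps)
  qed
qed

section \<open>The signature character at an integral point\<close>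

lemma sigma_nth: "fps_nth (fps_nth (sigma l) m2) m1 = sig (gram l m1 m2)"
  by (simp add: sigma_def)

lemma sig_gram_swap: "sig (gram l m1 m2) = sig (gram (prod.swap l) m2 m1)"
proof -
  let ?n = "Suc (min m1 m2)"
  have "sig (mat ?n ?n (\<lambda>(c, d). gram_entry l m1 m2 c d))
      = sig (mat ?n ?n (\<lambda>(c, d). gram_entry (prod.swap l) m2 m1 c d))"
  proof (rule sig_cong[where
        T = "\<lambda>k i. ev (swap_comb (pbw m1 m2 i)) (m2 - k) k (m1 - k)" and
        U = "\<lambda>k i. ev (swap_comb (pbw m2 m1 i)) (m1 - k) k (m2 - k)"])
    show "gram_entry (prod.swap l) m2 m1 i j = gram_entry (prod.swap l) m2 m1 j i" for i j
      by (rule gram_entry_sym)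
    show "gram_entry l m1 m2 i j = (\<Sum>k<?n. \<Sum>r<?n. ev (swap_comb (pbw m1 m2 i)) (m2 - k) k (m1 - k)
        * gram_entry (prod.swap l) m2 m1 k r * ev (swap_comb (pbw m1 m2 j)) (m2 - r) r (m1 - r))"
      if "i < ?n" "j < ?n" for i j
      by (rule gram_entry_swap[OF that])
    show "gram_entry (prod.swap l) m2 m1 i j = (\<Sum>k<?n. \<Sum>r<?n. ev (swap_comb (pbw m2 m1 i)) (m1 - k) k (m2 - k)
        * gram_entry l m1 m2 k r * ev (swap_comb (pbw m2 m1 j)) (m1 - r) r (m2 - r))"
      if "i < ?n" "j < ?n" for i j
      using gram_entry_swap[of i m2 m1 j "prod.swap l"] that by (simp only: min.commute[of m2 m1] swap_swap)
  qed
  then show ?thesis by (simp add: gram_eq min.commute)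
qed

lemma sigma_swap: "sigma l = fps_swap (sigma (prod.swap l))"
  by (rule fps2_eqI) (simp add: sigma_nth sig_gram_swap[of l])

section \<open>The four regions around the point\<close>

lemma ip_alpha_shift:
  "ip (alpha k) (l + s *\<^sub>R Lambda 2 + t *\<^sub>R alpha 1 + rho)
    = (if k = 1 then coord1 l + 2 * t else if k = 2 then coord2 l + s - t
       else if k = 3 then coord1 l + coord2 l + s + t else 0)"
  by (auto simp: ip_def alpha_def Lambda_def rho_def coord1_def coord2_def algebra_simps)

lemma avec_shift:
  "avec (l + s *\<^sub>R Lambda 2 + t *\<^sub>R alpha 1)
    = (nat \<lfloor>coord1 l + 2 * t\<rfloor>, nat \<lfloor>coord2 l + s - t\<rfloor>, nat \<lfloor>coord1 l + coord2 l + s + t\<rfloor>)"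
  unfolding avec_def ip_alpha_shift by simp

text \<open>For \<beta> \<ge> 1 one has P = A and \<open>s\<close> is the indicator of q < \<beta>.
  Otherwise P = A + \<beta>, \<open>s\<close> alternates, and \<open>nat\<close> truncates both
  values of a_2 to 0, as \<open>avec\<close> does.\<close>

lemma sigma_integral:
  assumes l: "coord1 l = real A" "coord2 l = of_int \<beta>" and A: "A > 0" and A\<beta>: "int A + \<beta> > 0"
  shows "sigma l * (4 * (1 - X1 ^ 2) * (1 - X2 ^ 2) * (1 - X1 ^ 2 * X2 ^ 2))
    = ftilde (A, nat \<beta>, nat (int A + \<beta>)) + ftilde (A - 1, nat \<beta>, nat (int A + \<beta>))
      + ftilde (A, nat (\<beta> - 1), nat (int A + \<beta> - 1)) + ftilde (A - 1, nat (\<beta> - 1), nat (int A + \<beta> - 1))"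
proof -
  define P where "P = nat (min (int A) (int A + \<beta>))"
  define s :: "nat \<Rightarrow> int" where "s q = (if \<beta> \<ge> 1 then if int q < \<beta> then 1 else 0 else (- 1) ^ q)" for q
  interpret gelfand_tsetlin A P "of_int \<beta>"
  proof
    show "P > 0" "P \<le> A" using A A\<beta> by (auto simp: P_def)
    have "int P \<le> int A + \<beta>" "int P = int A \<or> int P = int A + \<beta>" using A A\<beta> by (auto simp: P_def)
    then show "real P \<le> real A + of_int \<beta>" "P = A \<or> real P = real A + of_int \<beta>" by linarith+
  qed
  have coeff: "fps_nth (fps_nth (sigma l) m2) m1
      = (\<Sum>p | p \<le> m1 \<and> p \<le> m2 \<and> p < P \<and> m1 + p < A + m2. s (m2 - p))" for m1 m2
  proof -
    have "real_of_int (sig (gram l m1 m2)) = real_of_int (\<Sum>p\<in>idx m1 m2. s (m2 - p))"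
      unfolding sig_gram[OF l] qsign_eq[OF refl] of_int_sum s_def ..
    then show ?thesis by (simp only: of_int_eq_iff sigma_nth idx_def)
  qed
  note gen = string_generating_function[OF P_le coeff]
  note g1 = geometric_sum[of "X1 * X2" P] and g2 = geometric_sum[of X2 P]
  have X: "fps_const 1 * fps_X = X2" "fps_const fps_X * fps_X = X1 * X2"
    by (simp_all add: X1_def X2_def)
  show ?thesis
  proof (cases "\<beta> \<ge> 1")
    case True
    define B where "B = nat \<beta>"
    have B: "B > 0" "\<beta> = int B" using True by (simp_all add: B_def)
    have s: "s = (\<lambda>q. if q < B then 1 else 0)" using True by (auto simp: s_def B)
    have "P = A" using True by (simp add: P_def)
    have n: "nat \<beta> = B" "nat (int A + \<beta>) = A + B" "nat (\<beta> - 1) = B - 1" "nat (int A + \<beta> - 1) = A + B - 1"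
      using B by auto
    show ?thesis
      using multiply_out_dominant[OF gen g1 g2 twist_threshold[OF B(1), of 1, folded s, unfolded X]
          twist_threshold[OF B(1), of fps_X, folded s, unfolded X]]
      unfolding n ftilde_sum_dominant[OF A B(1)] \<open>P = A\<close> .
  next
    case False
    have s: "s = (\<lambda>q. (- 1) ^ q)" using False by (auto simp: s_def)
    have n: "nat \<beta> = 0" "nat (int A + \<beta>) = P" "nat (\<beta> - 1) = 0" "nat (int A + \<beta> - 1) = P - 1"
      using False A\<beta> by (auto simp: P_def)
    show ?thesis
      using multiply_out_alternating[OF gen g1 g2 twist_alternating[of 1, folded s, unfolded X]
          twist_alternating[of fps_X, folded s, unfolded X]]
      unfolding n ftilde_sum_alternating[OF P_pos P_le] .
  qed
qed

text \<open>The bound 1/2 gives 2 \<delta> < 1 and \<epsilon> + \<delta> < 1, so each floor moves by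
  at most one. By \<delta> < \<epsilon> the sign of s alone decides the floors of the second and
  third coordinates, while s' decides the first.\<close>

lemma sigma_average:
  assumes l: "coord1 l = real A" "coord2 l = of_int \<beta>" and A: "A > 0" and A\<beta>: "int A + \<beta> > 0"
    and \<epsilon>: "0 < \<delta>" "\<delta> < \<epsilon>" "\<epsilon> < 1 / 2"
  shows "sigma l * (4 * (1 - X1 ^ 2) * (1 - X2 ^ 2) * (1 - X1 ^ 2 * X2 ^ 2))
    = (\<Sum>s\<in>{1, -1::real}. \<Sum>s'\<in>{1, -1::real}. ftilde (avec (l + (s * \<epsilon>) *\<^sub>R Lambda 2 + (s' * \<delta>) *\<^sub>R alpha 1)))"
proof -
  have corner:
    "avec (l + (1 * \<epsilon>) *\<^sub>R Lambda 2 + (1 * \<delta>) *\<^sub>R alpha 1) = (A, nat \<beta>, nat (int A + \<beta>))"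
    "avec (l + (1 * \<epsilon>) *\<^sub>R Lambda 2 + (- 1 * \<delta>) *\<^sub>R alpha 1) = (A - 1, nat \<beta>, nat (int A + \<beta>))"
    "avec (l + (- 1 * \<epsilon>) *\<^sub>R Lambda 2 + (1 * \<delta>) *\<^sub>R alpha 1) = (A, nat (\<beta> - 1), nat (int A + \<beta> - 1))"
    "avec (l + (- 1 * \<epsilon>) *\<^sub>R Lambda 2 + (- 1 * \<delta>) *\<^sub>R alpha 1) = (A - 1, nat (\<beta> - 1), nat (int A + \<beta> - 1))"
  proof -
    have fl: "\<lfloor>x\<rfloor> = k" if "of_int k \<le> x" "x < of_int k + 1" for x :: real and k
      using that by (rule floor_unique)
    have n_eq: "x = int A \<Longrightarrow> nat x = A" "x = int A - 1 \<Longrightarrow> nat x = A - 1" for x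
      by simp_all
    show "avec (l + (1 * \<epsilon>) *\<^sub>R Lambda 2 + (1 * \<delta>) *\<^sub>R alpha 1) = (A, nat \<beta>, nat (int A + \<beta>))"
      "avec (l + (1 * \<epsilon>) *\<^sub>R Lambda 2 + (- 1 * \<delta>) *\<^sub>R alpha 1) = (A - 1, nat \<beta>, nat (int A + \<beta>))"
      "avec (l + (- 1 * \<epsilon>) *\<^sub>R Lambda 2 + (1 * \<delta>) *\<^sub>R alpha 1) = (A, nat (\<beta> - 1), nat (int A + \<beta> - 1))"
      "avec (l + (- 1 * \<epsilon>) *\<^sub>R Lambda 2 + (- 1 * \<delta>) *\<^sub>R alpha 1) = (A - 1, nat (\<beta> - 1), nat (int A + \<beta> - 1))"
      using \<epsilon> unfolding avec_shift l prod.inject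
      by (intro conjI n_eq arg_cong[where f = nat] fl; simp)+
  qed
  have expand: "(\<Sum>s\<in>{1, -1::real}. \<Sum>s'\<in>{1, -1::real}. f s s') = f 1 1 + f 1 (- 1) + (f (- 1) 1 + f (- 1) (- 1))"
    for f :: "real \<Rightarrow> real \<Rightarrow> int fps fps"
    by simp
  show ?thesis
    unfolding sigma_integral[OF l A A\<beta>] expand corner by (simp only: add.assoc)
qed

text \<open>The second line belongs to another root, since two distinct lines for the same root are
  disjoint. For \<alpha>_2 it prescribes b, for \<alpha>_3 it prescribes a + b; either way b is an
  integer and a + b > 0.\<close>

lemma integral_coordinates:
  assumes "on_vline n 1 l" and "\<exists>n' k. (n', k) \<noteq> (n, 1) \<and> on_vline n' k l"
  obtains \<beta> :: int where "coord1 l = real n" "coord2 l = of_int \<beta>" "n > 0" "int n + \<beta> > 0"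
proof -
  have 1: "coord1 l = real n" "n > 0" using assms(1) by (auto simp: on_vline_def coord1_def)
  have 3: "ip (alpha 3) (l + rho) = coord1 l + coord2 l"
    by (simp add: ip_def alpha_def coord1_def coord2_def)
  obtain n' k where k: "(n', k) \<noteq> (n, 1)" "on_vline n' k l" using assms(2) by auto
  then consider "k = 1" | "k = 2" | "k = 3" by (auto simp: on_vline_def)
  then show ?thesis
  proof cases
    case 1
    then show ?thesis using k assms(1) by (auto simp: on_vline_def)
  next
    case 2
    then show ?thesis using k 1 by (intro that[of "int n'"]) (auto simp: on_vline_def coord2_def)
  next
    case c: 3
    then have "coord1 l + coord2 l = real n'" "n' \<ge> 1" using k 3 by (auto simp: on_vline_def)
    then show ?thesis using 1 by (intro that[of "int n' - int n"]) auto
  qed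
qed

lemma on_vline_swap: "on_vline n k (prod.swap l) \<longleftrightarrow> on_vline n (if k = 1 then 2 else if k = 2 then 1 else k) l"
  by (auto simp: on_vline_def ip_def alpha_def rho_def algebra_simps)

lemma fps_swap_ftilde_avec: "fps_swap (ftilde (avec m)) = ftilde (avec (prod.swap m))"
  by (simp add: avec_def fps_swap_ftilde ip_def alpha_def rho_def algebra_simps)

theorem theorem9:
  fixes l :: wt and i ni :: nat
  assumes "i \<in> {1, 2}"
    and "on_vline ni i l"
    and "\<exists>n k. (n, k) \<noteq> (ni, i) \<and> on_vline n k l"
  shows "\<exists>e0 > 0. \<forall>\<epsilon> \<delta>. 0 < \<delta> \<and> \<delta> < \<epsilon> \<and> \<epsilon> < e0 \<longrightarrow>
           sigma l * (4 * (1 - X1 ^ 2) * (1 - X2 ^ 2) * (1 - X1 ^ 2 * X2 ^ 2))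
         = (\<Sum>s\<in>{1, -1::real}. \<Sum>s'\<in>{1, -1::real}.
              ftilde (avec (l + (s * \<epsilon>) *\<^sub>R Lambda (3 - i) + (s' * \<delta>) *\<^sub>R alpha i)))"
proof (intro exI[of _ "1 / 2"] conjI allI impI)
  fix \<epsilon> \<delta> :: real
  assume "0 < \<delta> \<and> \<delta> < \<epsilon> \<and> \<epsilon> < 1 / 2"
  then have \<epsilon>: "0 < \<delta>" "\<delta> < \<epsilon>" "\<epsilon> < 1 / 2" by auto
  from assms(1) consider "i = 1" | "i = 2" by auto
  then show "sigma l * (4 * (1 - X1 ^ 2) * (1 - X2 ^ 2) * (1 - X1 ^ 2 * X2 ^ 2))
         = (\<Sum>s\<in>{1, -1::real}. \<Sum>s'\<in>{1, -1::real}.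
              ftilde (avec (l + (s * \<epsilon>) *\<^sub>R Lambda (3 - i) + (s' * \<delta>) *\<^sub>R alpha i)))"
  proof cases
    case 1
    obtain \<beta> where "coord1 l = real ni" "coord2 l = of_int \<beta>" "ni > 0" "int ni + \<beta> > 0"
      by (rule integral_coordinates[OF assms(2,3)[unfolded 1]])
    from sigma_average[OF this \<epsilon>] show ?thesis unfolding 1 by simp
  next
    case 2
    \<comment> \<open>Swapping the coordinates exchanges the simple roots. \<open>sigma_swap\<close>
      and \<open>fps_swap_ftilde_avec\<close> carry both sides of the identity along, and the
      denominator is symmetric in x_1 and x_2.\<close>
    let ?l = "prod.swap l"
    have v1: "on_vline ni 1 ?l" using assms(2) unfolding 2 by (simp add: on_vline_swap)
    obtain n k where nk: "(n, k) \<noteq> (ni, 2)" "on_vline n k l" using assms(3) unfolding 2 by auto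
    then have "k \<in> {1, 2, 3}" by (simp add: on_vline_def)
    then have "(n, if k = 1 then 2 else if k = 2 then 1 else k) \<noteq> (ni, 1) \<and>
        on_vline n (if k = 1 then 2 else if k = 2 then 1 else k) ?l"
      using nk unfolding on_vline_swap by auto
    then have v2: "\<exists>n' k'. (n', k') \<noteq> (ni, 1) \<and> on_vline n' k' ?l" by blast
    obtain \<beta> where "coord1 ?l = real ni" "coord2 ?l = of_int \<beta>" "ni > 0" "int ni + \<beta> > 0"
      using integral_coordinates[OF v1 v2] .
    note avg = sigma_average[OF this \<epsilon>]
    have shift: "prod.swap (?l + s *\<^sub>R Lambda 2 + t *\<^sub>R alpha 1) = l + s *\<^sub>R Lambda 1 + t *\<^sub>R alpha 2" for s t
      by (cases l) (simp add: Lambda_def alpha_def)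
    have "sigma l * (4 * (1 - X1 ^ 2) * (1 - X2 ^ 2) * (1 - X1 ^ 2 * X2 ^ 2))
        = fps_swap (sigma ?l * (4 * (1 - X1 ^ 2) * (1 - X2 ^ 2) * (1 - X1 ^ 2 * X2 ^ 2)))"
      unfolding fps_swap_ring fps_swap_power fps_swap_numeral fps_swap_X sigma_swap[of l]
      by (simp only: mult_ac)
    also have "\<dots> = (\<Sum>s\<in>{1, -1::real}. \<Sum>s'\<in>{1, -1::real}.
        ftilde (avec (l + (s * \<epsilon>) *\<^sub>R Lambda 1 + (s' * \<delta>) *\<^sub>R alpha 2)))"
      unfolding avg by (simp only: fps_swap_sum fps_swap_ftilde_avec shift)
    finally show ?thesis unfolding 2 by simp
  qed
qed simp

end
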